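(* Let $R=\mathbb{C}\langle x,y\rangle/(xy-yx-y^2)$, let $n\ge 1$, and let $\mathrm{mod}(R,n)=\{(X,Y)\in M_n(\mathbb{C})^2 : XY-YX=Y^2\}$. Then: (1) every irreducible component of the variety $\mathrm{mod}(R,n)$ contains exactly one of the strata $\mathcal{U}_{\mathcal{P}}$ ($\mathcal{P}$ a partition of $n$), and is the Zariski closure of this stratum; (2) the number of irreducible components of $\mathrm{mod}(R,n)$ is equal to the number of partitions of $n$; (3) the variety $\mathrm{mod}(R,n)$ is equidimensional, and every irreducible component has dimension $n^2$.
   Context: For every $(X,Y)\in\mathrm{mod}(R,n)$ the matrix $Y$ is nilpotent. For a partition $\mathcal{P}$ of $n$, the stratum $\mathcal{U}_{\mathcal{P}}\subset\mathrm{mod}(R,n)$ is the set of all pairs $(X,Y)\in\mathrm{mod}(R,n)$ such that the sizes of the Jordan blocks of the (nilpotent) matrix $Y$ are the parts of $\mathcal{P}$. *)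

theory Defs
  imports
    "HOL-Analysis.Abstract_Topology"
    "HOL-Library.Extended_Nat"
    "HOL-Library.Multiset"
    "Jordan_Normal_Form.Jordan_Normal_Form"
begin

definition irreducible_subset :: "'a topology \<Rightarrow> 'a set \<Rightarrow> bool" where
  "irreducible_subset T A \<longleftrightarrow> A \<subseteq> topspace T \<and> A \<noteq> {} \<and>
     (\<forall>C D. closedin T C \<and> closedin T D \<and> A \<subseteq> C \<union> D \<longrightarrow> A \<subseteq> C \<or> A \<subseteq> D)"

definition irreducible_components :: "'a topology \<Rightarrow> 'a set set" where
  "irreducible_components T =
     {Z. irreducible_subset T Z \<and> (\<forall>A. irreducible_subset T A \<and> Z \<subseteq> A \<longrightarrow> A = Z)}"

text \<open>
  Krull dimension: the supremum of the lengths \<open>k\<close> of strictly increasing chains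
  \<open>C 0 \<subset> C 1 \<subset> \<dots> \<subset> C k\<close> of irreducible closed subsets.
  The empty space gets the value \<open>0\<close> here.
\<close>

definition krull_dim :: "'a topology \<Rightarrow> enat" where
  "krull_dim T = Sup {enat k | k. \<exists>C :: nat \<Rightarrow> 'a set.
     (\<forall>i\<le>k. closedin T (C i) \<and> irreducible_subset T (C i)) \<and>
     (\<forall>i<k. C i \<subset> C (Suc i))}"

definition equidimensional :: "'a topology \<Rightarrow> bool" where
  "equidimensional T \<longleftrightarrow>
     (\<forall>Z\<in>irreducible_components T. \<forall>Z'\<in>irreducible_components T.
        krull_dim (subtopology T Z) = krull_dim (subtopology T Z'))"

definition mat_pairs :: "nat \<Rightarrow> (complex mat \<times> complex mat) set" where
  "mat_pairs n = carrier_mat n n \<times> carrier_mat n n"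

text \<open>Polynomials in the \<open>2 * n\<^sup>2\<close> matrix entries, regarded as functions.\<close>

inductive_set poly_funs :: "nat \<Rightarrow> (complex mat \<times> complex mat \<Rightarrow> complex) set"
  for n :: nat where
  const: "(\<lambda>_. c) \<in> poly_funs n"
| entry_fst: "i < n \<Longrightarrow> j < n \<Longrightarrow> (\<lambda>p. fst p $$ (i, j)) \<in> poly_funs n"
| entry_snd: "i < n \<Longrightarrow> j < n \<Longrightarrow> (\<lambda>p. snd p $$ (i, j)) \<in> poly_funs n"
| add: "f \<in> poly_funs n \<Longrightarrow> g \<in> poly_funs n \<Longrightarrow> (\<lambda>p. f p + g p) \<in> poly_funs n"
| mult: "f \<in> poly_funs n \<Longrightarrow> g \<in> poly_funs n \<Longrightarrow> (\<lambda>p. f p * g p) \<in> poly_funs n"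

definition zariski :: "nat \<Rightarrow> (complex mat \<times> complex mat) topology" where
  "zariski n =
     topology (\<lambda>U. \<exists>F\<subseteq>poly_funs n. U = mat_pairs n - {p \<in> mat_pairs n. \<forall>f\<in>F. f p = 0})"

lemma istopology_zariski:
  "istopology (\<lambda>U. \<exists>F\<subseteq>poly_funs n. U = mat_pairs n - {p \<in> mat_pairs n. \<forall>f\<in>F. f p = 0})"
    (is "istopology ?P")
  unfolding istopology_def
proof (intro conjI allI impI)
  fix S T assume "?P S" "?P T"
  then obtain F G where F: "F \<subseteq> poly_funs n" "S = mat_pairs n - {p \<in> mat_pairs n. \<forall>f\<in>F. f p = 0}"
    and G: "G \<subseteq> poly_funs n" "T = mat_pairs n - {p \<in> mat_pairs n. \<forall>f\<in>G. f p = 0}"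
    by blast
  let ?H = "{\<lambda>p. f p * g p | f g. f \<in> F \<and> g \<in> G}"
  have "?H \<subseteq> poly_funs n"
    using F(1) G(1) by (auto intro: poly_funs.mult)
  moreover have "S \<inter> T = mat_pairs n - {p \<in> mat_pairs n. \<forall>h\<in>?H. h p = 0}"
  proof -
    have "(\<forall>h\<in>?H. h p = 0) \<longleftrightarrow> (\<forall>f\<in>F. f p = 0) \<or> (\<forall>g\<in>G. g p = 0)" for p
    proof
      assume *: "\<forall>h\<in>?H. h p = 0"
      have "f p * g p = 0" if "f \<in> F" "g \<in> G" for f g
      proof -
        have "(\<lambda>p. f p * g p) \<in> ?H" using that by blast
        from bspec[OF * this] show ?thesis .
      qed
      then show "(\<forall>f\<in>F. f p = 0) \<or> (\<forall>g\<in>G. g p = 0)"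
        by (metis mult_eq_0_iff)
    qed auto
    then show ?thesis
      unfolding F(2) G(2) by (simp only:) blast
  qed
  ultimately show "?P (S \<inter> T)" by (intro exI[of _ ?H] conjI)
next
  fix K assume K: "\<forall>U\<in>K. ?P U"
  let ?F = "{f \<in> poly_funs n. {p \<in> mat_pairs n. f p \<noteq> 0} \<subseteq> \<Union>K}"
  have "\<Union>K = mat_pairs n - {p \<in> mat_pairs n. \<forall>f\<in>?F. f p = 0}"
  proof (intro equalityI subsetI)
    fix p assume "p \<in> \<Union>K"
    then obtain U where U: "U \<in> K" "p \<in> U" by blast
    with K obtain F where F: "F \<subseteq> poly_funs n"
      "U = mat_pairs n - {p \<in> mat_pairs n. \<forall>f\<in>F. f p = 0}" by meson
    with U obtain f where f: "f \<in> F" "f p \<noteq> 0" "p \<in> mat_pairs n" by blast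
    have "{p \<in> mat_pairs n. f p \<noteq> 0} \<subseteq> U" using f(1) F(2) by blast
    with U(1) f(1) F(1) have "f \<in> ?F" by blast
    with f show "p \<in> mat_pairs n - {p \<in> mat_pairs n. \<forall>f\<in>?F. f p = 0}" by blast
  next
    fix p assume "p \<in> mat_pairs n - {p \<in> mat_pairs n. \<forall>f\<in>?F. f p = 0}"
    then show "p \<in> \<Union>K" by blast
  qed
  moreover have "?F \<subseteq> poly_funs n" by (rule Collect_restrict)
  ultimately show "?P (\<Union>K)" by (intro exI[of _ ?F] conjI)
qed

lemma topspace_zariski [simp]: "topspace (zariski n) = mat_pairs n"
proof -
  have "openin (zariski n) (mat_pairs n)"
    unfolding zariski_def topology_inverse'[OF istopology_zariski]
    by (intro exI[of _ "{\<lambda>_. 1}"]) (auto intro: poly_funs.const)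
  moreover have "topspace (zariski n) \<subseteq> mat_pairs n"
    unfolding topspace_def zariski_def topology_inverse'[OF istopology_zariski] by blast
  ultimately show ?thesis
    by (simp add: openin_subset subset_antisym)
qed

lemma closedin_zariski:
  "closedin (zariski n) C \<longleftrightarrow> (\<exists>F\<subseteq>poly_funs n. C = {p \<in> mat_pairs n. \<forall>f\<in>F. f p = 0})"
proof -
  have openin: "openin (zariski n) U \<longleftrightarrow>
      (\<exists>F\<subseteq>poly_funs n. U = mat_pairs n - {p \<in> mat_pairs n. \<forall>f\<in>F. f p = 0})" for U
    unfolding zariski_def topology_inverse'[OF istopology_zariski] ..
  have compl: "C \<subseteq> mat_pairs n \<and> mat_pairs n - C = mat_pairs n - Z \<longleftrightarrow> C = Z"
    if "Z \<subseteq> mat_pairs n" for Z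
    using that by blast
  have ex: "A \<and> (\<exists>F\<subseteq>P. Q F) \<longleftrightarrow> (\<exists>F\<subseteq>P. R F)"
    if "\<And>F. A \<and> Q F \<longleftrightarrow> R F" for A P and Q R :: "'b set \<Rightarrow> bool"
    using that by blast
  show ?thesis
    unfolding closedin_def topspace_zariski openin
    by (rule ex, rule compl, rule Collect_subset)
qed

text \<open>
  An \<open>n\<close>-dimensional representation of \<open>R = \<complex>\<langle>x, y\<rangle> / (xy - yx - y\<^sup>2)\<close> is a pair of
  matrices satisfying the defining relation.
\<close>

definition mod_R :: "nat \<Rightarrow> (complex mat \<times> complex mat) set" where
  "mod_R n = {(X, Y). X \<in> carrier_mat n n \<and> Y \<in> carrier_mat n n \<and> X * Y - Y * X = Y * Y}"

definition mod_R_variety :: "nat \<Rightarrow> (complex mat \<times> complex mat) topology" where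
  "mod_R_variety n = subtopology (zariski n) (mod_R n)"

definition partitions :: "nat \<Rightarrow> nat multiset set" where
  "partitions n = {P. 0 \<notin># P \<and> \<Sum>\<^sub># P = n}"

text \<open>
  The list \<open>n_as\<close> consists of the pairs (block size, eigenvalue) of a Jordan normal form
  of \<open>Y\<close>. For \<open>(X, Y) \<in> mod_R n\<close> the matrix \<open>Y\<close> is nilpotent, so all these eigenvalues are \<open>0\<close>.
\<close>

definition stratum :: "nat \<Rightarrow> nat multiset \<Rightarrow> (complex mat \<times> complex mat) set" where
  "stratum n P =
     {(X, Y) \<in> mod_R n. \<exists>n_as. jordan_nf Y n_as \<and> mset (map fst n_as) = P}"

end

theory Submission
  imports Defs
    "Jordan_Normal_Form.Jordan_Normal_Form_Existence"
    "HOL-Library.Function_Algebras"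
    "HOL-Library.FuncSet"
begin

text \<open>
  For a nilpotent matrix \<open>J\<close>, the solutions \<open>X\<close> of \<open>X * J - J * X = J * J\<close> form a translate of the
  centralizer of \<open>J\<close>. A stratum therefore fibres over a conjugacy class, of dimension
  \<open>n\<^sup>2 - c\<close> where \<open>c\<close> is the dimension of the centralizer, with fibres of dimension \<open>c\<close>. It
  is irreducible of dimension \<open>n\<^sup>2\<close> for every partition. The second matrix of a pair in the variety is
  always nilpotent (\<open>jordan_matrix_eigenvalues_zero\<close>), so the variety is the union of the
  finitely many strata. Since their closures are irreducible of the same finite dimension, none can
  contain another one properly, and they are the components. Different partitions have different
  closures, because the ranks of the powers of \<open>Y\<close> can only drop under specialisation
  (\<open>split_rank_closure\<close>) and determine the Jordan type (\<open>partition_determined_by_ranks\<close>).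

  The dimension is the Krull dimension of a topological space, and both bounds for it are obtained
  directly. For the upper bound, a chain of irreducible closed sets of length \<open>k\<close> yields
  \<open>(m + 1) ^ k\<close> linearly independent functions of degree \<open>O(m)\<close> on its largest member
  (\<open>chain_gives_independent_functions\<close>). On the other hand, a dense part of a stratum is parametrised
  by rational functions of \<open>n\<^sup>2\<close> parameters (\<open>slice_dense\<close>): conjugate the fibre by those \<open>g\<close> that lie in
  an affine complement, through \<open>1\<close>, of the centralizer. Counting monomials in the
  parameters gives \<open>k \<le> n\<^sup>2\<close> (\<open>chain_length_le_parameters\<close>). For the lower bound, a flag of coordinate
  subspaces in the space of parameters is mapped to a chain of irreducible closed sets
  (\<open>orbit_family_chain\<close>); it is strict since near the base point the parameters are rational functions
  of the pair (\<open>local_coordinates\<close>).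

  Irreducibility and density are both proved along lines in the space of matrices
  (\<open>irreducible_conj_image\<close>, \<open>slice_dense\<close>), so that only polynomials in one variable and the
  finiteness of their roots are used.
\<close>

section \<open>Filtered rings of functions\<close>

text \<open>
  Three kinds of functions occur below: polynomials in the matrix entries of a pair, polynomials in
  one variable \<open>t\<close> along a line of matrices, and polynomials in the parameters of a parametrised
  family. Determinants and adjugates are needed for all three, and for the first and the third also a
  bound on the degree. The locale collects what these arguments use: \<open>P m\<close> plays
  the role of the functions of degree at most \<open>m\<close>, and their union \<open>R\<close> is a ring.
\<close>

locale function_filtration =
  fixes P :: "nat \<Rightarrow> ('x \<Rightarrow> complex) set"
  assumes const: "(\<lambda>_. c) \<in> P 0"
    and mono: "f \<in> P a \<Longrightarrow> a \<le> b \<Longrightarrow> f \<in> P b"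
    and add: "f \<in> P a \<Longrightarrow> g \<in> P a \<Longrightarrow> (\<lambda>x. f x + g x) \<in> P a"
    and mult: "f \<in> P a \<Longrightarrow> g \<in> P b \<Longrightarrow> (\<lambda>x. f x * g x) \<in> P (a + b)"
begin

definition R :: "('x \<Rightarrow> complex) set" where
  "R = (\<Union>m. P m)"

lemma R_const: "(\<lambda>_. c) \<in> R"
  using const by (auto simp: R_def)

lemma R_add: "f \<in> R \<Longrightarrow> g \<in> R \<Longrightarrow> (\<lambda>x. f x + g x) \<in> R"
  unfolding R_def using add mono
  by clarsimp (metis max.cobounded1 max.cobounded2)

lemma R_mult: "f \<in> R \<Longrightarrow> g \<in> R \<Longrightarrow> (\<lambda>x. f x * g x) \<in> R"
  unfolding R_def using mult by blast

lemma R_uminus: "f \<in> R \<Longrightarrow> (\<lambda>x. - f x) \<in> R"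
  using R_mult[OF R_const[of "-1"]] by simp

lemma R_diff: "f \<in> R \<Longrightarrow> g \<in> R \<Longrightarrow> (\<lambda>x. f x - g x) \<in> R"
  using R_add[OF _ R_uminus] by fastforce

lemma R_sum: "(\<And>i. i \<in> I \<Longrightarrow> f i \<in> R) \<Longrightarrow> (\<lambda>x. \<Sum>i\<in>I. f i x) \<in> R"
  by (induction I rule: infinite_finite_induct) (auto intro: R_const R_add)

lemma R_prod: "(\<And>i. i \<in> I \<Longrightarrow> f i \<in> R) \<Longrightarrow> (\<lambda>x. \<Prod>i\<in>I. f i x) \<in> R"
  by (induction I rule: infinite_finite_induct) (auto intro: R_const R_mult)

definition R_mat :: "nat \<Rightarrow> nat \<Rightarrow> ('x \<Rightarrow> complex mat) \<Rightarrow> bool" where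
  "R_mat nr nc M \<longleftrightarrow> (\<forall>x. M x \<in> carrier_mat nr nc) \<and>
     (\<forall>i<nr. \<forall>j<nc. (\<lambda>x. M x $$ (i, j)) \<in> R)"

lemma R_matI:
  "(\<And>x. M x \<in> carrier_mat nr nc) \<Longrightarrow>
   (\<And>i j. i < nr \<Longrightarrow> j < nc \<Longrightarrow> (\<lambda>x. M x $$ (i, j)) \<in> R) \<Longrightarrow> R_mat nr nc M"
  by (simp add: R_mat_def)

lemma R_mat_entry: "R_mat nr nc M \<Longrightarrow> i < nr \<Longrightarrow> j < nc \<Longrightarrow> (\<lambda>x. M x $$ (i, j)) \<in> R"
  by (simp add: R_mat_def)

lemma R_mat_const: "A \<in> carrier_mat nr nc \<Longrightarrow> R_mat nr nc (\<lambda>_. A)"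
  by (simp add: R_mat_def R_const)

lemma R_mat_mult:
  assumes "R_mat nr k M" "R_mat k nc N"
  shows "R_mat nr nc (\<lambda>x. M x * N x)"
proof (rule R_matI)
  show "M x * N x \<in> carrier_mat nr nc" for x
    using assms unfolding R_mat_def by (meson mult_carrier_mat)
  fix i j assume ij: "i < nr" "j < nc"
  have "(M x * N x) $$ (i, j) = (\<Sum>l<k. M x $$ (i, l) * N x $$ (l, j))" for x
  proof -
    have "M x \<in> carrier_mat nr k" "N x \<in> carrier_mat k nc"
      using assms by (auto simp: R_mat_def)
    with ij show ?thesis by (simp add: scalar_prod_def atLeast0LessThan)
  qed
  moreover have "(\<lambda>x. \<Sum>l<k. M x $$ (i, l) * N x $$ (l, j)) \<in> R"
    using assms ij by (intro R_sum R_mult) (auto intro: R_mat_entry)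
  ultimately show "(\<lambda>x. (M x * N x) $$ (i, j)) \<in> R" by simp
qed

lemma R_mat_pow:
  assumes "R_mat n n M" shows "R_mat n n (\<lambda>x. M x ^\<^sub>m k)"
proof (induction k)
  case 0
  have "dim_row (M x) = n" for x using assms by (auto simp: R_mat_def)
  then show ?case by (simp add: R_mat_const)
qed (simp add: R_mat_mult assms)

lemma R_det:
  assumes "R_mat n n M"
  shows "(\<lambda>x. det (M x)) \<in> R"
proof -
  have "det (M x) = (\<Sum>p | p permutes {0..<n}. signof p * (\<Prod>i = 0..<n. M x $$ (i, p i)))" for x
    using assms by (intro det_def') (simp add: R_mat_def)
  moreover have "(\<lambda>x. \<Sum>p | p permutes {0..<n}. signof p * (\<Prod>i = 0..<n. M x $$ (i, p i))) \<in> R"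
    using assms
    by (intro R_sum R_mult R_const R_prod R_mat_entry[OF assms]) (use permutes_in_image in fastforce)+
  ultimately show ?thesis by simp
qed

lemma R_adj_mat:
  assumes "R_mat n n M"
  shows "R_mat n n (\<lambda>x. adj_mat (M x))"
proof (rule R_matI)
  have dims: "M x \<in> carrier_mat n n" for x using assms by (simp add: R_mat_def)
  show "adj_mat (M x) \<in> carrier_mat n n" for x using adj_mat(1)[OF dims] .
  fix i j assume ij: "i < n" "j < n"
  have "R_mat (n - 1) (n - 1) (\<lambda>x. mat_delete (M x) j i)"
  proof (rule R_matI)
    show "mat_delete (M x) j i \<in> carrier_mat (n - 1) (n - 1)" for x
      using dims[of x] by (rule mat_delete_carrier)
    fix a b assume ab: "a < n - 1" "b < n - 1"
    have "mat_delete (M x) j i $$ (a, b)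
        = M x $$ (if a < j then a else Suc a, if b < i then b else Suc b)" for x
      using dims[of x] ab by (auto simp: mat_delete_def)
    then show "(\<lambda>x. mat_delete (M x) j i $$ (a, b)) \<in> R"
      using ab by (simp add: R_mat_entry[OF assms])
  qed
  then have "(\<lambda>x. (- 1) ^ (j + i) * det (mat_delete (M x) j i)) \<in> R"
    by (intro R_mult R_const R_det)
  moreover have "adj_mat (M x) $$ (i, j) = (- 1) ^ (j + i) * det (mat_delete (M x) j i)" for x
    using ij dims[of x] by (auto simp: adj_mat_def cofactor_def)
  ultimately show "(\<lambda>x. adj_mat (M x) $$ (i, j)) \<in> R" by simp
qed

text \<open>
  Every function in \<open>R\<close> has some degree, but no degree bound is ever computed: finitely many
  functions have a common one, and only its existence matters for growth arguments.
\<close>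

lemma finite_R_degree_bound:
  assumes "finite A" "A \<subseteq> R"
  obtains e where "A \<subseteq> P e"
proof -
  have "\<exists>e. A \<subseteq> P e" using assms
  proof (induction A rule: finite_induct)
    case (insert f A)
    then obtain e d where "A \<subseteq> P e" "f \<in> P d" by (auto simp: R_def)
    then have "insert f A \<subseteq> P (max e d)" using mono by (auto intro: max.cobounded1 max.cobounded2)
    then show ?case by blast
  qed auto
  then show ?thesis using that by blast
qed

end

section \<open>Polynomial functions of bounded degree\<close>

inductive poly_deg :: "nat \<Rightarrow> nat \<Rightarrow> (complex mat \<times> complex mat \<Rightarrow> complex) \<Rightarrow> bool"
  for n :: nat where
  const: "poly_deg n m (\<lambda>_. c)"
| entry_fst: "i < n \<Longrightarrow> j < n \<Longrightarrow> poly_deg n (Suc m) (\<lambda>p. fst p $$ (i, j))"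
| entry_snd: "i < n \<Longrightarrow> j < n \<Longrightarrow> poly_deg n (Suc m) (\<lambda>p. snd p $$ (i, j))"
| add: "poly_deg n m f \<Longrightarrow> poly_deg n m g \<Longrightarrow> poly_deg n m (\<lambda>p. f p + g p)"
| mult: "poly_deg n a f \<Longrightarrow> poly_deg n b g \<Longrightarrow>
    poly_deg n (a + b) (\<lambda>p. f p * g p)"

lemma poly_deg_mono:
  "poly_deg n a f \<Longrightarrow> a \<le> b \<Longrightarrow> poly_deg n b f"
proof (induction arbitrary: b rule: poly_deg.induct)
  case (entry_fst i j m) then show ?case by (cases b) (auto intro: poly_deg.intros)
next
  case (entry_snd i j m) then show ?case by (cases b) (auto intro: poly_deg.intros)
next
  case (mult a f c g)
  then have "poly_deg n (b - a) g" by simp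
  from poly_deg.mult[OF mult.hyps(1) this] mult.prems show ?case by simp
qed (auto intro: poly_deg.intros)

interpretation pf: function_filtration "\<lambda>m. Collect (poly_deg n m)" for n
  by unfold_locales (auto intro: poly_deg.intros poly_deg_mono)

lemma R_poly_funs: "pf.R n = poly_funs n"
proof (intro equalityI subsetI)
  fix f assume "f \<in> pf.R n"
  then obtain m where "poly_deg n m f" by (auto simp: pf.R_def)
  then show "f \<in> poly_funs n" by induction (auto intro: poly_funs.intros)
next
  fix f assume "f \<in> poly_funs n"
  then show "f \<in> pf.R n"
  proof induction
    case (entry_fst i j)
    then show ?case using poly_deg.entry_fst[of i n j 0] by (auto simp: pf.R_def)
  next
    case (entry_snd i j)
    then show ?case using poly_deg.entry_snd[of i n j 0] by (auto simp: pf.R_def)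
  qed (auto intro: pf.R_const pf.R_add pf.R_mult)
qed

text \<open>
  Polynomials in one variable, with the constant filtration: along a line only the ring is used.
\<close>

interpretation up: function_filtration "\<lambda>_. range (poly :: complex poly \<Rightarrow> complex \<Rightarrow> complex)"
proof
  show "(\<lambda>_. c) \<in> range (poly :: complex poly \<Rightarrow> complex \<Rightarrow> complex)" for c
    by (rule image_eqI[of _ _ "[:c:]"]) auto
  fix f g :: "complex \<Rightarrow> complex" assume "f \<in> range poly" "g \<in> range poly"
  then obtain p q where [simp]: "f = poly p" "g = poly q" by auto
  show "(\<lambda>x. f x + g x) \<in> range poly"  by (rule image_eqI[of _ _ "p + q"]) auto
  show "(\<lambda>x. f x * g x) \<in> range poly"  by (rule image_eqI[of _ _ "p * q"]) auto
qed

lemma up_R: "up.R = range poly"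
  by (simp add: up.R_def)

section \<open>Conjugating a pair of matrices\<close>

text \<open>
  The pair \<open>(g * X * g\<^sup>-\<^sup>1, g * J * g\<^sup>-\<^sup>1)\<close>, with \<open>g\<^sup>-\<^sup>1\<close> expressed by the adjugate so that its entries are
  visibly polynomials in the entries of \<open>g\<close> and \<open>X\<close>, divided by \<open>det g\<close>.
\<close>

definition conj_pt :: "complex mat \<Rightarrow> complex mat \<Rightarrow> complex mat \<Rightarrow> complex mat \<times> complex mat" where
  "conj_pt J g X = (inverse (det g) \<cdot>\<^sub>m (g * X * adj_mat g), inverse (det g) \<cdot>\<^sub>m (g * J * adj_mat g))"

context function_filtration begin

text \<open>
  Clearing denominators: a function of degree \<open>m\<close> at a conjugated pair becomes a polynomial in the
  parameters after multiplication by \<open>det g ^ m\<close>. That its degree is at most a constant times \<open>m\<close>,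
  with the same constant for all functions, is what makes the counting of monomials work.
\<close>

lemma poly_deg_conj_pt:
  assumes J: "J \<in> carrier_mat n n" and g: "R_mat n n g" and X: "R_mat n n X"
  obtains e where "\<And>m f. poly_deg n m f \<Longrightarrow>
     \<exists>F \<in> P (e * m). \<forall>x. det (g x) \<noteq> 0 \<longrightarrow> F x = det (g x) ^ m * f (conj_pt J (g x) (X x))"
proof -
  have nX: "R_mat n n (\<lambda>x. g x * X x * adj_mat (g x))" and nJ: "R_mat n n (\<lambda>x. g x * J * adj_mat (g x))"
    by (rule R_mat_mult[OF R_mat_mult[OF g X] R_adj_mat[OF g]],
        rule R_mat_mult[OF R_mat_mult[OF g R_mat_const[OF J]] R_adj_mat[OF g]])
  define A where "A = insert (\<lambda>x. det (g x))
    ((\<lambda>(i, j) x. (g x * X x * adj_mat (g x)) $$ (i, j)) ` ({..<n} \<times> {..<n})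
     \<union> (\<lambda>(i, j) x. (g x * J * adj_mat (g x)) $$ (i, j)) ` ({..<n} \<times> {..<n}))"
  have "f \<in> R" if "f \<in> A" for f
  proof -
    consider "f = (\<lambda>x. det (g x))"
      | i j where "i < n" "j < n" "f = (\<lambda>x. (g x * X x * adj_mat (g x)) $$ (i, j))"
      | i j where "i < n" "j < n" "f = (\<lambda>x. (g x * J * adj_mat (g x)) $$ (i, j))"
      using \<open>f \<in> A\<close> unfolding A_def by (elim insertE UnE imageE) auto
    then show ?thesis
      using R_det[OF g] by cases (simp_all only: R_mat_entry[OF nX] R_mat_entry[OF nJ])
  qed
  moreover have "finite A" by (simp add: A_def)
  ultimately obtain e where e: "A \<subseteq> P e"
    using finite_R_degree_bound[of A] by blast
  have e_det: "(\<lambda>x. det (g x)) \<in> P e"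
    by (rule subsetD[OF e]) (simp add: A_def)
  have e_fst: "(\<lambda>x. (g x * X x * adj_mat (g x)) $$ (i, j)) \<in> P e" if "i < n" "j < n" for i j
    by (rule subsetD[OF e], unfold A_def, rule insertI2, rule UnI1, rule image_eqI[of _ _ "(i, j)"])
      (use that in simp_all)
  have e_snd: "(\<lambda>x. (g x * J * adj_mat (g x)) $$ (i, j)) \<in> P e" if "i < n" "j < n" for i j
    by (rule subsetD[OF e], unfold A_def, rule insertI2, rule UnI2, rule image_eqI[of _ _ "(i, j)"])
      (use that in simp_all)
  have pow: "(\<lambda>x. det (g x) ^ m) \<in> P (e * m)" for m
  proof (induction m)
    case (Suc m)
    from mult[OF e_det Suc] show ?case by simp
  qed (simp add: const)
  have gc: "g x \<in> carrier_mat n n" "X x \<in> carrier_mat n n" "adj_mat (g x) \<in> carrier_mat n n" for x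
    using g X R_adj_mat[OF g] unfolding R_mat_def by blast+
  have "poly_deg n m f \<Longrightarrow> \<exists>F \<in> P (e * m). \<forall>x. det (g x) \<noteq> 0 \<longrightarrow>
      F x = det (g x) ^ m * f (conj_pt J (g x) (X x))" for f m
  proof (induction m f rule: poly_deg.induct)
    case (const m c)
    have "(\<lambda>x. det (g x) ^ m * c) \<in> P (e * m)"
      using mult[OF pow[of m] function_filtration.const[OF function_filtration_axioms, of c]] by simp
    then show ?case by (rule bexI[rotated]) simp
  next
    case (entry_fst i j m)
    have "(\<lambda>x. (g x * X x * adj_mat (g x)) $$ (i, j)) \<in> P e" using e_fst entry_fst by simp
    from mult[OF this pow[of m]]
    have "(\<lambda>x. (g x * X x * adj_mat (g x)) $$ (i, j) * det (g x) ^ m) \<in> P (e * Suc m)" by simp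
    moreover have "det (g x) \<noteq> 0 \<longrightarrow> (g x * X x * adj_mat (g x)) $$ (i, j) * det (g x) ^ m =
       det (g x) ^ Suc m * fst (conj_pt J (g x) (X x)) $$ (i, j)" for x
      using entry_fst gc[of x] by (auto simp: conj_pt_def simp del: index_mult_mat(1))
    ultimately show ?case by (intro bexI allI)
  next
    case (entry_snd i j m)
    have "(\<lambda>x. (g x * J * adj_mat (g x)) $$ (i, j)) \<in> P e" using e_snd entry_snd by simp
    from mult[OF this pow[of m]]
    have "(\<lambda>x. (g x * J * adj_mat (g x)) $$ (i, j) * det (g x) ^ m) \<in> P (e * Suc m)" by simp
    moreover have "det (g x) \<noteq> 0 \<longrightarrow> (g x * J * adj_mat (g x)) $$ (i, j) * det (g x) ^ m =
       det (g x) ^ Suc m * snd (conj_pt J (g x) (X x)) $$ (i, j)" for x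
      using entry_snd gc[of x] J by (auto simp: conj_pt_def simp del: index_mult_mat(1))
    ultimately show ?case by (intro bexI allI)
  next
    case (add m f h)
    then obtain F G where F: "F \<in> P (e * m)"
        "\<And>x. det (g x) \<noteq> 0 \<Longrightarrow> F x = det (g x) ^ m * f (conj_pt J (g x) (X x))"
      and G: "G \<in> P (e * m)"
        "\<And>x. det (g x) \<noteq> 0 \<Longrightarrow> G x = det (g x) ^ m * h (conj_pt J (g x) (X x))"
      by blast
    show ?case
    proof (rule bexI)
      show "(\<lambda>x. F x + G x) \<in> P (e * m)"
        by (rule function_filtration.add[OF function_filtration_axioms F(1) G(1)])
    qed (simp add: F(2) G(2) algebra_simps)
  next
    case (mult a f b h)
    then obtain F G where F: "F \<in> P (e * a)"
        "\<And>x. det (g x) \<noteq> 0 \<Longrightarrow> F x = det (g x) ^ a * f (conj_pt J (g x) (X x))"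
      and G: "G \<in> P (e * b)"
        "\<And>x. det (g x) \<noteq> 0 \<Longrightarrow> G x = det (g x) ^ b * h (conj_pt J (g x) (X x))"
      by blast
    show ?case
    proof (rule bexI)
      show "(\<lambda>x. F x * G x) \<in> P (e * (a + b))"
        using function_filtration.mult[OF function_filtration_axioms F(1) G(1)]
        by (simp add: algebra_simps)
    qed (simp add: F(2) G(2) algebra_simps power_add)
  qed
  then show ?thesis using that by blast
qed

end

section \<open>Irreducible sets in the Zariski topology\<close>

lemma closedin_zero_set:
  assumes "f \<in> poly_funs n"
  shows "closedin (zariski n) {p \<in> mat_pairs n. f p = 0}"
  unfolding closedin_zariski using assms by (intro exI[of _ "{f}"]) auto

lemma zero_on_closure:
  assumes f: "f \<in> poly_funs n" and 0: "\<And>p. p \<in> A \<Longrightarrow> f p = 0"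
    and p: "p \<in> zariski n closure_of A"
  shows "f p = 0"
proof -
  have "p \<in> zariski n closure_of (mat_pairs n \<inter> A)"
    using p by (metis closure_of_restrict topspace_zariski)
  moreover have "zariski n closure_of (mat_pairs n \<inter> A) \<subseteq> {p \<in> mat_pairs n. f p = 0}"
    using 0 by (intro closure_of_minimal closedin_zero_set f) auto
  ultimately show ?thesis by blast
qed

lemma irreducible_subsetD:
  assumes "irreducible_subset T A" "closedin T C" "closedin T D" "A \<subseteq> C \<union> D"
  shows "A \<subseteq> C \<or> A \<subseteq> D"
  using assms unfolding irreducible_subset_def by blast

lemma irreducible_mult_zero:
  assumes irr: "irreducible_subset (zariski n) A"
    and fg: "f \<in> poly_funs n" "g \<in> poly_funs n" and 0: "\<And>p. p \<in> A \<Longrightarrow> f p * g p = 0"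
  shows "(\<forall>p\<in>A. f p = 0) \<or> (\<forall>p\<in>A. g p = 0)"
proof -
  have "A \<subseteq> mat_pairs n" using irr by (simp add: irreducible_subset_def)
  then have "A \<subseteq> {p \<in> mat_pairs n. f p = 0} \<union> {p \<in> mat_pairs n. g p = 0}"
    using 0 by fastforce
  from irreducible_subsetD[OF irr closedin_zero_set[OF fg(1)] closedin_zero_set[OF fg(2)] this]
  show ?thesis by auto
qed

lemma irreducible_closure_of:
  assumes "irreducible_subset T A"
  shows "irreducible_subset T (T closure_of A)"
proof -
  have "A \<subseteq> T closure_of A"
    using assms by (simp add: closure_of_subset irreducible_subset_def)
  show ?thesis
    unfolding irreducible_subset_def
  proof (intro conjI allI impI)
    show "T closure_of A \<noteq> {}"
      using assms \<open>A \<subseteq> T closure_of A\<close> unfolding irreducible_subset_def by auto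
    fix C D assume CD: "closedin T C \<and> closedin T D \<and> T closure_of A \<subseteq> C \<union> D"
    then have "A \<subseteq> C \<or> A \<subseteq> D"
      using assms \<open>A \<subseteq> T closure_of A\<close> unfolding irreducible_subset_def by (metis subset_trans)
    then show "T closure_of A \<subseteq> C \<or> T closure_of A \<subseteq> D"
      using CD closure_of_minimal[of A _ T] by metis
  qed (rule closure_of_subset_topspace)
qed

definition line :: "complex mat \<Rightarrow> complex mat \<Rightarrow> complex \<Rightarrow> complex mat" where
  "line A B t = (1 - t) \<cdot>\<^sub>m A + t \<cdot>\<^sub>m B"

lemma line_carrier [simp]:
  "A \<in> carrier_mat n m \<Longrightarrow> B \<in> carrier_mat n m \<Longrightarrow> line A B t \<in> carrier_mat n m"
  by (simp add: line_def)

lemma line_entry [simp]: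
  assumes "A \<in> carrier_mat n m" "B \<in> carrier_mat n m" "i < n" "j < m"
  shows "line A B t $$ (i, j) = (1 - t) * A $$ (i, j) + t * B $$ (i, j)"
  using assms by (simp add: line_def)

lemma line_0 [simp]: "A \<in> carrier_mat n m \<Longrightarrow> B \<in> carrier_mat n m \<Longrightarrow> line A B 0 = A"
  and line_1 [simp]: "A \<in> carrier_mat n m \<Longrightarrow> B \<in> carrier_mat n m \<Longrightarrow> line A B 1 = B"
  by (auto simp: line_def intro!: eq_matI)

lemma R_mat_line:
  assumes "A \<in> carrier_mat n m" "B \<in> carrier_mat n m"
  shows "up.R_mat n m (line A B)"
proof (rule up.R_matI)
  fix i j assume "i < n" "j < m"
  moreover have "(\<lambda>t. (1 - t) * A $$ (i, j) + t * B $$ (i, j)) = poly [:A $$ (i, j), B $$ (i, j) - A $$ (i, j):]"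
    by (auto simp: algebra_simps)
  ultimately show "(\<lambda>t. line A B t $$ (i, j)) \<in> up.R"
    using assms by (simp add: up_R)
qed (use assms in simp)

text \<open>
  This reduces questions about polynomial functions on a family of conjugated pairs to polynomials in
  one variable, which have only finitely many roots unless they vanish.
\<close>

lemma poly_along_curve:
  assumes J: "J \<in> carrier_mat n n" and g: "up.R_mat n n g" and X: "up.R_mat n n X"
    and f: "f \<in> poly_funs n"
  obtains p m where "\<And>t. det (g t) \<noteq> 0 \<Longrightarrow> poly p t = det (g t) ^ m * f (conj_pt J (g t) (X t))"
proof -
  from f obtain m where m: "poly_deg n m f"
    unfolding R_poly_funs[symmetric] pf.R_def by blast
  obtain e where e: "\<And>m f. poly_deg n m f \<Longrightarrow>
     \<exists>F \<in> range poly. \<forall>x. det (g x) \<noteq> 0 \<longrightarrow> F x = det (g x) ^ m * f (conj_pt J (g x) (X x))"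
    using up.poly_deg_conj_pt[OF J g X] by metis
  from e[OF m] that show ?thesis by blast
qed

lemma R_det_poly:
  assumes "up.R_mat n n g"
  obtains d where "\<And>t. poly d t = det (g t)"
proof -
  from up.R_det[OF assms] obtain d where "(\<lambda>t. det (g t)) = poly d" unfolding up_R by blast
  then show ?thesis using that by metis
qed

lemma adj_mat_carrier: "A \<in> carrier_mat n n \<Longrightarrow> adj_mat A \<in> carrier_mat n n"
  by (rule adj_mat(1))

lemma conj_pt_mat_pairs:
  "J \<in> carrier_mat n n \<Longrightarrow> g \<in> carrier_mat n n \<Longrightarrow> X \<in> carrier_mat n n \<Longrightarrow> conj_pt J g X \<in> mat_pairs n"
  unfolding conj_pt_def mat_pairs_def
  by (intro SigmaI smult_carrier_mat mult_carrier_mat[of _ n n] adj_mat_carrier)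

definition conj_image :: "complex mat \<Rightarrow> (complex mat \<times> complex mat) set \<Rightarrow> (complex mat \<times> complex mat) set" where
  "conj_image J \<Omega> = (\<lambda>(g, X). conj_pt J g X) ` {(g, X) \<in> \<Omega>. det g \<noteq> 0}"

lemma conj_imageI: "(g, X) \<in> \<Omega> \<Longrightarrow> det g \<noteq> 0 \<Longrightarrow> conj_pt J g X \<in> conj_image J \<Omega>"
  unfolding conj_image_def by (rule image_eqI[of _ _ "(g, X)"]) simp_all

lemma conj_imageE:
  assumes "p \<in> conj_image J \<Omega>"
  obtains g X where "(g, X) \<in> \<Omega>" "det g \<noteq> 0" "p = conj_pt J g X"
  using assms unfolding conj_image_def by (elim imageE) (auto split: prod.splits)

lemma conj_image_mat_pairs:
  assumes "J \<in> carrier_mat n n" "\<Omega> \<subseteq> mat_pairs n"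
  shows "conj_image J \<Omega> \<subseteq> mat_pairs n"
proof
  fix p assume "p \<in> conj_image J \<Omega>"
  then obtain g X where "(g, X) \<in> \<Omega>" "p = conj_pt J g X" by (rule conj_imageE)
  then show "p \<in> mat_pairs n" using assms conj_pt_mat_pairs by (auto simp: mat_pairs_def)
qed

text \<open>
  The parameter sets used below are affine subspaces of pairs of matrices.
\<close>

definition line_closed :: "(complex mat \<times> complex mat) set \<Rightarrow> bool" where
  "line_closed \<Omega> \<longleftrightarrow> (\<forall>(g, X)\<in>\<Omega>. \<forall>(g', X')\<in>\<Omega>. \<forall>t. (line g g' t, line X X' t) \<in> \<Omega>)"

text \<open>
  Any two points of the image lie on a rational curve, the image of a line of parameters. If two closed
  sets cover the image, one function for each of them that is nonzero at one end of the curve would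
  give a product that vanishes along the whole curve, although neither factor does.
\<close>

lemma irreducible_conj_image:
  assumes J: "J \<in> carrier_mat n n" and \<Omega>: "\<Omega> \<subseteq> mat_pairs n" and line: "line_closed \<Omega>"
    and ne: "conj_image J \<Omega> \<noteq> {}"
  shows "irreducible_subset (zariski n) (conj_image J \<Omega>)"
  unfolding irreducible_subset_def
proof (intro conjI allI impI ne)
  show sub: "conj_image J \<Omega> \<subseteq> topspace (zariski n)"
    using conj_image_mat_pairs[OF J \<Omega>] by simp
  fix C D assume CD: "closedin (zariski n) C \<and> closedin (zariski n) D \<and> conj_image J \<Omega> \<subseteq> C \<union> D"
  show "conj_image J \<Omega> \<subseteq> C \<or> conj_image J \<Omega> \<subseteq> D"
  proof (rule ccontr)
    assume "\<not> ?thesis"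
    then obtain g1 X1 g2 X2 where 1: "(g1, X1) \<in> \<Omega>" "det g1 \<noteq> 0" "conj_pt J g1 X1 \<notin> C"
      and 2: "(g2, X2) \<in> \<Omega>" "det g2 \<noteq> 0" "conj_pt J g2 X2 \<notin> D"
      by (metis conj_imageE subsetI)
    have car: "g1 \<in> carrier_mat n n" "X1 \<in> carrier_mat n n" "g2 \<in> carrier_mat n n" "X2 \<in> carrier_mat n n"
      using 1(1) 2(1) \<Omega> by (auto simp: mat_pairs_def)
    obtain F G where F: "F \<subseteq> poly_funs n" "C = {p \<in> mat_pairs n. \<forall>f\<in>F. f p = 0}"
      and G: "G \<subseteq> poly_funs n" "D = {p \<in> mat_pairs n. \<forall>f\<in>G. f p = 0}"
      using CD unfolding closedin_zariski by (elim conjE exE)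
    obtain f where f: "f \<in> F" "f (conj_pt J g1 X1) \<noteq> 0"
      using 1(3) conj_pt_mat_pairs[OF J car(1,2)] unfolding F(2) by blast
    obtain h where h: "h \<in> G" "h (conj_pt J g2 X2) \<noteq> 0"
      using 2(3) conj_pt_mat_pairs[OF J car(3,4)] unfolding G(2) by blast
    let ?g = "line g1 g2" and ?X = "line X1 X2"
    have R: "up.R_mat n n ?g" "up.R_mat n n ?X" using car by (auto intro: R_mat_line)
    obtain p m where p: "\<And>t. det (?g t) \<noteq> 0 \<Longrightarrow> poly p t = det (?g t) ^ m * f (conj_pt J (?g t) (?X t))"
      using poly_along_curve[OF J R, of f] f(1) F(1) by blast
    obtain q k where q: "\<And>t. det (?g t) \<noteq> 0 \<Longrightarrow> poly q t = det (?g t) ^ k * h (conj_pt J (?g t) (?X t))"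
      using poly_along_curve[OF J R, of h] h(1) G(1) by blast
    obtain d where d: "\<And>t. poly d t = det (?g t)"
      using R_det_poly[OF R(1)] by blast
    have "poly p 0 \<noteq> 0" using p[of 0] 1(2) f(2) car by simp
    moreover have "poly q 1 \<noteq> 0" using q[of 1] 2(2) h(2) car by simp
    moreover have "poly d 0 \<noteq> 0" using d[of 0] 1(2) car by simp
    ultimately have "p * q * d \<noteq> 0" by fastforce
    then obtain t where "poly (p * q * d) t \<noteq> 0" using poly_all_0_iff_0 by blast
    then have t: "poly p t \<noteq> 0" "poly q t \<noteq> 0" "det (?g t) \<noteq> 0" using d by auto
    have "(?g t, ?X t) \<in> \<Omega>" using line 1(1) 2(1) unfolding line_closed_def by fast
    then have "conj_pt J (?g t) (?X t) \<in> conj_image J \<Omega>"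
      using t(3) by (rule conj_imageI)
    then have "f (conj_pt J (?g t) (?X t)) = 0 \<or> h (conj_pt J (?g t) (?X t)) = 0"
      using CD F(2) G(2) f(1) h(1) by blast
    then show False using t p q by auto
  qed
qed

section \<open>Independent functions from chains of irreducible closed sets\<close>

definition lin_indep_on :: "'p set \<Rightarrow> nat set \<Rightarrow> (nat \<Rightarrow> 'p \<Rightarrow> complex) \<Rightarrow> bool" where
  "lin_indep_on Z I b \<longleftrightarrow> (\<forall>c. (\<forall>p\<in>Z. (\<Sum>i\<in>I. c i * b i p) = 0) \<longrightarrow> (\<forall>i\<in>I. c i = 0))"

lemma lin_indep_onD:
  assumes "lin_indep_on Z I b" "\<And>p. p \<in> Z \<Longrightarrow> (\<Sum>i\<in>I. c i * b i p) = 0" "i \<in> I"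
  shows "c i = 0"
  using assms unfolding lin_indep_on_def by auto

lemma poly_funs_sum:
  "(\<And>i. i \<in> I \<Longrightarrow> f i \<in> poly_funs n) \<Longrightarrow> (\<lambda>p. \<Sum>i\<in>I. f i p) \<in> poly_funs n"
  using pf.R_sum[of I f n] by (simp add: R_poly_funs)

lemma poly_funs_pow: "f \<in> poly_funs n \<Longrightarrow> (\<lambda>p. f p ^ k) \<in> poly_funs n"
  by (induction k) (auto intro: poly_funs.intros)

lemma poly_deg_pow: "poly_deg n d f \<Longrightarrow> poly_deg n (d * k) (\<lambda>p. f p ^ k)"
proof (induction k)
  case 0
  then show ?case by (simp add: poly_deg.const)
next
  case (Suc k)
  from poly_deg.mult[OF Suc.prems Suc.IH[OF Suc.prems]] show ?case by simp
qed

lemma sum_powers_shift: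
  fixes g :: complex
  assumes "j \<le> m" "\<And>j'. j' < j \<Longrightarrow> q j' = 0"
  shows "(\<Sum>j'\<le>m. g ^ j' * q j') = g ^ j * (\<Sum>j'=j..m. g ^ (j' - j) * q j')"
proof -
  have "(\<Sum>j'\<le>m. g ^ j' * q j') = (\<Sum>j'=j..m. g ^ j' * q j')"
    using assms by (intro sum.mono_neutral_right) auto
  also have "\<dots> = (\<Sum>j'=j..m. g ^ j * (g ^ (j' - j) * q j'))"
    by (intro sum.cong refl) (simp add: power_add[symmetric] mult.assoc[symmetric])
  finally show ?thesis by (simp add: sum_distrib_left)
qed

text \<open>
  If \<open>g\<close> vanishes on \<open>W\<close> but not on the irreducible set \<open>Z\<close>, functions that are independent on \<open>W\<close>
  stay independent on \<open>Z\<close> when multiplied by the powers of \<open>g\<close>: in a relation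
  \<open>\<Sum>j. g ^ j * q j = 0\<close> on \<open>Z\<close> the lowest power of \<open>g\<close> can be cancelled, and restricting what
  remains to \<open>W\<close> isolates the lowest coefficient.
\<close>

lemma powers_times_independent:
  assumes irr: "irreducible_subset (zariski n) Z" and "W \<subseteq> Z"
    and g: "g \<in> poly_funs n" "\<And>p. p \<in> W \<Longrightarrow> g p = 0" "z \<in> Z" "g z \<noteq> 0"
    and b: "\<And>i. i \<in> I \<Longrightarrow> b i \<in> poly_funs n" and indep: "lin_indep_on W I b"
    and 0: "\<And>p. p \<in> Z \<Longrightarrow> (\<Sum>j\<le>m. g p ^ j * (\<Sum>i\<in>I. c j i * b i p)) = 0"
    and ij: "j \<le> m" "i \<in> I"
  shows "c j i = 0"
  using ij
proof (induction j arbitrary: i rule: less_induct)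
  case (less j)
  define q where "q j' p = (\<Sum>i\<in>I. c j' i * b i p)" for j' p
  define r where "r p = (\<Sum>j'=j..m. g p ^ (j' - j) * q j' p)" for p
  have q: "q j' \<in> poly_funs n" for j'
    unfolding q_def[abs_def] by (intro poly_funs_sum poly_funs.mult poly_funs.const b)
  have r: "r \<in> poly_funs n"
    unfolding r_def[abs_def] by (intro poly_funs_sum poly_funs.mult poly_funs_pow g(1) q)
  have "g p ^ j * r p = 0" if "p \<in> Z" for p
  proof -
    have "q j' p = 0" if "j' < j" for j'
      unfolding q_def using less that by (intro sum.neutral) auto
    from sum_powers_shift[where g = "g p" and q = "\<lambda>j'. q j' p", OF less.prems(1) this] 0[OF \<open>p \<in> Z\<close>]
    show ?thesis by (simp add: r_def q_def)
  qed
  then have "(\<forall>p\<in>Z. g p ^ j = 0) \<or> (\<forall>p\<in>Z. r p = 0)"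
    by (intro irreducible_mult_zero[OF irr poly_funs_pow[OF g(1)] r])
  then have r0: "r p = 0" if "p \<in> W" for p
    using g(3,4) that \<open>W \<subseteq> Z\<close> by auto
  have "q j p = 0" if "p \<in> W" for p
  proof -
    have "r p = (\<Sum>j'=j..m. if j' = j then q j p else 0)"
      unfolding r_def using g(2)[OF that] by (intro sum.cong) auto
    then show ?thesis using r0[OF that] less.prems(1) by (simp add: sum.delta)
  qed
  then show ?case
    using lin_indep_onD[OF indep _ less.prems(2), of "c j"] unfolding q_def by metis
qed

text \<open>
  The step from \<open>C k\<close> to \<open>C (Suc k)\<close> multiplies the number of independent functions by \<open>m + 1\<close> while
  the degree stays linear in \<open>m\<close>. A chain of length \<open>k\<close> thus forces the functions of degree at
  most \<open>e * m\<close> on its largest member to have dimension at least \<open>(m + 1) ^ k\<close>; this replaces the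
  transcendence degree of the function field.
\<close>

theorem chain_gives_independent_functions:
  assumes "\<forall>i\<le>k. closedin (zariski n) (C i) \<and> irreducible_subset (zariski n) (C i)"
    and "\<forall>i<k. C i \<subset> C (Suc i)"
  shows "\<exists>e. \<forall>m. \<exists>I b. finite I \<and> card I = (m + 1) ^ k \<and>
           (\<forall>i\<in>I. poly_deg n (e * m) (b i)) \<and> lin_indep_on (C k) I b"
  using assms
proof (induction k)
  case 0
  then obtain p where p: "p \<in> C 0" unfolding irreducible_subset_def by auto
  show ?case
  proof (intro exI[of _ 0] allI)
    fix m
    have "lin_indep_on (C 0) {0} (\<lambda>_ _. 1)"
      unfolding lin_indep_on_def
    proof (intro allI impI ballI)
      fix c i assume "\<forall>p\<in>C 0. (\<Sum>i\<in>{0::nat}. c i * (1::complex)) = 0" "i \<in> {0::nat}"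
      then show "c i = 0" using bspec[OF _ p] by fastforce
    qed
    then show "\<exists>I b. finite I \<and> card I = (m + 1) ^ 0 \<and>
           (\<forall>i\<in>I. poly_deg n (0 * m) (b i)) \<and> lin_indep_on (C 0) I b"
      by (intro exI[of _ "{0}"] exI[of _ "\<lambda>_ _. 1"]) (simp add: poly_deg.const)
  qed
next
  case (Suc k)
  have "\<forall>i\<le>k. closedin (zariski n) (C i) \<and> irreducible_subset (zariski n) (C i)"
    "\<forall>i<k. C i \<subset> C (Suc i)" using Suc.prems by auto
  from Suc.IH[OF this] obtain e where e: "\<And>m. \<exists>I b. finite I \<and> card I = (m + 1) ^ k \<and>
           (\<forall>i\<in>I. poly_deg n (e * m) (b i)) \<and> lin_indep_on (C k) I b" by metis
  have irr: "irreducible_subset (zariski n) (C (Suc k))" using Suc.prems by auto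
  have lt: "C k \<subset> C (Suc k)" using Suc.prems by auto
  have "C (Suc k) \<subseteq> mat_pairs n" using irr by (simp add: irreducible_subset_def)
  obtain F where F: "F \<subseteq> poly_funs n" "C k = {p \<in> mat_pairs n. \<forall>f\<in>F. f p = 0}"
    using Suc.prems(1) closedin_zariski[of n "C k"] by (auto intro: that)
  from lt obtain z where z: "z \<in> C (Suc k)" "z \<notin> C k" by blast
  then obtain g where g: "g \<in> F" "g z \<noteq> 0" using F(2) \<open>C (Suc k) \<subseteq> mat_pairs n\<close> by blast
  then have g': "g \<in> poly_funs n" "\<And>p. p \<in> C k \<Longrightarrow> g p = 0" using F by auto
  then obtain d where d: "poly_deg n d g" unfolding R_poly_funs[symmetric] pf.R_def by blast
  show ?case
  proof (intro exI[of _ "d + e"] allI)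
    fix m
    obtain I b where I: "finite I" "card I = (m + 1) ^ k" and b: "\<And>i. i \<in> I \<Longrightarrow> poly_deg n (e * m) (b i)"
      and indep: "lin_indep_on (C k) I b" using e[of m] by auto
    let ?I = "prod_encode ` ({..m} \<times> I)"
    let ?b = "\<lambda>x p. case prod_decode x of (j, i) \<Rightarrow> g p ^ j * b i p"
    have inj: "inj_on prod_encode A" for A by (rule inj_on_subset[OF inj_prod_encode]) auto
    have "b i \<in> poly_funs n" if "i \<in> I" for i
      using b[OF that] unfolding R_poly_funs[symmetric] pf.R_def by blast
    note indep' = powers_times_independent[OF irr psubset_imp_subset[OF lt] g' z(1) g(2) this indep]
    have "lin_indep_on (C (Suc k)) ?I ?b"
      unfolding lin_indep_on_def
    proof (intro allI impI ballI)
      fix c x assume 0: "\<forall>p\<in>C (Suc k). (\<Sum>x\<in>?I. c x * ?b x p) = 0" and x: "x \<in> ?I"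
      have eq: "(\<Sum>x\<in>?I. c x * ?b x p) = (\<Sum>j\<le>m. g p ^ j * (\<Sum>i\<in>I. c (prod_encode (j, i)) * b i p))" for p
        by (simp add: sum.reindex[OF inj] sum.cartesian_product[symmetric] sum_distrib_left
              mult.left_commute o_def case_prod_unfold sum.cartesian_product')
      have "c (prod_encode (j, i)) = 0" if "j \<le> m" "i \<in> I" for j i
        using indep'[where m = m and c = "\<lambda>j i. c (prod_encode (j, i))"] 0 that unfolding eq by blast
      then show "c x = 0" using x by auto
    qed
    moreover have "card ?I = (m + 1) ^ Suc k" "finite ?I"
      using I by (simp_all add: card_image[OF inj])
    moreover have "poly_deg n ((d + e) * m) (?b x)" if "x \<in> ?I" for x
    proof -
      obtain j i where x: "x = prod_encode (j, i)" "j \<le> m" "i \<in> I"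
        using \<open>x \<in> ?I\<close> by (elim imageE SigmaE) auto
      have "poly_deg n (d * m) (\<lambda>p. g p ^ j)"
        by (rule poly_deg_mono[OF poly_deg_pow[OF d]]) (use x in simp)
      from poly_deg.mult[OF this b[OF x(3)]] show ?thesis by (simp add: x(1) algebra_simps)
    qed
    ultimately show "\<exists>I b. finite I \<and> card I = (m + 1) ^ Suc k \<and>
           (\<forall>i\<in>I. poly_deg n ((d + e) * m) (b i)) \<and> lin_indep_on (C (Suc k)) I b"
      by (intro exI[of _ ?I] exI[of _ ?b] conjI ballI)
  qed
qed

section \<open>Counting monomials bounds the length of chains\<close>

interpretation fs: vector_space "\<lambda>c (f :: 'x \<Rightarrow> complex) x. c * f x"
  by unfold_locales (auto simp: fun_eq_iff algebra_simps)

lemma sum_fun_apply: "(\<Sum>i\<in>I. f i) x = (\<Sum>i\<in>I. f i (x :: 'x) :: complex)"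
  by (induction I rule: infinite_finite_induct) auto

lemma too_many_functions_dependent:
  fixes F :: "nat \<Rightarrow> 'x \<Rightarrow> complex"
  assumes B: "finite B" and I: "finite I" and F: "\<And>i. i \<in> I \<Longrightarrow> F i \<in> fs.span B" and card: "card B < card I"
  shows "\<exists>c. (\<exists>i\<in>I. c i \<noteq> 0) \<and> (\<forall>x. (\<Sum>i\<in>I. c i * F i x) = 0)"
proof (cases "inj_on F I")
  case True
  have "fs.dependent (F ` I)"
  proof (rule ccontr)
    assume "\<not> fs.dependent (F ` I)"
    with fs.independent_span_bound[OF B this] F have "card (F ` I) \<le> card B" by blast
    then show False using card by (simp add: card_image[OF True])
  qed
  then obtain u v where u: "v \<in> F ` I" "u v \<noteq> 0" "(\<Sum>v\<in>F ` I. (\<lambda>x. u v * v x)) = 0"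
    using fs.dependent_finite[of "F ` I"] I by auto
  have "(\<Sum>i\<in>I. u (F i) * F i x) = 0" for x
  proof -
    have "(\<Sum>i\<in>I. u (F i) * F i x) = (\<Sum>v\<in>F ` I. u v * v x)"
      by (simp add: sum.reindex[OF True])
    also have "\<dots> = (\<Sum>v\<in>F ` I. (\<lambda>x. u v * v x)) x" by (simp only: sum_fun_apply)
    finally show ?thesis using u(3) by simp
  qed
  then show ?thesis using u(1,2) by (intro exI[of _ "\<lambda>i. u (F i)"]) auto
next
  case False
  then obtain i j where ij: "i \<in> I" "j \<in> I" "i \<noteq> j" "F i = F j" unfolding inj_on_def by blast
  let ?c = "\<lambda>k. if k = i then 1 else if k = j then -1 else (0 :: complex)"
  have "(\<Sum>k\<in>I. ?c k * F k x) = 0" for x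
  proof -
    have "(\<Sum>k\<in>I. ?c k * F k x) = (\<Sum>k\<in>{i, j}. ?c k * F k x)"
      using ij I by (intro sum.mono_neutral_right) auto
    then show ?thesis using ij by simp
  qed
  then show ?thesis using ij(1) by (intro exI[of _ ?c]) auto
qed

text \<open>
  Monomials are bounded in each exponent separately, because then their number is an exact power.
\<close>

definition monomials :: "'q set \<Rightarrow> nat \<Rightarrow> (('q \<Rightarrow> complex) \<Rightarrow> complex) set" where
  "monomials Q m = (\<lambda>a T. \<Prod>q\<in>Q. T q ^ a q) ` {a. \<forall>q\<in>Q. a q \<le> m}"

definition box_polys :: "'q set \<Rightarrow> nat \<Rightarrow> (('q \<Rightarrow> complex) \<Rightarrow> complex) set" where
  "box_polys Q m = fs.span (monomials Q m)"

lemma monomials_eq_PiE: "monomials Q m = (\<lambda>a T. \<Prod>q\<in>Q. T q ^ a q) ` (Q \<rightarrow>\<^sub>E {..m})"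
proof (intro equalityI subsetI)
  fix f assume "f \<in> monomials Q m"
  then obtain a where a: "\<forall>q\<in>Q. a q \<le> m" "f = (\<lambda>T. \<Prod>q\<in>Q. T q ^ a q)"
    unfolding monomials_def by auto
  then have "f = (\<lambda>T. \<Prod>q\<in>Q. T q ^ restrict a Q q)" by (simp cong: prod.cong)
  moreover have "restrict a Q \<in> Q \<rightarrow>\<^sub>E {..m}" using a by auto
  ultimately show "f \<in> (\<lambda>a T. \<Prod>q\<in>Q. T q ^ a q) ` (Q \<rightarrow>\<^sub>E {..m})" by (rule image_eqI)
next
  fix f assume "f \<in> (\<lambda>a (T :: 'a \<Rightarrow> complex). \<Prod>q\<in>Q. T q ^ a q) ` (Q \<rightarrow>\<^sub>E {..m})"
  then show "f \<in> monomials Q m" unfolding monomials_def by (auto simp: PiE_iff intro!: imageI)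
qed

lemma card_monomials:
  assumes "finite Q"
  shows "finite (monomials Q m)" "card (monomials Q m) \<le> (m + 1) ^ card Q"
proof -
  have fin: "finite (Q \<rightarrow>\<^sub>E {..m})" using assms by (simp add: finite_PiE)
  then show "finite (monomials Q m)" by (simp add: monomials_eq_PiE)
  have "card (monomials Q m) \<le> card (Q \<rightarrow>\<^sub>E {..m})"
    unfolding monomials_eq_PiE using fin by (rule card_image_le)
  then show "card (monomials Q m) \<le> (m + 1) ^ card Q"
    using assms by (simp add: card_PiE)
qed

text \<open>
  It suffices to check products of generators: induction over the span in each factor in turn.
\<close>

lemma span_mult:
  assumes AB: "\<And>a b. a \<in> A \<Longrightarrow> b \<in> B \<Longrightarrow> (\<lambda>x. a x * b x) \<in> fs.span C"
    and f: "f \<in> fs.span A" and g: "g \<in> fs.span B"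
  shows "(\<lambda>x :: 'x. f x * g x) \<in> fs.span C"
proof -
  have 1: "(\<lambda>x. a x * g x) \<in> fs.span C" if "a \<in> A" for a
    using g
  proof (rule fs.span_induct)
    show "fs.subspace {h. (\<lambda>x. a x * h x) \<in> fs.span C}"
      unfolding fs.subspace_def
    proof (intro conjI ballI allI)
      show "0 \<in> {h. (\<lambda>x. a x * h x) \<in> fs.span C}"
        using fs.span_zero[of C] by (simp add: zero_fun_def)
      show "h + k \<in> {h. (\<lambda>x. a x * h x) \<in> fs.span C}"
        if "h \<in> {h. (\<lambda>x. a x * h x) \<in> fs.span C}" "k \<in> {h. (\<lambda>x. a x * h x) \<in> fs.span C}" for h k
        using that fs.span_add[of "\<lambda>x. a x * h x" C "\<lambda>x. a x * k x"]
        by (simp add: plus_fun_def algebra_simps)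
      show "(\<lambda>x. c * h x) \<in> {h. (\<lambda>x. a x * h x) \<in> fs.span C}"
        if "h \<in> {h. (\<lambda>x. a x * h x) \<in> fs.span C}" for h c
        using that fs.span_scale[of "\<lambda>x. a x * h x" C c] by (simp add: mult.left_commute)
    qed
  qed (use AB that in simp)
  show ?thesis
    using f
  proof (rule fs.span_induct)
    show "fs.subspace {h. (\<lambda>x. h x * g x) \<in> fs.span C}"
      unfolding fs.subspace_def
    proof (intro conjI ballI allI)
      show "0 \<in> {h. (\<lambda>x. h x * g x) \<in> fs.span C}"
        using fs.span_zero[of C] by (simp add: zero_fun_def)
      show "h + k \<in> {h. (\<lambda>x. h x * g x) \<in> fs.span C}"
        if "h \<in> {h. (\<lambda>x. h x * g x) \<in> fs.span C}" "k \<in> {h. (\<lambda>x. h x * g x) \<in> fs.span C}" for h k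
        using that fs.span_add[of "\<lambda>x. h x * g x" C "\<lambda>x. k x * g x"]
        by (simp add: plus_fun_def algebra_simps)
      show "(\<lambda>x. c * h x) \<in> {h. (\<lambda>x. h x * g x) \<in> fs.span C}"
        if "h \<in> {h. (\<lambda>x. h x * g x) \<in> fs.span C}" for h c
        using that fs.span_scale[of "\<lambda>x. h x * g x" C c] by (simp add: mult.assoc)
    qed
  qed (use 1 in simp)
qed

interpretation box: function_filtration "box_polys Q" for Q :: "'q set"
proof
  show "(\<lambda>_. c) \<in> box_polys Q 0" for c
  proof -
    have "(\<lambda>_. 1) \<in> monomials Q 0" unfolding monomials_def by (rule image_eqI[of _ _ "\<lambda>_. 0"]) auto
    from fs.span_scale[OF fs.span_base[OF this], of c] show ?thesis by (simp add: box_polys_def)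
  qed
  show "f \<in> box_polys Q b" if "f \<in> box_polys Q a" "a \<le> b" for f a b
  proof -
    have "monomials Q a \<subseteq> monomials Q b" unfolding monomials_def using that(2) by (intro image_mono) auto
    from fs.span_mono[OF this] that(1) show ?thesis by (auto simp: box_polys_def)
  qed
  show "(\<lambda>x. f x + g x) \<in> box_polys Q a" if "f \<in> box_polys Q a" "g \<in> box_polys Q a" for f g a
    using fs.span_add[of f _ g] that by (simp add: box_polys_def plus_fun_def)
  show "(\<lambda>x. f x * g x) \<in> box_polys Q (a + b)" if "f \<in> box_polys Q a" "g \<in> box_polys Q b" for f g a b
    unfolding box_polys_def
  proof (rule span_mult)
    fix u v assume "u \<in> monomials Q a" "v \<in> monomials Q b"
    then obtain k l where kl: "\<forall>q\<in>Q. k q \<le> a" "\<forall>q\<in>Q. l q \<le> b"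
      "u = (\<lambda>T. \<Prod>q\<in>Q. T q ^ k q)" "v = (\<lambda>T. \<Prod>q\<in>Q. T q ^ l q)"
      unfolding monomials_def by auto
    have "(\<lambda>x. u x * v x) = (\<lambda>T. \<Prod>q\<in>Q. T q ^ (k q + l q))"
      unfolding kl(3,4) by (simp add: power_add prod.distrib)
    moreover have "\<forall>q\<in>Q. k q + l q \<le> a + b" using kl(1,2) by (simp add: add_mono)
    ultimately have "(\<lambda>x. u x * v x) \<in> monomials Q (a + b)"
      unfolding monomials_def by (intro image_eqI[of _ _ "\<lambda>q. k q + l q"] CollectI)
    then show "(\<lambda>x. u x * v x) \<in> fs.span (monomials Q (a + b))" by (rule fs.span_base)
  qed (use that in \<open>simp_all add: box_polys_def\<close>)
qed

lemma coordinate_box: assumes "finite Q" "q \<in> Q" shows "(\<lambda>T. T q) \<in> box.R Q"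
proof -
  have "(\<lambda>T :: 'a \<Rightarrow> complex. T q) = (\<lambda>T. \<Prod>r\<in>Q. T r ^ (if r = q then 1 else 0))"
    using assms by (auto simp: fun_eq_iff if_distrib prod.delta cong: if_cong)
  then have "(\<lambda>T. T q) \<in> monomials Q 1"
    unfolding monomials_def by (intro image_eqI[of _ _ "\<lambda>r. if r = q then 1 else 0"]) auto
  then have "(\<lambda>T. T q) \<in> box_polys Q 1" unfolding box_polys_def by (rule fs.span_base)
  then show ?thesis unfolding box.R_def by blast
qed

text \<open>
  The witness \<open>m = (K + 1) ^ N\<close> comes from \<open>K * m + 1 \<le> (K + 1) * (m + 1)\<close>.
\<close>

lemma growth_comparison:
  fixes K N k :: nat
  assumes "N < k"
  obtains m where "(K * m + 1) ^ N < (m + 1) ^ k"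
proof -
  define m where "m = (K + 1) ^ N"
  have "K * m + 1 \<le> (K + 1) * (m + 1)" by simp
  then have "(K * m + 1) ^ N \<le> ((K + 1) * (m + 1)) ^ N" by (rule power_mono) simp
  also have "\<dots> = m * (m + 1) ^ N" unfolding m_def by (rule power_mult_distrib)
  also have "\<dots> < (m + 1) * (m + 1) ^ N" by (rule mult_strict_right_mono) simp_all
  also have "\<dots> = (m + 1) ^ Suc N" by (rule power_Suc[symmetric])
  also have "\<dots> \<le> (m + 1) ^ k" using assms by (intro power_increasing) simp_all
  finally show ?thesis by (rule that)
qed

text \<open>
  A set in which a family of conjugated pairs with \<open>card Q\<close> parameters is dense has dimension at most
  \<open>card Q\<close>: a longer chain would give more independent functions of degree \<open>d * m\<close> than there are
  monomials in the parameters that can occur in them after clearing denominators.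
\<close>

theorem chain_length_le_parameters:
  assumes Q: "finite Q" and J: "J \<in> carrier_mat n n"
    and g: "box.R_mat Q n n g" and X: "box.R_mat Q n n X"
    and dense: "\<And>f p. f \<in> poly_funs n \<Longrightarrow> (\<And>T. det (g T) \<noteq> 0 \<Longrightarrow> f (conj_pt J (g T) (X T)) = 0) \<Longrightarrow>
        p \<in> Z \<Longrightarrow> f p = 0"
    and chain: "\<forall>i\<le>k. closedin (zariski n) (C i) \<and> irreducible_subset (zariski n) (C i)"
      "\<forall>i<k. C i \<subset> C (Suc i)" and sub: "C k \<subseteq> Z"
  shows "k \<le> card Q"
proof (rule ccontr)
  assume "\<not> ?thesis"
  then have "card Q < k" by simp
  obtain d where d: "\<And>m. \<exists>I b. finite I \<and> card I = (m + 1) ^ k \<and>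
           (\<forall>i\<in>I. poly_deg n (d * m) (b i)) \<and> lin_indep_on (C k) I b"
    using chain_gives_independent_functions[OF chain] by metis
  obtain e where e: "\<And>m f. poly_deg n m f \<Longrightarrow>
     \<exists>F \<in> box_polys Q (e * m). \<forall>x. det (g x) \<noteq> 0 \<longrightarrow> F x = det (g x) ^ m * f (conj_pt J (g x) (X x))"
    using box.poly_deg_conj_pt[OF J g X] by metis
  obtain m where m: "(e * d * m + 1) ^ card Q < (m + 1) ^ k"
    using growth_comparison[OF \<open>card Q < k\<close>] by metis
  obtain I b where I: "finite I" "card I = (m + 1) ^ k"
    and b: "\<And>i. i \<in> I \<Longrightarrow> poly_deg n (d * m) (b i)" and indep: "lin_indep_on (C k) I b"
    using d[of m] by auto
  have "\<forall>i\<in>I. \<exists>F. F \<in> box_polys Q (e * (d * m)) \<and>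
      (\<forall>x. det (g x) \<noteq> 0 \<longrightarrow> F x = det (g x) ^ (d * m) * b i (conj_pt J (g x) (X x)))"
    using e[OF b] by (simp add: Bex_def)
  then obtain F where F: "\<And>i. i \<in> I \<Longrightarrow> F i \<in> box_polys Q (e * (d * m))"
    "\<And>i x. i \<in> I \<Longrightarrow> det (g x) \<noteq> 0 \<Longrightarrow> F i x = det (g x) ^ (d * m) * b i (conj_pt J (g x) (X x))"
    using bchoice[of I] by metis
  have "card (monomials Q (e * (d * m))) < card I"
    using card_monomials(2)[OF Q, of "e * (d * m)"] m I(2) by (simp add: mult.assoc)
  then have "\<exists>c. (\<exists>i\<in>I. c i \<noteq> 0) \<and> (\<forall>x. (\<Sum>i\<in>I. c i * F i x) = 0)"
    by (intro too_many_functions_dependent[OF card_monomials(1)[OF Q, of "e * (d * m)"] I(1)])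
      (use F(1) in \<open>simp_all only: box_polys_def\<close>)
  then obtain c where "\<exists>i\<in>I. c i \<noteq> 0" and c: "\<forall>x. (\<Sum>i\<in>I. c i * F i x) = 0"
    by (elim exE conjE) (rule that)
  then obtain i where i: "i \<in> I" "c i \<noteq> 0" by (elim bexE)
  have "(\<Sum>i\<in>I. c i * b i p) = 0" if "p \<in> C k" for p
  proof (rule dense)
    show "(\<lambda>p. \<Sum>i\<in>I. c i * b i p) \<in> poly_funs n"
    proof (intro poly_funs_sum poly_funs.mult poly_funs.const)
      show "b i \<in> poly_funs n" if "i \<in> I" for i
        using b[OF that] unfolding R_poly_funs[symmetric] pf.R_def by blast
    qed
    show "p \<in> Z" using that sub by blast
    fix T assume T: "det (g T) \<noteq> 0"
    have "det (g T) ^ (d * m) * (\<Sum>i\<in>I. c i * b i (conj_pt J (g T) (X T))) = (\<Sum>i\<in>I. c i * F i T)"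
      by (simp add: sum_distrib_left F(2)[OF _ T] mult.left_commute)
    then show "(\<Sum>i\<in>I. c i * b i (conj_pt J (g T) (X T))) = 0" using c T by simp
  qed
  from lin_indep_onD[OF indep this i(1)] i(2) show False by blast
qed

section \<open>Cramer's rule and pivots\<close>

context function_filtration begin

text \<open>
  \<open>D\<close> is the determinant and \<open>N\<close> the adjugate applied to the right-hand side. The system is indexed by
  an arbitrary finite set, since below both unknowns and equations are indexed by positions of a
  matrix; the enumeration that turns it into a matrix stays inside this proof.
\<close>

lemma cramer:
  fixes a :: "'x \<Rightarrow> 'p \<Rightarrow> 'p \<Rightarrow> complex" and \<beta> :: "'x \<Rightarrow> 'p \<Rightarrow> complex"
  assumes P: "finite S" and a: "\<forall>p\<in>S. \<forall>q\<in>S. (\<lambda>x. a x p q) \<in> R"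
    and \<beta>: "\<forall>p\<in>S. (\<lambda>x. \<beta> x p) \<in> R"
  shows "\<exists>D\<in>R. \<exists>N. (\<forall>q\<in>S. N q \<in> R) \<and>
    (\<forall>x. \<forall>p\<in>S. (\<Sum>q\<in>S. a x p q * N q x) = D x * \<beta> x p) \<and>
    (\<forall>x u. (\<forall>p\<in>S. (\<Sum>q\<in>S. a x p q * u q) = \<beta> x p) \<longrightarrow> (\<forall>q\<in>S. N q x = D x * u q)) \<and>
    (\<forall>x. (\<forall>u. (\<forall>p\<in>S. (\<Sum>q\<in>S. a x p q * u q) = 0) \<longrightarrow> (\<forall>q\<in>S. u q = 0)) \<longrightarrow> D x \<noteq> 0)"
proof -
  define c where "c = card S"
  obtain e where e: "bij_betw e {..<c} S"
    using ex_bij_betw_nat_finite[OF P] by (auto simp: c_def atLeast0LessThan)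
  define e' where "e' = inv_into {..<c} e"
  have e'e: "e' (e i) = i" if "i < c" for i
    unfolding e'_def by (rule bij_betw_inv_into_left[OF e]) (use that in simp)
  have ee': "e (e' q) = q" "e' q < c" if "q \<in> S" for q
    using bij_betw_inv_into_right[OF e that] bij_betwE[OF bij_betw_inv_into[OF e]] that
    by (auto simp: e'_def)
  have eS: "e i \<in> S" if "i < c" for i using bij_betwE[OF e] that by auto
  define A where "A x = mat c c (\<lambda>(i, j). a x (e i) (e j))" for x
  define v where "v x = mat c 1 (\<lambda>(i, j). \<beta> x (e i))" for x
  define w where "w x = adj_mat (A x) * v x" for x
  define D where "D x = det (A x)" for x
  have Ac: "A x \<in> carrier_mat c c" and vc: "v x \<in> carrier_mat c 1" for x by (simp_all add: A_def v_def)
  have adjc: "adj_mat (A x) \<in> carrier_mat c c" for x by (rule adj_mat_carrier[OF Ac])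
  have wc: "w x \<in> carrier_mat c 1" for x unfolding w_def by (rule mult_carrier_mat[OF adjc vc])
  have RA: "R_mat c c A" by (rule R_matI[OF Ac]) (simp add: A_def a eS)
  have "R_mat c 1 v" by (rule R_matI[OF vc]) (simp add: v_def \<beta> eS)
  from R_mat_mult[OF R_adj_mat[OF RA] this] have Rw: "R_mat c 1 w" unfolding w_def[abs_def] .
  have sum_e: "(\<Sum>q\<in>S. f q) = (\<Sum>j<c. f (e j))" for f :: "'p \<Rightarrow> complex"
    by (rule sum.reindex_bij_betw[OF e, symmetric])
  have A_mult: "(A x * M) $$ (i, 0) = (\<Sum>j<c. a x (e i) (e j) * M $$ (j, 0))"
    if "M \<in> carrier_mat c 1" "i < c" for x M i
    using that by (simp add: A_def scalar_prod_def atLeast0LessThan)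
  show ?thesis
  proof (intro bexI[of _ D] exI[of _ "\<lambda>q x. w x $$ (e' q, 0)"] conjI allI ballI impI)
    show "D \<in> R" using R_det[OF RA] by (simp add: D_def[abs_def])
    show "(\<lambda>x. w x $$ (e' q, 0)) \<in> R" if "q \<in> S" for q using R_mat_entry[OF Rw] ee'[OF that] by simp
    show "(\<Sum>q\<in>S. a x p q * w x $$ (e' q, 0)) = D x * \<beta> x p" if "p \<in> S" for x p
    proof -
      have "A x * w x = (A x * adj_mat (A x)) * v x"
        unfolding w_def by (rule assoc_mult_mat[OF Ac adjc vc, symmetric])
      also have "\<dots> = D x \<cdot>\<^sub>m v x"
        unfolding adj_mat(2)[OF Ac] D_def by (simp only: mult_smult_assoc_mat[OF one_carrier_mat vc] left_mult_one_mat[OF vc])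
      finally have "(A x * w x) $$ (e' p, 0) = D x * \<beta> x p"
        using vc ee'[OF that] by (simp add: v_def)
      then show ?thesis using ee'[OF that] by (simp add: A_mult[OF wc] sum_e e'e)
    qed
    show "w x $$ (e' q, 0) = D x * u q"
      if u: "\<forall>p\<in>S. (\<Sum>q\<in>S. a x p q * u q) = \<beta> x p" and q: "q \<in> S" for x u q
    proof -
      define M where "M = mat c 1 (\<lambda>(i, j). u (e i))"
      have Mc: "M \<in> carrier_mat c 1" by (simp add: M_def)
      have "A x * M = v x"
      proof (rule eq_matI)
        fix i j assume "i < dim_row (v x)" "j < dim_col (v x)"
        then have ij: "i < c" "j = 0" using carrier_matD[OF vc[of x]] by simp_all
        have "(A x * M) $$ (i, 0) = (\<Sum>j<c. a x (e i) (e j) * u (e j))"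
          unfolding A_mult[OF Mc ij(1)] by (simp add: M_def)
        also have "\<dots> = \<beta> x (e i)" using bspec[OF u eS[OF ij(1)]] by (simp add: sum_e)
        finally show "(A x * M) $$ (i, j) = v x $$ (i, j)" using ij by (simp add: v_def)
      qed (use Mc vc Ac in \<open>auto simp: A_def M_def v_def\<close>)
      then have "w x = adj_mat (A x) * A x * M"
        unfolding w_def using assoc_mult_mat[OF adjc Ac Mc] by simp
      also have "\<dots> = D x \<cdot>\<^sub>m M"
        unfolding adj_mat(3)[OF Ac] D_def by (simp only: mult_smult_assoc_mat[OF one_carrier_mat Mc] left_mult_one_mat[OF Mc])
      finally show ?thesis using ee'[OF q] by (simp add: M_def)
    qed
    show "D x \<noteq> 0"
      if ker: "\<forall>u. (\<forall>p\<in>S. (\<Sum>q\<in>S. a x p q * u q) = 0) \<longrightarrow> (\<forall>q\<in>S. u q = 0)" for x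
    proof
      assume "D x = 0"
      then obtain y where y: "y \<in> carrier_vec c" "y \<noteq> 0\<^sub>v c" "A x *\<^sub>v y = 0\<^sub>v c"
        using det_0_iff_vec_prod_zero[OF Ac] by (auto simp: D_def)
      have "(\<Sum>q\<in>S. a x p q * y $ e' q) = 0" if p: "p \<in> S" for p
      proof -
        have "(A x *\<^sub>v y) $ e' p = (\<Sum>j<c. a x p (e j) * y $ j)"
          using y(1) ee'[OF p] by (simp add: A_def scalar_prod_def atLeast0LessThan)
        then show ?thesis using y(3) ee'[OF p] by (simp add: sum_e e'e)
      qed
      with ker[THEN spec, of "\<lambda>q. y $ e' q"] have "y $ e' q = 0" if "q \<in> S" for q using that by simp
      then have "y $ i = 0" if "i < c" for i using e'e[OF that] eS[OF that] by metis
      then have "y = 0\<^sub>v c" using y(1) by (intro eq_vecI) auto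
      with y(2) show False by blast
    qed
  qed
qed

end

text \<open>
  A reduced echelon basis \<open>b\<close> with pivot positions \<open>P\<close>. A position \<open>x\<close> is dropped if the
  remaining positions \<open>Q\<close> still determine the matrices in \<open>W\<close>. Otherwise some matrix in \<open>W\<close> vanishes on
  \<open>Q\<close> but not at \<open>x\<close>; it is the basis element for the pivot \<open>x\<close>, and the other basis elements are
  found among the matrices that vanish at \<open>x\<close>.
\<close>

lemma pivots:
  assumes "finite Q" "Q \<subseteq> {..<n} \<times> {..<n}" "W \<subseteq> carrier_mat n n"
    and "\<And>A c. A \<in> W \<Longrightarrow> c \<cdot>\<^sub>m A \<in> W"
    and "\<And>A. A \<in> W \<Longrightarrow> (\<And>q. q \<in> Q \<Longrightarrow> A $$ q = 0) \<Longrightarrow> A = 0\<^sub>m n n"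
  shows "\<exists>P\<subseteq>Q. \<exists>b :: nat \<times> nat \<Rightarrow> complex mat.
     (\<forall>p\<in>P. b p \<in> W \<and> (\<forall>q\<in>P. b p $$ q = (if p = q then 1 else 0))) \<and>
     (\<forall>A\<in>W. (\<forall>p\<in>P. A $$ p = 0) \<longrightarrow> A = 0\<^sub>m n n)"
  using assms
proof (induction Q arbitrary: W rule: finite_induct)
  case empty
  then show ?case by (intro exI[of _ "{}"]) auto
next
  case (insert x Q)
  show ?case
  proof (cases "\<forall>A\<in>W. (\<forall>q\<in>Q. A $$ q = 0) \<longrightarrow> A = 0\<^sub>m n n")
    case True
    have "\<exists>P\<subseteq>Q. \<exists>b :: nat \<times> nat \<Rightarrow> complex mat.
     (\<forall>p\<in>P. b p \<in> W \<and> (\<forall>q\<in>P. b p $$ q = (if p = q then 1 else 0))) \<and>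
     (\<forall>A\<in>W. (\<forall>p\<in>P. A $$ p = 0) \<longrightarrow> A = 0\<^sub>m n n)"
      using insert.prems True by (intro insert.IH) auto
    then show ?thesis by (elim ex_forward conj_forward subset_insertI2)
  next
    case False
    then obtain A where A: "A \<in> W" "\<And>q. q \<in> Q \<Longrightarrow> A $$ q = 0" "A \<noteq> 0\<^sub>m n n" by blast
    have x: "x \<in> {..<n} \<times> {..<n}" using insert.prems by auto
    have Ax: "A $$ x \<noteq> 0"
      using insert.prems(4)[OF A(1)] A(2,3) by auto
    define B where "B = inverse (A $$ x) \<cdot>\<^sub>m A"
    have Ac: "A \<in> carrier_mat n n" using A(1) insert.prems(2) by auto
    have B: "B \<in> W" "B $$ x = 1" "\<And>q. q \<in> Q \<Longrightarrow> B $$ q = 0"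
    proof -
      show "B \<in> W" unfolding B_def by (rule insert.prems(3)[OF A(1)])
      show "B $$ x = 1" using x Ax Ac by (auto simp: B_def)
      show "B $$ q = 0" if "q \<in> Q" for q
      proof -
        have "q \<in> {..<n} \<times> {..<n}" using that insert.prems(1) by auto
        then show ?thesis using A(2)[OF that] Ac by (auto simp: B_def)
      qed
    qed
    define V where "V = {A \<in> W. A $$ x = 0}"
    have Vs: "c \<cdot>\<^sub>m M \<in> V" if "M \<in> V" for M c
    proof -
      have "M \<in> carrier_mat n n" using that insert.prems(2) by (auto simp: V_def)
      then show ?thesis using that x insert.prems(3) by (auto simp: V_def)
    qed
    have V0: "M = 0\<^sub>m n n" if "M \<in> V" "\<And>q. q \<in> Q \<Longrightarrow> M $$ q = 0" for M
      using insert.prems(4)[of M] that by (auto simp: V_def)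
    have "\<exists>P\<subseteq>Q. \<exists>b :: nat \<times> nat \<Rightarrow> complex mat.
     (\<forall>p\<in>P. b p \<in> V \<and> (\<forall>q\<in>P. b p $$ q = (if p = q then 1 else 0))) \<and>
     (\<forall>A\<in>V. (\<forall>p\<in>P. A $$ p = 0) \<longrightarrow> A = 0\<^sub>m n n)"
      using insert.prems(1,2) by (intro insert.IH Vs V0) (auto simp: V_def)
    then obtain P b where P: "P \<subseteq> Q"
      and b: "\<And>p. p \<in> P \<Longrightarrow> b p \<in> V" "\<And>p q. p \<in> P \<Longrightarrow> q \<in> P \<Longrightarrow> b p $$ q = (if p = q then 1 else 0)"
      and det: "\<And>A. A \<in> V \<Longrightarrow> (\<And>p. p \<in> P \<Longrightarrow> A $$ p = 0) \<Longrightarrow> A = 0\<^sub>m n n" by metis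
    have xP: "x \<notin> P" using P insert.hyps by auto
    let ?b = "b(x := B)"
    show ?thesis
    proof (intro exI[of _ "insert x P"] exI[of _ ?b] conjI ballI impI)
      show "insert x P \<subseteq> insert x Q" using P by auto
      have bV: "b p \<in> W" "b p $$ x = 0" if "p \<in> P" for p using b(1)[OF that] by (simp_all add: V_def)
      have BP: "B $$ q = 0" if "q \<in> P" for q using B(3) P that by blast
      show "?b p \<in> W" if "p \<in> insert x P" for p using that bV(1) B(1) by (cases "p = x") simp_all
      show "?b p $$ q = (if p = q then 1 else 0)" if "p \<in> insert x P" "q \<in> insert x P" for p q
        using that b(2) B(2) bV(2) BP xP by (cases "p = x"; cases "q = x") auto
      show "M = 0\<^sub>m n n" if "M \<in> W" "\<forall>p\<in>insert x P. M $$ p = 0" for M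
        using that by (intro det) (simp_all add: V_def)
    qed
  qed
qed

lemma det_nonzero_inverse:
  assumes "g \<in> carrier_mat n n" "det g \<noteq> (0 :: complex)"
  obtains g' where "g' \<in> carrier_mat n n" "g * g' = 1\<^sub>m n" "g' * g = 1\<^sub>m n"
proof
  let ?g' = "inverse (det g) \<cdot>\<^sub>m adj_mat g"
  have adj: "adj_mat g \<in> carrier_mat n n" by (rule adj_mat_carrier[OF assms(1)])
  show "?g' \<in> carrier_mat n n" using adj by simp
  show "g * ?g' = 1\<^sub>m n"
    unfolding mult_smult_distrib[OF assms(1) adj] adj_mat(2)[OF assms(1)] using assms(2)
    by (auto intro!: eq_matI)
  show "?g' * g = 1\<^sub>m n"
    unfolding mult_smult_assoc_mat[OF adj assms(1)] adj_mat(3)[OF assms(1)] using assms(2)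
    by (auto intro!: eq_matI)
qed

text \<open>
  The description of conjugation without inverses, which is linear in \<open>g\<close>.
\<close>

lemma conj_pt_eq_iff:
  assumes c: "J \<in> carrier_mat n n" "g \<in> carrier_mat n n" "X \<in> carrier_mat n n" "det g \<noteq> 0"
    and AB: "A \<in> carrier_mat n n" "B \<in> carrier_mat n n"
  shows "conj_pt J g X = (A, B) \<longleftrightarrow> A * g = g * X \<and> B * g = g * J"
proof -
  have *: "inverse (det g) \<cdot>\<^sub>m (g * M * adj_mat g) = N \<longleftrightarrow> N * g = g * M"
    if M: "M \<in> carrier_mat n n" and N: "N \<in> carrier_mat n n" for M N
  proof
    note adj = adj_mat_carrier[OF c(2)]
    have gM: "g * M \<in> carrier_mat n n" using c(2) M by simp
    show "N * g = g * M" if "inverse (det g) \<cdot>\<^sub>m (g * M * adj_mat g) = N"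
    proof -
      have "N * g = inverse (det g) \<cdot>\<^sub>m (g * M * adj_mat g * g)"
        unfolding that[symmetric] by (rule mult_smult_assoc_mat[OF mult_carrier_mat[OF gM adj] c(2)])
      also have "g * M * adj_mat g * g = g * M * (adj_mat g * g)"
        by (rule assoc_mult_mat[OF gM adj c(2)])
      also have "\<dots> = det g \<cdot>\<^sub>m (g * M)"
        unfolding adj_mat(3)[OF c(2)] by (simp only: mult_smult_distrib[OF gM one_carrier_mat] right_mult_one_mat[OF gM])
      also have "inverse (det g) \<cdot>\<^sub>m (det g \<cdot>\<^sub>m (g * M)) = g * M"
        using c(4) by (auto intro!: eq_matI simp del: index_mult_mat(1))
      finally show ?thesis .
    qed
    show "inverse (det g) \<cdot>\<^sub>m (g * M * adj_mat g) = N" if "N * g = g * M"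
    proof -
      have "g * M * adj_mat g = N * (g * adj_mat g)"
        unfolding that[symmetric] by (rule assoc_mult_mat[OF N c(2) adj])
      also have "\<dots> = det g \<cdot>\<^sub>m N"
        unfolding adj_mat(2)[OF c(2)] by (simp only: mult_smult_distrib[OF N one_carrier_mat] right_mult_one_mat[OF N])
      finally show ?thesis using c(4) N by (auto intro!: eq_matI)
    qed
  qed
  show ?thesis unfolding conj_pt_def using *[OF c(3) AB(1)] *[OF c(1) AB(2)] by simp
qed

section \<open>Pairs whose second matrix is conjugate to a fixed one\<close>

definition lin_comb :: "nat \<Rightarrow> (nat \<times> nat) set \<Rightarrow> (nat \<times> nat \<Rightarrow> complex mat) \<Rightarrow> (nat \<times> nat \<Rightarrow> complex) \<Rightarrow> complex mat" where
  "lin_comb n S b x = mat n n (\<lambda>ij. \<Sum>p\<in>S. x p * b p $$ ij)"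

lemma lin_comb_carrier [simp]: "lin_comb n S b x \<in> carrier_mat n n"
  by (simp add: lin_comb_def)

lemma lin_comb_entry: "i < n \<Longrightarrow> j < n \<Longrightarrow> lin_comb n S b x $$ (i, j) = (\<Sum>p\<in>S. x p * b p $$ (i, j))"
  by (simp add: lin_comb_def)

lemma mult_lin_comb:
  assumes "g \<in> carrier_mat n n" "\<And>p. p \<in> S \<Longrightarrow> b p \<in> carrier_mat n n"
  shows "g * lin_comb n S b x = lin_comb n S (\<lambda>p. g * b p) x"
proof (rule eq_matI)
  fix i j assume "i < dim_row (lin_comb n S (\<lambda>p. g * b p) x)" "j < dim_col (lin_comb n S (\<lambda>p. g * b p) x)"
  then have ij: "i < n" "j < n" by (simp_all add: lin_comb_def)
  have "(g * lin_comb n S b x) $$ (i, j) = (\<Sum>k<n. g $$ (i, k) * (\<Sum>p\<in>S. x p * b p $$ (k, j)))"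
    using assms(1) ij by (simp add: lin_comb_def scalar_prod_def atLeast0LessThan)
  also have "\<dots> = (\<Sum>p\<in>S. x p * (\<Sum>k<n. g $$ (i, k) * b p $$ (k, j)))"
    by (simp add: sum_distrib_left mult.left_commute) (rule sum.swap)
  also have "\<dots> = (\<Sum>p\<in>S. x p * (g * b p) $$ (i, j))"
  proof (intro sum.cong refl)
    fix p assume "p \<in> S"
    then show "x p * (\<Sum>k<n. g $$ (i, k) * b p $$ (k, j)) = x p * (g * b p) $$ (i, j)"
      using assms(1) assms(2)[of p] ij by (simp add: scalar_prod_def atLeast0LessThan)
  qed
  finally show "(g * lin_comb n S b x) $$ (i, j) = lin_comb n S (\<lambda>p. g * b p) x $$ (i, j)"
    using ij by (simp add: lin_comb_entry)
qed (use assms in \<open>auto simp: lin_comb_def\<close>)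

lemma lin_comb_mult:
  assumes "g \<in> carrier_mat n n" "\<And>p. p \<in> S \<Longrightarrow> b p \<in> carrier_mat n n"
  shows "lin_comb n S b x * g = lin_comb n S (\<lambda>p. b p * g) x"
proof (rule eq_matI)
  fix i j assume "i < dim_row (lin_comb n S (\<lambda>p. b p * g) x)" "j < dim_col (lin_comb n S (\<lambda>p. b p * g) x)"
  then have ij: "i < n" "j < n" by (simp_all add: lin_comb_def)
  have "(lin_comb n S b x * g) $$ (i, j) = (\<Sum>k<n. (\<Sum>p\<in>S. x p * b p $$ (i, k)) * g $$ (k, j))"
    using assms(1) ij by (simp add: lin_comb_def scalar_prod_def atLeast0LessThan)
  also have "\<dots> = (\<Sum>p\<in>S. x p * (\<Sum>k<n. b p $$ (i, k) * g $$ (k, j)))"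
    by (simp add: sum_distrib_left sum_distrib_right mult.assoc) (rule sum.swap)
  also have "\<dots> = (\<Sum>p\<in>S. x p * (b p * g) $$ (i, j))"
  proof (intro sum.cong refl)
    fix p assume "p \<in> S"
    then show "x p * (\<Sum>k<n. b p $$ (i, k) * g $$ (k, j)) = x p * (b p * g) $$ (i, j)"
      using assms(1) assms(2)[of p] ij by (simp add: scalar_prod_def atLeast0LessThan)
  qed
  finally show "(lin_comb n S b x * g) $$ (i, j) = lin_comb n S (\<lambda>p. b p * g) x $$ (i, j)"
    using ij by (simp add: lin_comb_entry)
qed (use assms in \<open>auto simp: lin_comb_def\<close>)

lemma lin_comb_cong: "(\<And>p. p \<in> S \<Longrightarrow> b p = b' p) \<Longrightarrow> (\<And>p. p \<in> S \<Longrightarrow> x p = x' p) \<Longrightarrow>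
    lin_comb n S b x = lin_comb n S b' x'"
  by (simp add: lin_comb_def cong: sum.cong)

text \<open>
  The pairs \<open>(X, Y)\<close> of the variety with \<open>Y\<close> conjugate to \<open>J\<close> form a bundle over the conjugacy class
  of \<open>J\<close>. The fibre over \<open>J\<close> is the affine space of all solutions \<open>X\<close> of the linear equation
  \<open>X * J - J * X = J * J\<close>, a translate of the centralizer of \<open>J\<close>; the matrix \<open>X0\<close> witnesses that it
  is not empty.
\<close>

locale fibre_bundle =
  fixes n :: nat and J X0 :: "complex mat"
  assumes J: "J \<in> carrier_mat n n" and X0: "X0 \<in> carrier_mat n n"
    and X0_rel: "X0 * J - J * X0 = J * J"
begin

definition centralizer :: "complex mat set" where
  "centralizer = {Z \<in> carrier_mat n n. Z * J = J * Z}"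

definition fibre :: "complex mat set" where
  "fibre = {X \<in> carrier_mat n n. X * J - J * X = J * J}"

definition orbit_family :: "(complex mat \<times> complex mat) set" where
  "orbit_family = conj_image J (carrier_mat n n \<times> fibre)"

lemma centralizer_carrier: "Z \<in> centralizer \<Longrightarrow> Z \<in> carrier_mat n n"
  and centralizer_commute: "Z \<in> centralizer \<Longrightarrow> Z * J = J * Z"
  by (auto simp: centralizer_def)

lemma centralizer_smult: assumes "Z \<in> centralizer" shows "c \<cdot>\<^sub>m Z \<in> centralizer"
proof -
  note Z = centralizer_carrier[OF assms]
  show ?thesis
    using Z by (simp add: centralizer_def mult_smult_distrib[OF J Z] mult_smult_assoc_mat[OF Z J]
        centralizer_commute[OF assms])
qed

lemma one_centralizer: "1\<^sub>m n \<in> centralizer"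
  using J by (simp add: centralizer_def)

lemma centralizer_lin_comb:
  assumes "\<And>p. p \<in> S \<Longrightarrow> b p \<in> centralizer"
  shows "lin_comb n S b x \<in> centralizer"
proof -
  have c: "b p \<in> carrier_mat n n" if "p \<in> S" for p using centralizer_carrier[OF assms[OF that]] .
  have "lin_comb n S b x * J = lin_comb n S (\<lambda>p. b p * J) x" by (rule lin_comb_mult[OF J c])
  also have "\<dots> = lin_comb n S (\<lambda>p. J * b p) x"
    by (rule lin_comb_cong) (simp_all add: centralizer_commute[OF assms])
  also have "\<dots> = J * lin_comb n S b x" by (rule mult_lin_comb[OF J c, symmetric])
  finally show ?thesis by (simp add: centralizer_def)
qed

lemma fibre_iff: "X \<in> fibre \<longleftrightarrow> X \<in> carrier_mat n n \<and> X - X0 \<in> centralizer"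
proof (cases "X \<in> carrier_mat n n")
  case True
  note c = True X0 J
  have "X * J - J * X = J * J \<longleftrightarrow> X * J - J * X = X0 * J - J * X0" using X0_rel by simp
  also have "\<dots> \<longleftrightarrow> X * J - X0 * J = J * X - J * X0"
  proof -
    have cc: "X * J \<in> carrier_mat n n" "J * X \<in> carrier_mat n n" "X0 * J \<in> carrier_mat n n" "J * X0 \<in> carrier_mat n n"
      using c by auto
    have *: "A - B = C - D \<longleftrightarrow> A - C = B - D"
      if "A \<in> carrier_mat n n" "B \<in> carrier_mat n n" "C \<in> carrier_mat n n" "D \<in> carrier_mat n n"
      for A B C D :: "complex mat"
    proof -
      have "a - b = c - d \<longleftrightarrow> a - c = b - d" for a b c d :: complex by (auto simp: algebra_simps)
      then show ?thesis using that by (auto simp: mat_eq_iff)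
    qed
    show ?thesis by (rule *[OF cc(1,2,3,4)])
  qed
  also have "\<dots> \<longleftrightarrow> (X - X0) * J = J * (X - X0)"
    using c by (simp add: minus_mult_distrib_mat[OF c] mult_minus_distrib_mat[OF J True X0])
  finally show ?thesis using c minus_carrier_mat[OF X0, of X] by (simp add: fibre_def centralizer_def)
qed (auto simp: fibre_def)

lemma fibre_carrier: "X \<in> fibre \<Longrightarrow> X \<in> carrier_mat n n"
  by (simp add: fibre_def)

text \<open>
  The group of invertible elements of the centralizer acts on the fibre.
\<close>

lemma fibre_conj:
  assumes h: "h \<in> centralizer" and h': "h' \<in> carrier_mat n n" "h * h' = 1\<^sub>m n" "h' * h = 1\<^sub>m n"
    and X: "X \<in> fibre"
  shows "h' * X * h \<in> fibre"
proof -
  note hc = centralizer_carrier[OF h] and Xc = fibre_carrier[OF X] and hJ = centralizer_commute[OF h]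
  have J_conj: "h' * J * h = J"
  proof -
    have "h' * J * h = h' * (h * J)" unfolding hJ by (rule assoc_mult_mat[OF h'(1) J hc])
    also have "\<dots> = h' * h * J" by (rule assoc_mult_mat[OF h'(1) hc J, symmetric])
    finally show ?thesis using J h'(3) by simp
  qed
  have conj_mult: "h' * A * h * (h' * B * h) = h' * (A * B) * h"
    if A: "A \<in> carrier_mat n n" and B: "B \<in> carrier_mat n n" for A B
  proof -
    have "h' * A * h * (h' * B * h) = h' * A * (h * h') * B * h"
      using h'(1) hc A B by (simp add: assoc_mult_mat[of _ n n _ n _ n])
    also have "\<dots> = h' * (A * B) * h"
      unfolding h'(2) using h'(1) hc A B by (simp add: assoc_mult_mat[of _ n n _ n _ n])
    finally show ?thesis .
  qed
  have "h' * X * h * J - J * (h' * X * h) = h' * (X * J) * h - h' * (J * X) * h"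
    using conj_mult[OF Xc J] conj_mult[OF J Xc] by (simp add: J_conj)
  also have "\<dots> = h' * (X * J - J * X) * h"
    using h'(1) hc J Xc by (simp add: mult_minus_distrib_mat[of _ n n _ n] minus_mult_distrib_mat[of _ n n _ _ n])
  also have "\<dots> = h' * (J * J) * h" using X by (simp add: fibre_def)
  also have "\<dots> = J * J" using conj_mult[OF J J] by (simp add: J_conj)
  finally show ?thesis using h'(1) hc Xc by (simp add: fibre_def)
qed

text \<open>
  This is the redundancy of the parametrisation by all of \<open>carrier_mat n n \<times> fibre\<close>: if
  \<open>A * g = g * X\<close>, then \<open>A * (g * h) = (g * h) * (h' * X * h)\<close> for \<open>h'\<close> inverse to \<open>h\<close>, and \<open>h\<close> commutes with \<open>J\<close>.
\<close>

lemma conj_pt_centralizer: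
  assumes g: "g \<in> carrier_mat n n" "det g \<noteq> 0" and h: "h \<in> centralizer"
    and h': "h' \<in> carrier_mat n n" "h * h' = 1\<^sub>m n" "h' * h = 1\<^sub>m n" and X: "X \<in> carrier_mat n n"
  shows "conj_pt J (g * h) (h' * X * h) = conj_pt J g X"
proof -
  note hc = centralizer_carrier[OF h] and hJ = centralizer_commute[OF h]
  obtain A B where AB: "conj_pt J g X = (A, B)" by fastforce
  then have c: "A \<in> carrier_mat n n" "B \<in> carrier_mat n n"
    using conj_pt_mat_pairs[OF J g(1) X] by (simp_all add: mat_pairs_def)
  have eq: "A * g = g * X" "B * g = g * J"
    using AB conj_pt_eq_iff[OF J g(1) X g(2) c] by simp_all
  have "det h * det h' = 1" using det_mult[OF hc h'(1)] h'(2) by simp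
  then have "det (g * h) \<noteq> 0" using g by (auto simp: det_mult[OF g(1) hc])
  moreover have "A * (g * h) = g * h * (h' * X * h)"
  proof -
    have "g * h * (h' * X * h) = g * (h * h') * X * h"
      using g(1) hc h'(1) X by (simp add: assoc_mult_mat[of _ n n _ n _ n])
    also have "\<dots> = A * g * h" unfolding h'(2) eq(1) using g(1) by simp
    finally show ?thesis using assoc_mult_mat[OF c(1) g(1) hc] by simp
  qed
  moreover have "B * (g * h) = g * h * J"
  proof -
    have "B * (g * h) = g * J * h" using assoc_mult_mat[OF c(2) g(1) hc] eq(2) by simp
    then show ?thesis using assoc_mult_mat[OF g(1) J hc] assoc_mult_mat[OF g(1) hc J] hJ by simp
  qed
  ultimately show ?thesis
    unfolding AB using g(1) hc h'(1) X J c by (subst conj_pt_eq_iff) auto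
qed

lemma X0_fibre: "X0 \<in> fibre" using X0 X0_rel by (simp add: fibre_def)

lemma conj_pt_one: assumes "X \<in> carrier_mat n n" shows "conj_pt J (1\<^sub>m n) X = (X, J)"
  using assms J by (subst conj_pt_eq_iff) auto

lemma centralizer_add:
  assumes "A \<in> centralizer" "B \<in> centralizer" shows "A + B \<in> centralizer"
proof -
  note c = centralizer_carrier[OF assms(1)] centralizer_carrier[OF assms(2)]
  show ?thesis
    using c by (simp add: centralizer_def add_mult_distrib_mat[OF c J] mult_add_distrib_mat[OF J c]
        centralizer_commute[OF assms(1)] centralizer_commute[OF assms(2)])
qed

lemma centralizer_line:
  assumes "A \<in> centralizer" "B \<in> centralizer" shows "line A B t \<in> centralizer"
  unfolding line_def by (intro centralizer_add centralizer_smult assms)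

lemma fibre_line: assumes "A \<in> fibre" "B \<in> fibre" shows "line A B t \<in> fibre"
proof -
  have c: "A \<in> carrier_mat n n" "B \<in> carrier_mat n n" using assms fibre_carrier by auto
  have "line A B t - X0 = line (A - X0) (B - X0) t"
    using c X0 by (auto simp: line_def algebra_simps intro!: eq_matI)
  then show ?thesis using assms c centralizer_line unfolding fibre_iff by simp
qed

lemma orbit_family_irreducible: "irreducible_subset (zariski n) orbit_family"
  unfolding orbit_family_def
proof (rule irreducible_conj_image[OF J])
  show "carrier_mat n n \<times> fibre \<subseteq> mat_pairs n" using fibre_carrier by (auto simp: mat_pairs_def)
  show "line_closed (carrier_mat n n \<times> fibre)" by (auto simp: line_closed_def fibre_line)
  have "conj_pt J (1\<^sub>m n) X0 \<in> conj_image J (carrier_mat n n \<times> fibre)"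
    by (rule conj_imageI) (use X0_fibre in auto)
  then show "conj_image J (carrier_mat n n \<times> fibre) \<noteq> {}" by blast
qed

definition indices :: "(nat \<times> nat) set" where "indices = {..<n} \<times> {..<n}"

lemma ex_pivots: "\<exists>P b. P \<subseteq> indices \<and>
     (\<forall>p\<in>P. b p \<in> centralizer \<and> (\<forall>q\<in>P. b p $$ q = (if p = q then 1 else 0))) \<and>
     (\<forall>A\<in>centralizer. (\<forall>p\<in>P. A $$ p = 0) \<longrightarrow> A = 0\<^sub>m n n)"
proof -
  have "\<exists>P\<subseteq>indices. \<exists>b :: nat \<times> nat \<Rightarrow> complex mat.
     (\<forall>p\<in>P. b p \<in> centralizer \<and> (\<forall>q\<in>P. b p $$ q = (if p = q then 1 else 0))) \<and>
     (\<forall>A\<in>centralizer. (\<forall>p\<in>P. A $$ p = 0) \<longrightarrow> A = 0\<^sub>m n n)"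
  proof (rule pivots)
    show "finite indices" "indices \<subseteq> {..<n} \<times> {..<n}" by (simp_all add: indices_def)
    show "centralizer \<subseteq> carrier_mat n n" by (auto simp: centralizer_def)
    show "c \<cdot>\<^sub>m A \<in> centralizer" if "A \<in> centralizer" for A c by (rule centralizer_smult[OF that])
    show "A = 0\<^sub>m n n" if "A \<in> centralizer" "\<And>q. q \<in> indices \<Longrightarrow> A $$ q = 0" for A
      using centralizer_carrier[OF that(1)] that(2) by (intro eq_matI) (auto simp: indices_def)
  qed
  then show ?thesis by auto
qed

text \<open>
  The centralizer is determined by its entries at the positions in \<open>pivot\<close>, which are free, and the
  matrices supported at the other positions form a complement.
\<close>

definition pivot :: "(nat \<times> nat) set" where
  "pivot = (SOME P. \<exists>b. P \<subseteq> indices \<and>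
     (\<forall>p\<in>P. b p \<in> centralizer \<and> (\<forall>q\<in>P. b p $$ q = (if p = q then 1 else 0))) \<and>
     (\<forall>A\<in>centralizer. (\<forall>p\<in>P. A $$ p = 0) \<longrightarrow> A = 0\<^sub>m n n))"

definition basis :: "nat \<times> nat \<Rightarrow> complex mat" where
  "basis = (SOME b. pivot \<subseteq> indices \<and>
     (\<forall>p\<in>pivot. b p \<in> centralizer \<and> (\<forall>q\<in>pivot. b p $$ q = (if p = q then 1 else 0))) \<and>
     (\<forall>A\<in>centralizer. (\<forall>p\<in>pivot. A $$ p = 0) \<longrightarrow> A = 0\<^sub>m n n))"

lemma pivot_basis:
  shows pivot_indices: "pivot \<subseteq> indices"
    and basis_centralizer: "p \<in> pivot \<Longrightarrow> basis p \<in> centralizer"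
    and basis_entry: "p \<in> pivot \<Longrightarrow> q \<in> pivot \<Longrightarrow> basis p $$ q = (if p = q then 1 else 0)"
    and pivot_zero: "A \<in> centralizer \<Longrightarrow> (\<And>p. p \<in> pivot \<Longrightarrow> A $$ p = 0) \<Longrightarrow> A = 0\<^sub>m n n"
proof -
  note * = someI_ex[OF someI_ex[OF ex_pivots, folded pivot_def], folded basis_def]
  show "pivot \<subseteq> indices" using * by (elim conjE)
  show "p \<in> pivot \<Longrightarrow> basis p \<in> centralizer" using * by (elim conjE) simp
  show "p \<in> pivot \<Longrightarrow> q \<in> pivot \<Longrightarrow> basis p $$ q = (if p = q then 1 else 0)" using * by (elim conjE) simp
  show "A \<in> centralizer \<Longrightarrow> (\<And>p. p \<in> pivot \<Longrightarrow> A $$ p = 0) \<Longrightarrow> A = 0\<^sub>m n n" using * by (elim conjE) simp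
qed

lemma finite_pivot: "finite pivot"
  using pivot_indices by (rule finite_subset) (simp add: indices_def)

lemma lin_comb_pivot_entry:
  assumes "q \<in> pivot" shows "lin_comb n pivot basis x $$ q = x q"
proof -
  have q: "fst q < n" "snd q < n" using assms pivot_indices by (auto simp: indices_def)
  have "lin_comb n pivot basis x $$ q = (\<Sum>p\<in>pivot. x p * basis p $$ q)"
    using lin_comb_entry[OF q, of pivot basis x] by simp
  also have "\<dots> = (\<Sum>p\<in>pivot. if p = q then x p else 0)"
    using assms by (intro sum.cong) (auto simp: basis_entry)
  finally show ?thesis using assms finite_pivot by simp
qed

lemma centralizer_expand:
  assumes "A \<in> centralizer" shows "lin_comb n pivot basis (\<lambda>p. A $$ p) = A"
proof -
  let ?L = "lin_comb n pivot basis (\<lambda>p. A $$ p)"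
  have L: "?L \<in> centralizer" by (rule centralizer_lin_comb[OF basis_centralizer])
  note c = centralizer_carrier[OF assms]
  have "?L - A = 0\<^sub>m n n"
  proof (rule pivot_zero)
    have "J * ?L - J * A = ?L * J - A * J"
      using centralizer_commute[OF assms] centralizer_commute[OF L] by simp
    then show "?L - A \<in> centralizer"
      using c J minus_carrier_mat[OF c, of ?L] by (simp add: centralizer_def minus_mult_distrib_mat[OF lin_comb_carrier c J]
          mult_minus_distrib_mat[OF J lin_comb_carrier c])
    fix p assume p: "p \<in> pivot"
    then have "fst p < n" "snd p < n" using pivot_indices by (auto simp: indices_def)
    then have "(?L - A) $$ p = ?L $$ p - A $$ p" using c by (cases p) auto
    then show "(?L - A) $$ p = 0" using lin_comb_pivot_entry[OF p] by simp
  qed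
  then show ?thesis using c by (auto simp: mat_eq_iff lin_comb_def)
qed

text \<open>
  The redundancy is removed by requiring that \<open>g\<close> agrees with the identity at the pivots. A single
  matrix \<open>T\<close> of parameters suffices: its entries at the pivots are the coordinates of \<open>X - X0\<close> in the
  centralizer, the other entries are those of \<open>g - 1\<close>. The number of parameters is therefore \<open>n\<^sup>2\<close>,
  whatever the dimension of the centralizer is.
\<close>

definition slice_g :: "(nat \<times> nat \<Rightarrow> complex) \<Rightarrow> complex mat" where
  "slice_g T = 1\<^sub>m n + mat n n (\<lambda>q. if q \<in> pivot then 0 else T q)"

definition slice_X :: "(nat \<times> nat \<Rightarrow> complex) \<Rightarrow> complex mat" where
  "slice_X T = X0 + lin_comb n pivot basis T"

lemma slice_carrier [simp]: "slice_g T \<in> carrier_mat n n" "slice_X T \<in> carrier_mat n n"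
  using X0 by (simp_all add: slice_g_def slice_X_def)

lemma slice_X_fibre: "slice_X T \<in> fibre"
proof -
  have "slice_X T - X0 = lin_comb n pivot basis T"
    using X0 by (auto simp: slice_X_def lin_comb_def intro!: eq_matI)
  then show ?thesis
    unfolding fibre_iff using centralizer_lin_comb[OF basis_centralizer] by simp
qed

lemma slice_covers:
  assumes g: "g \<in> carrier_mat n n" "\<And>p. p \<in> pivot \<Longrightarrow> g $$ p = 1\<^sub>m n $$ p" and X: "X \<in> fibre"
  obtains T where "slice_g T = g" "slice_X T = X"
proof
  let ?T = "\<lambda>p. if p \<in> pivot then (X - X0) $$ p else g $$ p - 1\<^sub>m n $$ p"
  show "slice_g ?T = g"
    using g by (auto simp: slice_g_def intro!: eq_matI)
  have "lin_comb n pivot basis ?T = lin_comb n pivot basis (\<lambda>p. (X - X0) $$ p)"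
    by (rule lin_comb_cong) auto
  also have "\<dots> = X - X0" using X by (intro centralizer_expand) (simp add: fibre_iff)
  finally show "slice_X ?T = X"
    using fibre_carrier[OF X] X0 by (auto simp: slice_X_def intro!: eq_matI)
qed

text \<open>
  For a generic \<open>g\<close> some invertible \<open>h\<close> in the centralizer makes \<open>g * h\<close> agree with the identity at
  the pivots: this is a square linear system for \<open>h\<close>, and its solution at \<open>g = 1\<close> is unique, namely
  \<open>h = 1\<close>. Genericity is only needed along the line from \<open>1\<close> to a given \<open>g\<close>, where it holds for all
  but finitely many \<open>t\<close>; a polynomial that vanishes at these \<open>t\<close> also vanishes at \<open>t = 1\<close>.
\<close>

lemma slice_dense:
  assumes f: "f \<in> poly_funs n"
    and 0: "\<And>T. det (slice_g T) \<noteq> 0 \<Longrightarrow> f (conj_pt J (slice_g T) (slice_X T)) = 0"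
    and p: "p \<in> orbit_family"
  shows "f p = 0"
proof -
  obtain g X where g: "g \<in> carrier_mat n n" "det g \<noteq> 0" and X: "X \<in> fibre" and p: "p = conj_pt J g X"
    using p unfolding orbit_family_def by (elim conj_imageE) auto
  note Xc = fibre_carrier[OF X]
  \<comment> \<open>The line starts at the identity, where the system for \<open>h\<close> is the identity system.\<close>
  define G where "G = line (1\<^sub>m n) g"
  have RG: "up.R_mat n n G" unfolding G_def using g by (intro R_mat_line) auto
  have Gc: "G t \<in> carrier_mat n n" for t using g by (simp add: G_def)
  have G0: "G 0 = 1\<^sub>m n" and G1: "G 1 = g"
    unfolding G_def using line_0[OF one_carrier_mat g(1)] line_1[OF one_carrier_mat g(1)] by simp_all
  have bc: "basis q \<in> carrier_mat n n" if "q \<in> pivot" for q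
    by (rule centralizer_carrier[OF basis_centralizer[OF that]])
  have R_entry: "\<forall>p\<in>pivot. \<forall>q\<in>pivot. (\<lambda>t. (G t * basis q) $$ p) \<in> up.R"
  proof (intro ballI)
    fix p q assume that: "p \<in> pivot" "q \<in> pivot"
    have "fst p < n" "snd p < n" using that pivot_indices by (auto simp: indices_def)
    then show "(\<lambda>t. (G t * basis q) $$ p) \<in> up.R"
      using up.R_mat_entry[OF up.R_mat_mult[OF RG up.R_mat_const[OF bc[OF that(2)]]], of "fst p" "snd p"] by simp
  qed
  from up.cramer[of pivot "\<lambda>t p q. (G t * basis q) $$ p" "\<lambda>t p. 1\<^sub>m n $$ p",
      OF finite_pivot R_entry ballI[OF up.R_const]]
  obtain D N where D: "D \<in> up.R" and DN: "(\<forall>q\<in>pivot. N q \<in> up.R) \<and>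
    (\<forall>t. \<forall>p\<in>pivot. (\<Sum>q\<in>pivot. (G t * basis q) $$ p * N q t) = D t * 1\<^sub>m n $$ p) \<and>
    (\<forall>t u. (\<forall>p\<in>pivot. (\<Sum>q\<in>pivot. (G t * basis q) $$ p * u q) = 1\<^sub>m n $$ p) \<longrightarrow>
       (\<forall>q\<in>pivot. N q t = D t * u q)) \<and>
    (\<forall>t. (\<forall>u. (\<forall>p\<in>pivot. (\<Sum>q\<in>pivot. (G t * basis q) $$ p * u q) = 0) \<longrightarrow>
       (\<forall>q\<in>pivot. u q = 0)) \<longrightarrow> D t \<noteq> 0)"
    by (elim bexE exE)
  have N: "N q \<in> up.R" if "q \<in> pivot" for q using DN that by (elim conjE) (rule bspec)
  have sol: "(\<Sum>q\<in>pivot. (G t * basis q) $$ p * N q t) = D t * 1\<^sub>m n $$ p" if "p \<in> pivot" for t p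
    using DN that by (elim conjE) simp
  have uniq: "N q t = D t * u q"
    if "\<forall>p\<in>pivot. (\<Sum>q\<in>pivot. (G t * basis q) $$ p * u q) = 1\<^sub>m n $$ p" "q \<in> pivot" for t u q
  proof -
    from DN have "(\<forall>p\<in>pivot. (\<Sum>q\<in>pivot. (G t * basis q) $$ p * u q) = 1\<^sub>m n $$ p) \<longrightarrow>
       (\<forall>q\<in>pivot. N q t = D t * u q)" by (elim conjE allE)
    with that show ?thesis by simp
  qed
  have ker: "D t \<noteq> 0"
    if "\<forall>u. (\<forall>p\<in>pivot. (\<Sum>q\<in>pivot. (G t * basis q) $$ p * u q) = 0) \<longrightarrow> (\<forall>q\<in>pivot. u q = 0)" for t
  proof -
    from DN have "(\<forall>u. (\<forall>p\<in>pivot. (\<Sum>q\<in>pivot. (G t * basis q) $$ p * u q) = 0) \<longrightarrow>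
       (\<forall>q\<in>pivot. u q = 0)) \<longrightarrow> D t \<noteq> 0" by (elim conjE) (rule spec)
    with that show ?thesis by (rule mp[rotated])
  qed
  \<comment> \<open>\<open>H t\<close> is the solution \<open>h\<close> scaled by the determinant \<open>D t\<close> of the system.\<close>
  define H where "H t = lin_comb n pivot basis (\<lambda>q. N q t)" for t
  have Hc: "H t \<in> centralizer" for t
    unfolding H_def by (rule centralizer_lin_comb[OF basis_centralizer])
  have GH_eq: "G t * H t = lin_comb n pivot (\<lambda>q. G t * basis q) (\<lambda>q. N q t)" for t
    unfolding H_def by (rule mult_lin_comb[OF Gc bc])
  have GH: "(G t * H t) $$ p = D t * 1\<^sub>m n $$ p" if "p \<in> pivot" for t p
  proof -
    have ij: "fst p < n" "snd p < n" using that pivot_indices by (auto simp: indices_def)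
    have "(G t * H t) $$ p = (\<Sum>q\<in>pivot. N q t * (G t * basis q) $$ p)"
      unfolding GH_eq
      using lin_comb_entry[OF ij, of pivot "\<lambda>q. G t * basis q" "\<lambda>q. N q t"] by simp
    then show ?thesis using sol[OF that, of t] by (simp add: mult.commute)
  qed
  have RH: "up.R_mat n n H"
  proof (rule up.R_matI)
    show "H t \<in> carrier_mat n n" for t by (rule centralizer_carrier[OF Hc])
    show "(\<lambda>t. H t $$ (i, j)) \<in> up.R" if "i < n" "j < n" for i j
      unfolding H_def lin_comb_entry[OF that] by (intro up.R_sum up.R_mult N up.R_const)
  qed
  have at0: "(\<Sum>q\<in>pivot. (G 0 * basis q) $$ p * u q) = u p" if "p \<in> pivot" for u p
  proof -
    have "(\<Sum>q\<in>pivot. (G 0 * basis q) $$ p * u q) = (\<Sum>q\<in>pivot. if q = p then u q else 0)"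
    proof (intro sum.cong refl)
      fix q assume "q \<in> pivot"
      then show "(G 0 * basis q) $$ p * u q = (if q = p then u q else 0)"
        using left_mult_one_mat[OF bc[of q]] basis_entry[of q p] that by (simp add: G0)
    qed
    then show ?thesis using that finite_pivot by simp
  qed
  have D0: "D 0 \<noteq> 0" by (rule ker) (simp add: at0)
  have H0: "H 0 = D 0 \<cdot>\<^sub>m 1\<^sub>m n"
  proof -
    have N0: "N q 0 = (D 0 \<cdot>\<^sub>m 1\<^sub>m n) $$ q" if "q \<in> pivot" for q
    proof -
      have "N q 0 = D 0 * 1\<^sub>m n $$ q" by (rule uniq[OF _ that]) (simp add: at0)
      then show ?thesis using that pivot_indices by (auto simp: indices_def)
    qed
    have "H 0 = lin_comb n pivot basis (\<lambda>q. (D 0 \<cdot>\<^sub>m 1\<^sub>m n) $$ q)"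
      unfolding H_def by (rule lin_comb_cong) (simp_all only: N0)
    also have "\<dots> = D 0 \<cdot>\<^sub>m 1\<^sub>m n"
      by (rule centralizer_expand[OF centralizer_smult[OF one_centralizer]])
    finally show ?thesis .
  qed
  obtain d where d: "\<And>t. poly d t = det (G t)" by (rule R_det_poly[OF RG]) blast
  obtain h where h: "\<And>t. poly h t = det (H t)" by (rule R_det_poly[OF RH]) blast
  obtain D' where D': "D = poly D'" using D unfolding up_R by blast
  obtain F m where F: "\<And>t. det (G t) \<noteq> 0 \<Longrightarrow> poly F t = det (G t) ^ m * f (conj_pt J (G t) X)"
    using poly_along_curve[OF J RG up.R_mat_const[OF Xc] f] by blast
  \<comment> \<open>The factors \<open>d\<close>, \<open>h\<close> and \<open>D'\<close> absorb the finitely many parameters \<open>t\<close> where the line cannot be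
    moved into the slice.\<close>
  have "poly (F * (d * h * D')) t = 0" for t
  proof (cases "det (G t) = 0 \<or> det (H t) = 0 \<or> D t = 0")
    case True
    then show ?thesis using d h D' by auto
  next
    case False
    define k where "k = inverse (D t) \<cdot>\<^sub>m H t"
    have k: "k \<in> centralizer" unfolding k_def by (rule centralizer_smult[OF Hc])
    note kc = centralizer_carrier[OF k]
    have "det k \<noteq> 0" using False kc by (simp add: k_def det_smult)
    then obtain k' where k': "k' \<in> carrier_mat n n" "k * k' = 1\<^sub>m n" "k' * k = 1\<^sub>m n"
      using det_nonzero_inverse[OF kc] by blast
    have Gk: "G t * k = inverse (D t) \<cdot>\<^sub>m (G t * H t)"
      unfolding k_def by (rule mult_smult_distrib[OF Gc centralizer_carrier[OF Hc]])
    have "(G t * k) $$ p = 1\<^sub>m n $$ p" if "p \<in> pivot" for p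
    proof -
      have "fst p < n" "snd p < n" using that pivot_indices by (auto simp: indices_def)
      then have "(G t * k) $$ p = inverse (D t) * (G t * H t) $$ p"
        unfolding Gk using Gc[of t] centralizer_carrier[OF Hc[of t]] by (cases p) (simp del: index_mult_mat(1))
      then show ?thesis using GH[OF that, of t] False by simp
    qed
    from slice_covers[OF mult_carrier_mat[OF Gc kc] this fibre_conj[OF k k' X]]
    obtain T where T: "slice_g T = G t * k" "slice_X T = k' * X * k" by blast
    have "det (G t * k) \<noteq> 0" using False \<open>det k \<noteq> 0\<close> by (simp add: det_mult[OF Gc kc])
    then have "f (conj_pt J (G t * k) (k' * X * k)) = 0" using 0[of T] T by simp
    then have "f (conj_pt J (G t) X) = 0"
      using conj_pt_centralizer[OF Gc _ k k' Xc] False by simp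
    then show ?thesis using F[of t] False by simp
  qed
  then have "F * (d * h * D') = 0" using poly_all_0_iff_0 by blast
  moreover have "poly (d * h * D') 0 \<noteq> 0"
    using d[of 0] h[of 0] D' D0 by (simp add: G0 H0 det_smult)
  ultimately have "F = 0" by auto
  then show ?thesis using F[of 1] g(2) by (simp add: G1 p)
qed

end

section \<open>The dimension of the family\<close>

text \<open>
  The entry \<open>k\<close> of \<open>A * E - E * J\<close>, where \<open>E\<close> is the matrix unit at position \<open>q\<close>. Writing it with
  explicit entries keeps it polynomial in \<open>A\<close> for arbitrary arguments.
\<close>

definition comm_entry :: "complex mat \<Rightarrow> complex mat \<Rightarrow> nat \<times> nat \<Rightarrow> nat \<times> nat \<Rightarrow> complex" where
  "comm_entry J A q k = (if snd k = snd q then A $$ (fst k, fst q) else 0)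
     - (if fst k = fst q then J $$ (snd q, snd k) else 0)"

lemma comm_entry_expand:
  assumes "J \<in> carrier_mat n n" "A \<in> carrier_mat n n" "s \<in> carrier_mat n n" and k: "k \<in> {..<n} \<times> {..<n}"
  shows "(A * s - s * J) $$ k = (\<Sum>q\<in>{..<n} \<times> {..<n}. s $$ q * comm_entry J A q k)"
proof -
  obtain i j where k: "k = (i, j)" "i < n" "j < n" using k by auto
  have "(\<Sum>q\<in>{..<n} \<times> {..<n}. s $$ q * comm_entry J A q k) =
     (\<Sum>a<n. \<Sum>b<n. if b = j then s $$ (a, j) * A $$ (i, a) else 0) -
     (\<Sum>a<n. \<Sum>b<n. if a = i then s $$ (i, b) * J $$ (b, j) else 0)"
    unfolding sum_subtractf[symmetric] sum.cartesian_product
    by (rule sum.cong) (auto simp: comm_entry_def k algebra_simps)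
  also have "(\<Sum>a<n. \<Sum>b<n. if b = j then s $$ (a, j) * A $$ (i, a) else 0) = (\<Sum>a<n. A $$ (i, a) * s $$ (a, j))"
    using k by (simp add: mult.commute)
  also have "(\<Sum>a<n. \<Sum>b<n. if a = i then s $$ (i, b) * J $$ (b, j) else 0) = (\<Sum>b<n. s $$ (i, b) * J $$ (b, j))"
    using k by (subst sum.swap) simp
  also have "(\<Sum>a<n. A $$ (i, a) * s $$ (a, j)) - (\<Sum>b<n. s $$ (i, b) * J $$ (b, j)) = (A * s - s * J) $$ k"
    using assms k by (simp add: scalar_prod_def atLeast0LessThan)
  finally show ?thesis by simp
qed

context fibre_bundle begin

lemma finite_indices: "finite indices" and card_indices: "card indices = n\<^sup>2"
  by (simp_all add: indices_def power2_eq_square)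

lemma slice_g_entry: "i < n \<Longrightarrow> j < n \<Longrightarrow>
    slice_g T $$ (i, j) = 1\<^sub>m n $$ (i, j) + (if (i, j) \<in> pivot then 0 else T (i, j))"
  by (simp add: slice_g_def)

lemma slice_X_entry: "i < n \<Longrightarrow> j < n \<Longrightarrow>
    slice_X T $$ (i, j) = X0 $$ (i, j) + (\<Sum>p\<in>pivot. T p * basis p $$ (i, j))"
  using X0 by (simp add: slice_X_def lin_comb_def)

lemma slice_dims [simp]: "dim_row (slice_g T) = n" "dim_col (slice_g T) = n"
    "dim_row (slice_X T) = n" "dim_col (slice_X T) = n"
  using slice_carrier carrier_matD by blast+

lemma R_slice: "box.R_mat indices n n slice_g" "box.R_mat indices n n slice_X"
proof -
  show "box.R_mat indices n n slice_g"
  proof (rule box.R_matI)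
    fix i j assume ij: "i < n" "j < n"
    show "(\<lambda>T. slice_g T $$ (i, j)) \<in> box.R indices"
    proof (cases "(i, j) \<in> pivot")
      case True
      then show ?thesis unfolding slice_g_entry[OF ij] by (simp add: box.R_const)
    next
      case False
      have "(\<lambda>T. T (i, j)) \<in> box.R indices"
        by (rule coordinate_box[OF finite_indices]) (use ij in \<open>simp add: indices_def\<close>)
      from box.R_add[OF box.R_const this] show ?thesis
        unfolding slice_g_entry[OF ij] using False by simp
    qed
  qed simp
  show "box.R_mat indices n n slice_X"
  proof (rule box.R_matI)
    fix i j assume ij: "i < n" "j < n"
    have "(\<lambda>T. T p) \<in> box.R indices" if "p \<in> pivot" for p
      by (rule coordinate_box[OF finite_indices]) (use that pivot_indices in blast)
    then show "(\<lambda>T. slice_X T $$ (i, j)) \<in> box.R indices"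
      unfolding slice_X_entry[OF ij] by (intro box.R_add box.R_const box.R_sum box.R_mult)
  qed simp
qed

theorem orbit_family_chain_le:
  assumes "\<forall>i\<le>k. closedin (zariski n) (C i) \<and> irreducible_subset (zariski n) (C i)"
    "\<forall>i<k. C i \<subset> C (Suc i)" "C k \<subseteq> zariski n closure_of orbit_family"
  shows "k \<le> n\<^sup>2"
proof -
  have "f p = 0" if f: "f \<in> poly_funs n"
    and 0: "\<And>T. det (slice_g T) \<noteq> 0 \<Longrightarrow> f (conj_pt J (slice_g T) (slice_X T)) = 0"
    and p: "p \<in> zariski n closure_of orbit_family" for f p
    by (rule zero_on_closure[OF f slice_dense[OF f 0] p])
  then have "k \<le> card indices"
    by (rule chain_length_le_parameters[OF finite_indices J R_slice _ assms])
  then show ?thesis by (simp add: card_indices)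
qed

text \<open>
  A flag of coordinate subspaces in the space of parameters gives an increasing sequence of
  irreducible closed sets. The two cases of strictness follow below: pivot positions are added first
  and are read off from \<open>X\<close>, the others are read off from \<open>Y\<close>.
\<close>

definition flag_params :: "(nat \<times> nat) set \<Rightarrow> (complex mat \<times> complex mat) set" where
  "flag_params S = (\<lambda>T. (slice_g T, slice_X T)) ` {T. \<forall>q\<in>indices - S. T q = 0}"

definition flag_piece :: "(nat \<times> nat) set \<Rightarrow> (complex mat \<times> complex mat) set" where
  "flag_piece S = zariski n closure_of conj_image J (flag_params S)"

lemma slice_line:
  "line (slice_g T) (slice_g T') t = slice_g (\<lambda>q. (1 - t) * T q + t * T' q)"
  "line (slice_X T) (slice_X T') t = slice_X (\<lambda>q. (1 - t) * T q + t * T' q)"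
proof -
  show "line (slice_g T) (slice_g T') t = slice_g (\<lambda>q. (1 - t) * T q + t * T' q)"
  proof (rule eq_matI)
    fix i j assume "i < dim_row (slice_g (\<lambda>q. (1 - t) * T q + t * T' q))"
      "j < dim_col (slice_g (\<lambda>q. (1 - t) * T q + t * T' q))"
    then have ij: "i < n" "j < n" by (simp_all add: slice_g_def)
    show "line (slice_g T) (slice_g T') t $$ (i, j) = slice_g (\<lambda>q. (1 - t) * T q + t * T' q) $$ (i, j)"
      unfolding line_entry[OF slice_carrier(1) slice_carrier(1) ij] slice_g_entry[OF ij]
      by (simp add: algebra_simps)
  qed (simp_all add: line_def slice_g_def)
  show "line (slice_X T) (slice_X T') t = slice_X (\<lambda>q. (1 - t) * T q + t * T' q)"
  proof (rule eq_matI)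
    fix i j assume "i < dim_row (slice_X (\<lambda>q. (1 - t) * T q + t * T' q))"
      "j < dim_col (slice_X (\<lambda>q. (1 - t) * T q + t * T' q))"
    then have ij: "i < n" "j < n" by simp_all
    have "(\<Sum>p\<in>pivot. ((1 - t) * T p + t * T' p) * basis p $$ (i, j)) =
        (1 - t) * (\<Sum>p\<in>pivot. T p * basis p $$ (i, j)) + t * (\<Sum>p\<in>pivot. T' p * basis p $$ (i, j))"
      by (simp add: distrib_right sum.distrib sum_distrib_left mult.assoc)
    then show "line (slice_X T) (slice_X T') t $$ (i, j) = slice_X (\<lambda>q. (1 - t) * T q + t * T' q) $$ (i, j)"
      unfolding line_entry[OF slice_carrier(2) slice_carrier(2) ij] slice_X_entry[OF ij]
      by (simp add: algebra_simps)
  qed (simp_all add: line_def)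
qed

lemma slice_zero: "(\<And>q. q \<in> indices \<Longrightarrow> q \<notin> pivot \<Longrightarrow> T q = 0) \<Longrightarrow> slice_g T = 1\<^sub>m n"
  by (rule eq_matI) (auto simp: slice_g_def indices_def)

lemma flag_params_mat_pairs: "flag_params S \<subseteq> mat_pairs n"
  by (auto simp: flag_params_def mat_pairs_def)

lemma flag_piece_irreducible: "irreducible_subset (zariski n) (flag_piece S)"
  unfolding flag_piece_def
proof (intro irreducible_closure_of irreducible_conj_image[OF J flag_params_mat_pairs])
  show "line_closed (flag_params S)"
    unfolding line_closed_def flag_params_def by (auto simp: slice_line)
  have "(slice_g (\<lambda>_. 0), slice_X (\<lambda>_. 0)) \<in> flag_params S" by (simp add: flag_params_def)
  moreover have "det (slice_g (\<lambda>_. 0)) \<noteq> 0" by (simp add: slice_zero)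
  ultimately show "conj_image J (flag_params S) \<noteq> {}" using conj_imageI by fastforce
qed

lemma flag_piece_closed: "closedin (zariski n) (flag_piece S)"
  by (simp add: flag_piece_def)

lemma flag_piece_subset: "flag_piece S \<subseteq> zariski n closure_of orbit_family"
  unfolding flag_piece_def
proof (rule closure_of_mono)
  show "conj_image J (flag_params S) \<subseteq> orbit_family"
  proof
    fix p assume "p \<in> conj_image J (flag_params S)"
    then obtain T where "det (slice_g T) \<noteq> 0" "p = conj_pt J (slice_g T) (slice_X T)"
      by (elim conj_imageE) (auto simp: flag_params_def)
    then show "p \<in> orbit_family"
      unfolding orbit_family_def using slice_X_fibre by (auto intro!: conj_imageI)
  qed
qed

lemma flag_piece_mono: "S \<subseteq> S' \<Longrightarrow> flag_piece S \<subseteq> flag_piece S'"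
  unfolding flag_piece_def
proof (intro closure_of_mono subsetI)
  assume "S \<subseteq> S'"
  then have "flag_params S \<subseteq> flag_params S'" unfolding flag_params_def by (intro image_mono) auto
  then show "p \<in> conj_image J (flag_params S')" if "p \<in> conj_image J (flag_params S)" for p
    using that by (elim conj_imageE) (auto intro: conj_imageI)
qed

lemma in_flag_piece:
  assumes "\<And>q. q \<in> indices - S \<Longrightarrow> T q = 0" "det (slice_g T) \<noteq> 0"
  shows "conj_pt J (slice_g T) (slice_X T) \<in> flag_piece S"
proof -
  have "conj_pt J (slice_g T) (slice_X T) \<in> conj_image J (flag_params S)"
    by (rule conj_imageI) (use assms in \<open>auto simp: flag_params_def\<close>)
  moreover have "conj_image J (flag_params S) \<subseteq> flag_piece S"
    unfolding flag_piece_def using conj_image_mat_pairs[OF J flag_params_mat_pairs]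
    by (intro closure_of_subset) simp
  ultimately show ?thesis by blast
qed

lemma zero_on_flag_piece:
  assumes f: "f \<in> poly_funs n"
    and 0: "\<And>T. (\<And>q. q \<in> indices - S \<Longrightarrow> T q = 0) \<Longrightarrow> det (slice_g T) \<noteq> 0 \<Longrightarrow>
       f (conj_pt J (slice_g T) (slice_X T)) = 0"
    and p: "p \<in> flag_piece S"
  shows "f p = 0"
proof (rule zero_on_closure[OF f _ p[unfolded flag_piece_def]])
  fix p assume "p \<in> conj_image J (flag_params S)"
  then obtain T where "\<forall>q\<in>indices - S. T q = 0" "det (slice_g T) \<noteq> 0"
    "p = conj_pt J (slice_g T) (slice_X T)"
    by (elim conj_imageE) (auto simp: flag_params_def)
  then show "f p = 0" using 0[of T] by simp
qed

text \<open>
  For \<open>Y = g * J * g\<^sup>-\<^sup>1\<close> with \<open>g = 1 + s\<close>, the identity \<open>Y * g = g * J\<close> becomes the linear system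
  \<open>Y * s - s * J = J - Y\<close> for the parameters in \<open>s\<close>.
\<close>

lemma slice_comm:
  assumes "det (slice_g T) \<noteq> 0" and k: "k \<in> indices"
  defines "Y \<equiv> snd (conj_pt J (slice_g T) (slice_X T))"
  shows "(\<Sum>q\<in>indices - pivot. T q * comm_entry J Y q k) = J $$ k - Y $$ k"
proof -
  obtain X where X: "conj_pt J (slice_g T) (slice_X T) = (X, Y)" unfolding Y_def by (metis prod.collapse)
  have "(X, Y) \<in> mat_pairs n"
    unfolding X[symmetric] by (rule conj_pt_mat_pairs[OF J slice_carrier])
  then have c: "X \<in> carrier_mat n n" "Y \<in> carrier_mat n n" by (simp_all add: mat_pairs_def)
  have eq: "Y * slice_g T = slice_g T * J"
    using X conj_pt_eq_iff[OF J slice_carrier assms(1) c] by simp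
  define s where "s = mat n n (\<lambda>q. if q \<in> pivot then 0 else T q)"
  have s: "s \<in> carrier_mat n n" and g: "slice_g T = 1\<^sub>m n + s" by (simp_all add: s_def slice_g_def)
  have "Y + Y * s = J + s * J"
    using eq unfolding g mult_add_distrib_mat[OF c(2) one_carrier_mat s]
      add_mult_distrib_mat[OF one_carrier_mat s J] right_mult_one_mat[OF c(2)] left_mult_one_mat[OF J] .
  moreover obtain i j where ij: "k = (i, j)" "i < n" "j < n" using k by (auto simp: indices_def)
  ultimately have "(Y + Y * s) $$ (i, j) = (J + s * J) $$ (i, j)" by simp
  then have "(Y * s) $$ (i, j) - (s * J) $$ (i, j) = J $$ (i, j) - Y $$ (i, j)"
    using ij c J s by (simp add: algebra_simps del: index_mult_mat(1))
  then have "(Y * s - s * J) $$ k = J $$ k - Y $$ k"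
    using ij c J s by (simp del: index_mult_mat(1))
  moreover have "(Y * s - s * J) $$ k = (\<Sum>q\<in>indices. s $$ q * comm_entry J Y q k)"
    using comm_entry_expand[OF J c(2) s] k by (simp add: indices_def)
  moreover have "\<dots> = (\<Sum>q\<in>indices - pivot. T q * comm_entry J Y q k)"
  proof -
    have "s $$ q = (if q \<in> pivot then 0 else T q)" if "q \<in> indices" for q
      using that by (auto simp: s_def indices_def)
    then show ?thesis
      using finite_indices by (intro sum.mono_neutral_cong_right) auto
  qed
  ultimately show ?thesis by simp
qed

text \<open>
  At \<open>Y = J\<close> the homogeneous system says that \<open>s\<close> centralizes \<open>J\<close>, and \<open>s\<close> vanishes at the pivots.
\<close>

lemma comm_kernel:
  assumes "\<And>k. k \<in> indices \<Longrightarrow> (\<Sum>q\<in>indices - pivot. u q * comm_entry J J q k) = 0"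
    and q: "q \<in> indices - pivot"
  shows "u q = 0"
proof -
  define s where "s = mat n n (\<lambda>q. if q \<in> pivot then 0 else u q)"
  have s: "s \<in> carrier_mat n n" by (simp add: s_def)
  have s_entry: "s $$ q = (if q \<in> pivot then 0 else u q)" if "q \<in> indices" for q
    using that by (auto simp: s_def indices_def)
  have "(J * s - s * J) $$ k = 0" if k: "k \<in> indices" for k
  proof -
    have "(J * s - s * J) $$ k = (\<Sum>q\<in>indices. s $$ q * comm_entry J J q k)"
      using comm_entry_expand[OF J J s] k by (simp add: indices_def)
    also have "\<dots> = (\<Sum>q\<in>indices - pivot. u q * comm_entry J J q k)"
      using finite_indices s_entry by (intro sum.mono_neutral_cong_right) auto
    finally show ?thesis using assms(1)[OF k] by simp
  qed
  then have "(J * s) $$ (i, j) = (s * J) $$ (i, j)" if "i < n" "j < n" for i j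
  proof -
    have "(J * s - s * J) $$ (i, j) = (J * s) $$ (i, j) - (s * J) $$ (i, j)"
      using that J s by (intro index_minus_mat(1)) simp_all
    then show ?thesis using \<open>\<And>k. k \<in> indices \<Longrightarrow> (J * s - s * J) $$ k = 0\<close>[of "(i, j)"] that
      by (simp add: indices_def del: index_mult_mat(1))
  qed
  then have "s * J = J * s" using J s by (intro eq_matI) auto
  then have "s \<in> centralizer" using s by (simp add: centralizer_def)
  then have "s = 0\<^sub>m n n" by (rule pivot_zero) (use s_entry pivot_indices in auto)
  then show ?thesis using s_entry[of q] q by (auto simp: indices_def)
qed

text \<open>
  Near the base point the slice parameters in \<open>g\<close> are rational functions \<open>N q / D\<close> of the pair. The
  linear system that determines them has more equations than unknowns. It is made square by taking
  inner products of all equations with the coefficient vectors at \<open>Y = J\<close>; these vectors are constant,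
  so their complex conjugates do not affect polynomiality in \<open>Y\<close>, and at \<open>Y = J\<close> the square system
  is given by a Gram matrix, which is invertible because the vectors are independent.
\<close>

lemma local_coordinates:
  obtains D N where "D \<in> poly_funs n" "\<And>q. q \<in> indices - pivot \<Longrightarrow> N q \<in> poly_funs n"
    "\<And>T q. det (slice_g T) \<noteq> 0 \<Longrightarrow> q \<in> indices - pivot \<Longrightarrow>
      N q (conj_pt J (slice_g T) (slice_X T)) = D (conj_pt J (slice_g T) (slice_X T)) * T q"
    "D (X0, J) \<noteq> 0"
proof -
  let ?S = "indices - pivot"
  define a where "a p q q' = (\<Sum>k\<in>indices. cnj (comm_entry J J q k) * comm_entry J (snd p) q' k)"
    for p :: "complex mat \<times> complex mat" and q q'
  define \<beta> where "\<beta> p q = (\<Sum>k\<in>indices. cnj (comm_entry J J q k) * (J $$ k - snd p $$ k))"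
    for p :: "complex mat \<times> complex mat" and q
  have snd_R: "(\<lambda>p. snd p $$ k) \<in> pf.R n" if "k \<in> indices" for k
    unfolding R_poly_funs using that by (cases k) (auto simp: indices_def intro: poly_funs.entry_snd)
  have "(\<lambda>p. comm_entry J (snd p) q k) \<in> pf.R n" if "q \<in> indices" "k \<in> indices" for q k
  proof -
    have "(\<lambda>p. if snd k = snd q then snd p $$ (fst k, fst q) else 0) \<in> pf.R n"
      using snd_R[of "(fst k, fst q)"] that
      by (cases "snd k = snd q") (simp_all add: indices_def mem_Times_iff pf.R_const)
    then show ?thesis unfolding comm_entry_def by (intro pf.R_diff pf.R_const)
  qed
  then have a: "\<forall>q\<in>?S. \<forall>q'\<in>?S. (\<lambda>p. a p q q') \<in> pf.R n"
    unfolding a_def by (intro ballI pf.R_sum pf.R_mult pf.R_const) auto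
  have \<beta>: "\<forall>q\<in>?S. (\<lambda>p. \<beta> p q) \<in> pf.R n"
    unfolding \<beta>_def by (intro ballI pf.R_sum pf.R_mult pf.R_diff pf.R_const snd_R)
  have "finite ?S" using finite_indices by simp
  from pf.cramer[OF this a \<beta>] obtain D N where D: "D \<in> pf.R n" and DN: "(\<forall>q\<in>?S. N q \<in> pf.R n) \<and>
    (\<forall>x. \<forall>p\<in>?S. (\<Sum>q\<in>?S. a x p q * N q x) = D x * \<beta> x p) \<and>
    (\<forall>x u. (\<forall>p\<in>?S. (\<Sum>q\<in>?S. a x p q * u q) = \<beta> x p) \<longrightarrow> (\<forall>q\<in>?S. N q x = D x * u q)) \<and>
    (\<forall>x. (\<forall>u. (\<forall>p\<in>?S. (\<Sum>q\<in>?S. a x p q * u q) = 0) \<longrightarrow> (\<forall>q\<in>?S. u q = 0)) \<longrightarrow> D x \<noteq> 0)"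
    by (elim bexE exE)
  have swap: "(\<Sum>q'\<in>?S. a p q q' * u q') =
      (\<Sum>k\<in>indices. cnj (comm_entry J J q k) * (\<Sum>q'\<in>?S. u q' * comm_entry J (snd p) q' k))" for p q u
    unfolding a_def by (simp add: sum_distrib_left sum_distrib_right mult.assoc mult.left_commute mult.commute)
      (rule sum.swap)
  show ?thesis
  proof (rule that[of D N])
    show "D \<in> poly_funs n" using D by (simp add: R_poly_funs)
    show "N q \<in> poly_funs n" if "q \<in> ?S" for q
      using DN that unfolding R_poly_funs by (elim conjE) (rule bspec)
    fix T q assume T: "det (slice_g T) \<noteq> 0" and q: "q \<in> ?S"
    let ?p = "conj_pt J (slice_g T) (slice_X T)"
    have "\<forall>q\<in>?S. (\<Sum>q'\<in>?S. a ?p q q' * T q') = \<beta> ?p q"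
      unfolding swap \<beta>_def using slice_comm[OF T] by simp
    moreover from DN have "(\<forall>p\<in>?S. (\<Sum>q\<in>?S. a ?p p q * T q) = \<beta> ?p p) \<longrightarrow> (\<forall>q\<in>?S. N q ?p = D ?p * T q)"
      by (elim conjE allE)
    ultimately show "N q ?p = D ?p * T q" using q by simp
  next
    \<comment> \<open>A vector \<open>u\<close> in the kernel of the Gram matrix makes the sum of the \<open>\<bar>w k\<bar>\<^sup>2\<close> vanish.\<close>
    have "u q = 0" if u: "\<forall>p\<in>?S. (\<Sum>q\<in>?S. a (X0, J) p q * u q) = 0" and q: "q \<in> ?S" for u q
    proof -
      define w where "w k = (\<Sum>q'\<in>?S. u q' * comm_entry J J q' k)" for k
      have "0 = (\<Sum>q\<in>?S. cnj (u q) * (\<Sum>k\<in>indices. cnj (comm_entry J J q k) * w k))"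
        using u unfolding swap w_def by simp
      also have "\<dots> = (\<Sum>q\<in>?S. \<Sum>k\<in>indices. cnj (u q * comm_entry J J q k) * w k)"
        by (simp add: sum_distrib_left mult.assoc)
      also have "\<dots> = (\<Sum>k\<in>indices. (\<Sum>q\<in>?S. cnj (u q * comm_entry J J q k)) * w k)"
        unfolding sum_distrib_right by (rule sum.swap)
      also have "\<dots> = (\<Sum>k\<in>indices. cnj (w k) * w k)"
        by (simp add: w_def)
      also have "\<dots> = of_real (\<Sum>k\<in>indices. (cmod (w k))\<^sup>2)"
        by (simp add: mult.commute complex_norm_square[symmetric])
      finally have "(\<Sum>k\<in>indices. (cmod (w k))\<^sup>2) = 0" by (metis of_real_eq_0_iff)
      then have "w k = 0" if "k \<in> indices" for k
        using that finite_indices by (simp add: sum_nonneg_eq_0_iff)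
      then show ?thesis unfolding w_def using comm_kernel[OF _ q] by blast
    qed
    moreover from DN have "(\<forall>u. (\<forall>p\<in>?S. (\<Sum>q\<in>?S. a (X0, J) p q * u q) = 0) \<longrightarrow> (\<forall>q\<in>?S. u q = 0)) \<longrightarrow> D (X0, J) \<noteq> 0"
      by (elim conjE) (rule spec)
    ultimately show "D (X0, J) \<noteq> 0" by blast
  qed
qed

text \<open>
  As long as only pivot positions are added, \<open>g = 1\<close> and the pair is \<open>(X, J)\<close> with \<open>X\<close> in an affine
  space, where the entry of \<open>X - X0\<close> at a pivot is a coordinate.
\<close>

lemma flag_piece_strict_pivot:
  assumes "S \<subseteq> pivot" "x \<in> pivot" "x \<notin> S"
  shows "flag_piece S \<noteq> flag_piece (insert x S)"
proof -
  obtain i j where x: "x = (i, j)" "i < n" "j < n" using assms pivot_indices by (auto simp: indices_def)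
  let ?f = "\<lambda>p :: complex mat \<times> complex mat. fst p $$ x - X0 $$ x"
  have f: "?f \<in> poly_funs n"
    using poly_funs.add[OF poly_funs.entry_fst[OF x(2,3)] poly_funs.const[of "- X0 $$ x"]] x(1) by simp
  have pt: "?f (conj_pt J (slice_g T) (slice_X T)) = T x" and dt: "slice_g T = 1\<^sub>m n"
    if "\<And>q. q \<in> indices - insert x S \<Longrightarrow> T q = 0" for T
  proof -
    show g: "slice_g T = 1\<^sub>m n" using that assms by (intro slice_zero) auto
    have "slice_X T $$ x = X0 $$ x + lin_comb n pivot basis T $$ x"
      unfolding x(1) slice_X_def using X0 x by (simp add: lin_comb_def)
    then show "?f (conj_pt J (slice_g T) (slice_X T)) = T x"
      unfolding g using conj_pt_one[OF slice_carrier(2)] lin_comb_pivot_entry[OF assms(2)] by simp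
  qed
  let ?T = "\<lambda>q. if q = x then 1 else 0 :: complex"
  have "conj_pt J (slice_g ?T) (slice_X ?T) \<in> flag_piece (insert x S)"
    by (rule in_flag_piece) (use dt[of ?T] in auto)
  moreover have "?f (conj_pt J (slice_g ?T) (slice_X ?T)) = 1" using pt[of ?T] by auto
  moreover have "?f p = 0" if "p \<in> flag_piece S" for p
  proof (rule zero_on_flag_piece[OF f _ that])
    fix T :: "nat \<times> nat \<Rightarrow> complex" assume T: "\<And>q. q \<in> indices - S \<Longrightarrow> T q = 0"
    have "x \<in> indices - S" using assms pivot_indices by blast
    then show "?f (conj_pt J (slice_g T) (slice_X T)) = 0"
      using pt[of T] T by simp
  qed
  ultimately show ?thesis by (metis zero_neq_one)
qed

text \<open>
  The numerator of the rational function that recovers the parameter at \<open>x\<close> vanishes on the smaller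
  set, but not at a point of the larger one where only this parameter is nonzero, with a generic value.
\<close>

lemma flag_piece_strict_slice:
  assumes x: "x \<in> indices - pivot" "x \<notin> S"
  shows "flag_piece S \<noteq> flag_piece (insert x S)"
proof -
  obtain D N where D: "D \<in> poly_funs n" and N: "\<And>q. q \<in> indices - pivot \<Longrightarrow> N q \<in> poly_funs n"
    and DN: "\<And>T q. det (slice_g T) \<noteq> 0 \<Longrightarrow> q \<in> indices - pivot \<Longrightarrow>
      N q (conj_pt J (slice_g T) (slice_X T)) = D (conj_pt J (slice_g T) (slice_X T)) * T q"
    and D0: "D (X0, J) \<noteq> 0"
    using local_coordinates by metis
  \<comment> \<open>A point on this curve separates the two sets as soon as \<open>t\<close> avoids \<open>0\<close> and finitely many further
    values.\<close>
  define T where "T t q = (if q = x then t else 0)" for t :: complex and q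
  have g0: "slice_g (T 0) = 1\<^sub>m n" by (rule slice_zero) (simp add: T_def)
  have X: "slice_X (T t) = X0" for t
  proof (rule eq_matI)
    fix i j assume "i < dim_row X0" "j < dim_col X0"
    then have ij: "i < n" "j < n" using X0 by auto
    show "slice_X (T t) $$ (i, j) = X0 $$ (i, j)"
      unfolding slice_X_entry[OF ij] using x by (auto simp: T_def intro!: sum.neutral)
  qed (use X0 in auto)
  have R: "up.R_mat n n (\<lambda>t. slice_g (T t))"
  proof (rule up.R_matI)
    fix i j assume ij: "i < n" "j < n"
    have "(\<lambda>t. T t (i, j)) \<in> up.R"
    proof (cases "(i, j) = x")
      case True
      have "(\<lambda>t. t) = poly [:0, 1::complex:]" by auto
      then show ?thesis using True by (simp add: T_def up_R)
    qed (simp add: T_def up.R_const)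
    then show "(\<lambda>t. slice_g (T t) $$ (i, j)) \<in> up.R"
      unfolding slice_g_entry[OF ij] by (cases "(i, j) \<in> pivot") (auto intro: up.R_add up.R_const)
  qed simp
  obtain F m where F: "\<And>t. det (slice_g (T t)) \<noteq> 0 \<Longrightarrow>
      poly F t = det (slice_g (T t)) ^ m * D (conj_pt J (slice_g (T t)) X0)"
    using poly_along_curve[OF J R up.R_mat_const[OF X0] D] by blast
  obtain d where d: "\<And>t. poly d t = det (slice_g (T t))" by (rule R_det_poly[OF R]) blast
  have "poly F 0 \<noteq> 0" using F[of 0] D0 by (simp add: g0 conj_pt_one[OF X0])
  moreover have "poly d 0 \<noteq> 0" using d[of 0] by (simp add: g0)
  ultimately have "F * d * [:0, 1:] \<noteq> 0" by auto
  then obtain t where "poly (F * d * [:0, 1:]) t \<noteq> 0" using poly_all_0_iff_0 by blast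
  then have t: "poly F t \<noteq> 0" "det (slice_g (T t)) \<noteq> 0" "t \<noteq> 0" using d by auto
  let ?p = "conj_pt J (slice_g (T t)) (slice_X (T t))"
  have "D ?p \<noteq> 0" using F[OF t(2)] t(1) X by auto
  then have "N x ?p \<noteq> 0" using DN[OF t(2) x(1)] t(3) by (simp add: T_def)
  moreover have "?p \<in> flag_piece (insert x S)"
    by (rule in_flag_piece[OF _ t(2)]) (simp add: T_def)
  moreover have "N x p = 0" if "p \<in> flag_piece S" for p
  proof (rule zero_on_flag_piece[OF N[OF x(1)] _ that])
    fix T assume "\<And>q. q \<in> indices - S \<Longrightarrow> T q = 0" "det (slice_g T) \<noteq> 0"
    then show "N x (conj_pt J (slice_g T) (slice_X T)) = 0" using DN[of T x] x by simp
  qed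
  ultimately show ?thesis by metis
qed

theorem orbit_family_chain:
  "\<exists>C. (\<forall>i. closedin (zariski n) (C i) \<and> irreducible_subset (zariski n) (C i) \<and>
      C i \<subseteq> zariski n closure_of orbit_family) \<and> (\<forall>i<n\<^sup>2. C i \<subset> C (Suc i))"
proof -
  obtain ps where ps: "set ps = pivot" "distinct ps" using finite_distinct_list[OF finite_pivot] by blast
  obtain qs where qs: "set qs = indices - pivot" "distinct qs"
    using finite_distinct_list[of "indices - pivot"] finite_indices by auto
  define xs where "xs = ps @ qs"
  have xs: "distinct xs" "set xs = indices" using ps qs pivot_indices by (auto simp: xs_def)
  then have len: "length xs = n\<^sup>2" using distinct_card[of xs] by (simp add: card_indices)
  define C where "C i = flag_piece (set (take i xs))" for i
  have "C i \<subset> C (Suc i)" if "i < n\<^sup>2" for i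
  proof -
    have i: "i < length xs" using that len by simp
    have S: "set (take (Suc i) xs) = insert (xs ! i) (set (take i xs))"
      by (simp add: take_Suc_conv_app_nth[OF i])
    have new: "xs ! i \<notin> set (take i xs)"
      using xs(1) i by (auto simp: in_set_conv_nth nth_eq_iff_index_eq)
    have "flag_piece (set (take i xs)) \<noteq> flag_piece (insert (xs ! i) (set (take i xs)))"
    proof (cases "i < length ps")
      case True
      then have "xs ! i \<in> pivot" using ps(1) nth_mem[of i ps] by (simp add: xs_def nth_append)
      moreover have "set (take i xs) \<subseteq> pivot"
        using True set_take_subset[of i ps] ps(1) by (simp add: xs_def)
      ultimately show ?thesis using new by (intro flag_piece_strict_pivot)
    next
      case False
      then have "xs ! i = qs ! (i - length ps)" "i - length ps < length qs"
        using i by (auto simp: xs_def nth_append)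
      then have "xs ! i \<in> indices - pivot" using qs(1) nth_mem by metis
      then show ?thesis using new by (intro flag_piece_strict_slice)
    qed
    moreover have "C i \<subseteq> C (Suc i)" unfolding C_def S by (intro flag_piece_mono) auto
    ultimately show ?thesis unfolding C_def S by blast
  qed
  moreover have "closedin (zariski n) (C i)" "irreducible_subset (zariski n) (C i)"
    "C i \<subseteq> zariski n closure_of orbit_family" for i
    unfolding C_def by (rule flag_piece_closed flag_piece_irreducible flag_piece_subset)+
  ultimately show ?thesis by (intro exI[of _ C] conjI allI impI)
qed

end

section \<open>Semicontinuity of the rank\<close>

lemma mat_prod_entry:
  assumes "A \<in> carrier_mat a k" "B \<in> carrier_mat k b" "i < a" "j < b"
  shows "(A * B) $$ (i, j) = (\<Sum>l<k. A $$ (i, l) * B $$ (l, j))"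
  using assms by (simp add: scalar_prod_def atLeast0LessThan)

text \<open>
  A factorisation that shows that the rank of \<open>M\<close> is \<open>r\<close>: the factors through dimension \<open>r\<close> bound it
  from above, their one-sided inverses bound it from below. In this form the rank enters
  determinants directly.
\<close>

definition split_rank :: "nat \<Rightarrow> complex mat \<Rightarrow> nat \<Rightarrow> bool" where
  "split_rank n M r \<longleftrightarrow> (\<exists>E F A B. E \<in> carrier_mat n r \<and> F \<in> carrier_mat r n \<and> M = E * F \<and>
     A \<in> carrier_mat r n \<and> B \<in> carrier_mat n r \<and> A * E = 1\<^sub>m r \<and> F * B = 1\<^sub>m r)"

lemma split_rankI:
  "E \<in> carrier_mat n r \<Longrightarrow> F \<in> carrier_mat r n \<Longrightarrow> M = E * F \<Longrightarrow>
     A \<in> carrier_mat r n \<Longrightarrow> B \<in> carrier_mat n r \<Longrightarrow> A * E = 1\<^sub>m r \<Longrightarrow> F * B = 1\<^sub>m r \<Longrightarrow> split_rank n M r"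
  unfolding split_rank_def by (intro exI conjI)

lemma split_rankE:
  assumes "split_rank n M r"
  obtains E F A B where "E \<in> carrier_mat n r" "F \<in> carrier_mat r n" "M = E * F"
    "A \<in> carrier_mat r n" "B \<in> carrier_mat n r" "A * E = 1\<^sub>m r" "F * B = 1\<^sub>m r"
  using assms unfolding split_rank_def by (elim exE conjE)

lemma det_thin_product:
  assumes E: "E \<in> carrier_mat m r" and F: "F \<in> carrier_mat r m" and "r < m"
  shows "det (E * F :: complex mat) = 0"
proof -
  have "\<exists>y. y \<in> carrier_vec m \<and> y \<noteq> 0\<^sub>v m \<and> F *\<^sub>v y = 0\<^sub>v r"
  proof -
    let ?F = "mat m m (\<lambda>(i, j). if i < r then F $$ (i, j) else 0)"
    have Fc: "?F \<in> carrier_mat m m" by simp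
    have "det ?F = 0"
    proof -
      have "det ?F = (\<Sum>p | p permutes {0..<m}. signof p * (\<Prod>i = 0..<m. ?F $$ (i, p i)))"
        by (rule det_def'[OF Fc])
      also have "\<dots> = 0"
      proof (rule sum.neutral, rule ballI)
        fix p assume "p \<in> {p. p permutes {0..<m}}"
        then have "p r < m" using permutes_in_image[of p "{0..<m}" r] \<open>r < m\<close> by simp
        then have "?F $$ (r, p r) = 0" using \<open>r < m\<close> by simp
        then have "(\<Prod>i = 0..<m. ?F $$ (i, p i)) = 0"
          using \<open>r < m\<close> by (intro prod_zero) (auto intro!: bexI[of _ r])
        then show "signof p * (\<Prod>i = 0..<m. ?F $$ (i, p i)) = 0" by simp
      qed
      finally show ?thesis .
    qed
    then obtain y where y: "y \<in> carrier_vec m" "y \<noteq> 0\<^sub>v m" "?F *\<^sub>v y = 0\<^sub>v m"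
      using det_0_iff_vec_prod_zero[OF Fc] by auto
    have "F *\<^sub>v y = 0\<^sub>v r"
    proof (rule eq_vecI)
      fix i assume "i < dim_vec (0\<^sub>v r :: complex vec)"
      then have i: "i < r" by simp
      have "(F *\<^sub>v y) $ i = (?F *\<^sub>v y) $ i"
        using i y(1) F \<open>r < m\<close> by (simp add: scalar_prod_def)
      then show "(F *\<^sub>v y) $ i = 0\<^sub>v r $ i" using y(3) i \<open>r < m\<close> by simp
    qed (use F in simp)
    with y show ?thesis by blast
  qed
  then obtain y where y: "y \<in> carrier_vec m" "y \<noteq> 0\<^sub>v m" "F *\<^sub>v y = 0\<^sub>v r" by blast
  have "(E * F) *\<^sub>v y = E *\<^sub>v (F *\<^sub>v y)" by (rule assoc_mult_mat_vec[OF E F y(1)])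
  also have "\<dots> = 0\<^sub>v m" unfolding y(3) using E by (intro eq_vecI) (auto simp: scalar_prod_def)
  finally show ?thesis using det_0_iff_vec_prod_zero[OF mult_carrier_mat[OF E F]] y(1,2) by blast
qed

text \<open>
  The one-sided inverses of the factors of \<open>Y' ^\<^sub>m k\<close> define a polynomial function
  \<open>det (A' * Y ^\<^sub>m k * B')\<close> which is \<open>1\<close> at \<open>Y'\<close> and vanishes wherever the rank of \<open>Y ^\<^sub>m k\<close> is smaller
  than \<open>r'\<close>.
\<close>

lemma split_rank_closure:
  assumes S: "S \<subseteq> mat_pairs n" and r: "\<And>X Y. (X, Y) \<in> S \<Longrightarrow> split_rank n (Y ^\<^sub>m k) r"
    and p: "(X', Y') \<in> zariski n closure_of S" and r': "split_rank n (Y' ^\<^sub>m k) r'"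
  shows "r' \<le> r"
proof (rule ccontr)
  assume "\<not> ?thesis"
  then have "r < r'" by simp
  have p': "Y' \<in> carrier_mat n n"
    using p closure_of_subset_topspace[of "zariski n" S] by (auto simp: mat_pairs_def)
  obtain E' F' A' B' where c: "E' \<in> carrier_mat n r'" "F' \<in> carrier_mat r' n" "Y' ^\<^sub>m k = E' * F'"
    "A' \<in> carrier_mat r' n" "B' \<in> carrier_mat n r'" "A' * E' = 1\<^sub>m r'" "F' * B' = 1\<^sub>m r'"
    using r' by (rule split_rankE)
  define M where "M p = mat n n (\<lambda>ij. snd p $$ ij)" for p :: "complex mat \<times> complex mat"
  have M: "M (X, Y) = Y" if "Y \<in> carrier_mat n n" for X Y
    using that by (auto simp: M_def intro!: eq_matI)
  define f where "f p = det (A' * M p ^\<^sub>m k * B')" for p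
  have "pf.R_mat n n n M"
    by (rule pf.R_matI) (auto simp: M_def R_poly_funs intro: poly_funs.entry_snd)
  then have "pf.R_mat n r' r' (\<lambda>p. A' * M p ^\<^sub>m k * B')"
    using pf.R_mat_mult[OF pf.R_mat_mult[OF pf.R_mat_const[OF c(4)] pf.R_mat_pow] pf.R_mat_const[OF c(5)]] by blast
  then have f: "f \<in> poly_funs n"
    using pf.R_det by (simp add: f_def[abs_def] R_poly_funs)
  have "f q = 0" if "q \<in> S" for q
  proof -
    obtain X Y where q: "q = (X, Y)" by (cases q)
    with that have XY: "(X, Y) \<in> S" by simp
    then have Y: "Y \<in> carrier_mat n n" using S by (auto simp: mat_pairs_def)
    obtain E F A B where e: "E \<in> carrier_mat n r" "F \<in> carrier_mat r n" "Y ^\<^sub>m k = E * F"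
      using r[OF XY] by (rule split_rankE)
    have "A' * (E * F) * B' = (A' * E) * (F * B')"
      unfolding assoc_mult_mat[OF c(4) e(1,2), symmetric]
      by (rule assoc_mult_mat[OF mult_carrier_mat[OF c(4) e(1)] e(2) c(5)])
    then show ?thesis
      unfolding f_def q M[OF Y] e(3)
      using det_thin_product[OF mult_carrier_mat[OF c(4) e(1)] mult_carrier_mat[OF e(2) c(5)] \<open>r < r'\<close>] by simp
  qed
  from zero_on_closure[OF f this p] have "f (X', Y') = 0" .
  moreover have "A' * (E' * F') * B' = (A' * E') * (F' * B')"
    unfolding assoc_mult_mat[OF c(4) c(1,2), symmetric]
    by (rule assoc_mult_mat[OF mult_carrier_mat[OF c(4) c(1)] c(2,5)])
  then have "f (X', Y') = 1"
    unfolding f_def M[OF p'] c(3) by (simp add: c(6,7))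
  ultimately show False by simp
qed

lemma split_rank_similar:
  assumes "similar_mat Y J" "Y \<in> carrier_mat n n" "split_rank n (J ^\<^sub>m k) r"
  shows "split_rank n (Y ^\<^sub>m k) r"
proof -
  obtain P Q where PQ: "similar_mat_wit Y J P Q" using assms(1) unfolding similar_mat_def by blast
  from similar_mat_witD2[OF assms(2) PQ]
  have c: "P \<in> carrier_mat n n" "Q \<in> carrier_mat n n" "P * Q = 1\<^sub>m n" "Q * P = 1\<^sub>m n" by auto
  obtain E F A B where e: "E \<in> carrier_mat n r" "F \<in> carrier_mat r n" "J ^\<^sub>m k = E * F"
    "A \<in> carrier_mat r n" "B \<in> carrier_mat n r" "A * E = 1\<^sub>m r" "F * B = 1\<^sub>m r"
    using assms(3) by (rule split_rankE)
  show ?thesis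
  proof (rule split_rankI)
    show "P * E \<in> carrier_mat n r" "F * Q \<in> carrier_mat r n" "A * Q \<in> carrier_mat r n" "P * B \<in> carrier_mat n r"
      using c e by auto
    have "Y ^\<^sub>m k = P * (E * F) * Q" using similar_mat_wit_pow_id[OF PQ, of k] e(3) by simp
    also have "P * (E * F) = (P * E) * F" by (rule assoc_mult_mat[OF c(1) e(1,2), symmetric])
    also have "\<dots> * Q = (P * E) * (F * Q)" by (rule assoc_mult_mat[OF mult_carrier_mat[OF c(1) e(1)] e(2) c(2)])
    finally show "Y ^\<^sub>m k = (P * E) * (F * Q)" .
    have "A * Q * (P * E) = A * (Q * P) * E"
      using assoc_mult_mat[OF mult_carrier_mat[OF e(4) c(2)] c(1) e(1)] assoc_mult_mat[OF e(4) c(2) c(1)] by simp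
    then show "A * Q * (P * E) = 1\<^sub>m r" using c(4) e by simp
    have "F * Q * (P * B) = F * (Q * P) * B"
      using assoc_mult_mat[OF mult_carrier_mat[OF e(2) c(2)] c(1) e(5)] assoc_mult_mat[OF e(2) c(2) c(1)] by simp
    then show "F * Q * (P * B) = 1\<^sub>m r" using c(4) e by simp
  qed
qed

lemma split_rank_block:
  assumes "split_rank n M r" "split_rank m N s"
  shows "split_rank (n + m) (four_block_mat M (0\<^sub>m n m) (0\<^sub>m m n) N) (r + s)"
proof -
  obtain E F A B where 1: "E \<in> carrier_mat n r" "F \<in> carrier_mat r n" "M = E * F"
    "A \<in> carrier_mat r n" "B \<in> carrier_mat n r" "A * E = 1\<^sub>m r" "F * B = 1\<^sub>m r"
    using assms(1) by (rule split_rankE)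
  obtain E' F' A' B' where 2: "E' \<in> carrier_mat m s" "F' \<in> carrier_mat s m" "N = E' * F'"
    "A' \<in> carrier_mat s m" "B' \<in> carrier_mat m s" "A' * E' = 1\<^sub>m s" "F' * B' = 1\<^sub>m s"
    using assms(2) by (rule split_rankE)
  show ?thesis
  proof (rule split_rankI)
    let ?D = "\<lambda>P Q :: complex mat. four_block_mat P (0\<^sub>m (dim_row P) (dim_col Q)) (0\<^sub>m (dim_row Q) (dim_col P)) Q"
    show "?D E E' \<in> carrier_mat (n + m) (r + s)" "?D F F' \<in> carrier_mat (r + s) (n + m)"
      "?D A A' \<in> carrier_mat (r + s) (n + m)" "?D B B' \<in> carrier_mat (n + m) (r + s)"
      using 1 2 by auto
    have D: "?D P Q * ?D P' Q' = ?D (P * P') (Q * Q')"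
      if "dim_col P = dim_row P'" "dim_col Q = dim_row Q'" for P Q P' Q'
      using that
      by (subst mult_four_block_mat[of _ "dim_row P" "dim_col P" _ "dim_col Q" _ "dim_row Q" _ _ "dim_col P'" _ "dim_col Q'"]) auto
    show "four_block_mat M (0\<^sub>m n m) (0\<^sub>m m n) N = ?D E E' * ?D F F'"
      using 1 2 by (subst D) auto
    show "?D A A' * ?D E E' = 1\<^sub>m (r + s)" using 1 2 by (subst D) auto
    show "?D F F' * ?D B B' = 1\<^sub>m (r + s)" using 1 2 by (subst D) auto
  qed
qed

lemma split_rank_jordan_block: "split_rank m (jordan_block m 0 ^\<^sub>m k) (m - k)"
proof (rule split_rankI)
  let ?E = "mat m (m - k) (\<lambda>(i, a). if i = a then 1 else 0 :: complex)"
  let ?A = "mat (m - k) m (\<lambda>(a, i). if i = a then 1 else 0 :: complex)"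
  let ?F = "mat (m - k) m (\<lambda>(a, j). if j = a + k then 1 else 0 :: complex)"
  let ?B = "mat m (m - k) (\<lambda>(j, a). if j = a + k then 1 else 0 :: complex)"
  show "?E \<in> carrier_mat m (m - k)" "?F \<in> carrier_mat (m - k) m" "?A \<in> carrier_mat (m - k) m" "?B \<in> carrier_mat m (m - k)"
    by simp_all
  show "jordan_block m 0 ^\<^sub>m k = ?E * ?F"
    unfolding jordan_block_zero_pow
  proof (rule eq_matI)
    fix i j assume "i < dim_row (?E * ?F)" "j < dim_col (?E * ?F)"
    then have ij: "i < m" "j < m" by simp_all
    have "(?E * ?F) $$ (i, j) = (\<Sum>a<m - k. ?E $$ (i, a) * ?F $$ (a, j))"
      by (rule mat_prod_entry) (use ij in simp_all)
    also have "\<dots> = (\<Sum>a<m - k. if a = i then (if j = i + k then 1 else 0) else 0)"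
      by (rule sum.cong) (use ij in auto)
    finally show "mat m m (\<lambda>(i, j). if i \<le> j \<and> j - i = k then 1 else 0) $$ (i, j) = (?E * ?F) $$ (i, j)"
      using ij by (auto simp: sum.delta)
  qed simp_all
  show "?A * ?E = 1\<^sub>m (m - k)"
  proof (rule eq_matI)
    fix a b assume "a < dim_row (1\<^sub>m (m - k))" "b < dim_col (1\<^sub>m (m - k))"
    then have ab: "a < m - k" "b < m - k" by simp_all
    have "(?A * ?E) $$ (a, b) = (\<Sum>i<m. ?A $$ (a, i) * ?E $$ (i, b))"
      by (rule mat_prod_entry) (use ab in simp_all)
    also have "\<dots> = (\<Sum>i<m. if i = a then (if a = b then 1 else 0) else 0)"
      by (rule sum.cong) (use ab in auto)
    finally show "(?A * ?E) $$ (a, b) = 1\<^sub>m (m - k) $$ (a, b)"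
      using ab by (auto simp: sum.delta)
  qed simp_all
  show "?F * ?B = 1\<^sub>m (m - k)"
  proof (rule eq_matI)
    fix a b assume "a < dim_row (1\<^sub>m (m - k))" "b < dim_col (1\<^sub>m (m - k))"
    then have ab: "a < m - k" "b < m - k" by simp_all
    have "(?F * ?B) $$ (a, b) = (\<Sum>i<m. ?F $$ (a, i) * ?B $$ (i, b))"
      by (rule mat_prod_entry) (use ab in simp_all)
    also have "\<dots> = (\<Sum>i<m. if i = a + k then (if a = b then 1 else 0) else 0)"
      by (rule sum.cong) (use ab in auto)
    finally show "(?F * ?B) $$ (a, b) = 1\<^sub>m (m - k) $$ (a, b)"
      using ab by (auto simp: sum.delta)
  qed simp_all
qed

section \<open>Nilpotent Jordan matrices\<close>

definition nil_jordan :: "nat list \<Rightarrow> complex mat" where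
  "nil_jordan ks = jordan_matrix (map (\<lambda>k. (k, 0)) ks)"

lemma nil_jordan_carrier: "nil_jordan ks \<in> carrier_mat (sum_list ks) (sum_list ks)"
  using jordan_matrix_carrier[of "map (\<lambda>k. (k, 0 :: complex)) ks"] by (simp add: nil_jordan_def o_def)

lemma nil_jordan_Cons:
  "nil_jordan (k # ks) = four_block_mat (jordan_block k 0) (0\<^sub>m k (sum_list ks)) (0\<^sub>m (sum_list ks) k) (nil_jordan ks)"
  by (simp add: nil_jordan_def jordan_matrix_Cons o_def)

lemma nil_jordan_Nil: "nil_jordan [] = 0\<^sub>m 0 0"
  by (simp add: nil_jordan_def jordan_matrix_def)

lemma split_rank_nil_jordan:
  "split_rank (sum_list ks) (nil_jordan ks ^\<^sub>m k) (\<Sum>m\<leftarrow>ks. m - k)"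
proof (induction ks)
  case Nil
  have "nil_jordan [] ^\<^sub>m k \<in> carrier_mat 0 0" by (simp add: nil_jordan_Nil)
  then have "nil_jordan [] ^\<^sub>m k = 0\<^sub>m 0 0 * 0\<^sub>m 0 0" by (intro eq_matI) auto
  then show ?case by (intro split_rankI[of "0\<^sub>m 0 0" _ _ "0\<^sub>m 0 0" _ "0\<^sub>m 0 0" "0\<^sub>m 0 0"]) auto
next
  case (Cons m ks)
  have "nil_jordan (m # ks) ^\<^sub>m k = four_block_mat (jordan_block m 0 ^\<^sub>m k) (0\<^sub>m m (sum_list ks))
     (0\<^sub>m (sum_list ks) m) (nil_jordan ks ^\<^sub>m k)"
    unfolding nil_jordan_Cons by (rule pow_four_block_mat[OF jordan_block_carrier nil_jordan_carrier])
  then show ?case using split_rank_block[OF split_rank_jordan_block Cons.IH] by simp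
qed

lemma nil_jordan_superdiagonal:
  "i < sum_list ks \<Longrightarrow> j < sum_list ks \<Longrightarrow> nil_jordan ks $$ (i, j) \<noteq> 0 \<Longrightarrow> j = Suc i"
proof (induction ks arbitrary: i j)
  case (Cons m ks)
  show ?case
  proof (cases "i < m \<or> j < m")
    case True
    then show ?thesis
      using Cons.prems nil_jordan_carrier[of ks] by (auto simp: nil_jordan_Cons split: if_splits)
  next
    case False
    then have "nil_jordan ks $$ (i - m, j - m) \<noteq> 0"
      using Cons.prems nil_jordan_carrier[of ks] by (auto simp: nil_jordan_Cons)
    moreover have "i - m < sum_list ks" "j - m < sum_list ks" using False Cons.prems by auto
    ultimately have "j - m = Suc (i - m)" using Cons.IH by blast
    then show ?thesis using False by arith
  qed
qed simp

text \<open>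
  The fibre over a matrix \<open>J\<close> supported on the superdiagonal is not empty: for \<open>D = diag (0, 1, 2, ...)\<close>
  one has \<open>D * J - J * D = - J\<close>, hence \<open>X = - D * J\<close> satisfies \<open>X * J - J * X = J * J\<close>. This is the matrix
  form of the derivation \<open>y\<^sup>2 d/dy\<close>.
\<close>

lemma weighted_superdiagonal_relation:
  fixes J :: "complex mat"
  assumes J: "J \<in> carrier_mat n n" and super: "\<And>i j. i < n \<Longrightarrow> j < n \<Longrightarrow> J $$ (i, j) \<noteq> 0 \<Longrightarrow> j = Suc i"
  defines "X \<equiv> mat n n (\<lambda>(i, j). - of_nat i * J $$ (i, j))"
  shows "X * J - J * X = J * J"
proof (rule eq_matI)
  fix i j assume "i < dim_row (J * J)" "j < dim_col (J * J)"
  then have ij: "i < n" "j < n" using J by auto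
  have "(X * J - J * X) $$ (i, j) = (\<Sum>k<n. - of_nat i * J $$ (i, k) * J $$ (k, j)) - (\<Sum>k<n. J $$ (i, k) * (- of_nat k * J $$ (k, j)))"
    using ij J by (simp add: X_def scalar_prod_def atLeast0LessThan)
  also have "\<dots> = (\<Sum>k<n. J $$ (i, k) * J $$ (k, j))"
    unfolding sum_subtractf[symmetric]
  proof (rule sum.cong)
    fix k assume "k \<in> {..<n}"
    then show "- of_nat i * J $$ (i, k) * J $$ (k, j) - J $$ (i, k) * (- of_nat k * J $$ (k, j)) = J $$ (i, k) * J $$ (k, j)"
      using super[of i k] ij by (cases "J $$ (i, k) = 0") (auto simp: algebra_simps)
  qed simp
  also have "\<dots> = (J * J) $$ (i, j)" using ij J by (simp add: scalar_prod_def atLeast0LessThan)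
  finally show "(X * J - J * X) $$ (i, j) = (J * J) $$ (i, j)" .
qed (use J in \<open>simp_all add: X_def\<close>)

lemma similar_mat_swap_blocks:
  fixes A B :: "complex mat"
  assumes A: "A \<in> carrier_mat p p" and B: "B \<in> carrier_mat q q"
  shows "similar_mat (four_block_mat A (0\<^sub>m p q) (0\<^sub>m q p) B) (four_block_mat B (0\<^sub>m q p) (0\<^sub>m p q) A)"
proof (rule similar_matI)
  let ?W = "four_block_mat (0\<^sub>m p q) (1\<^sub>m p) (1\<^sub>m q) (0\<^sub>m q p) :: complex mat"
  let ?W' = "four_block_mat (0\<^sub>m q p) (1\<^sub>m q) (1\<^sub>m p) (0\<^sub>m p q) :: complex mat"
  let ?AB = "four_block_mat A (0\<^sub>m p q) (0\<^sub>m q p) B" and ?BA = "four_block_mat B (0\<^sub>m q p) (0\<^sub>m p q) A"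
  have W: "?W \<in> carrier_mat (p + q) (p + q)" "?W' \<in> carrier_mat (p + q) (p + q)"
    by (intro carrier_matI; simp)+
  have AB: "?AB \<in> carrier_mat (p + q) (p + q)" "?BA \<in> carrier_mat (p + q) (p + q)"
    using A B by (intro carrier_matI; simp)+
  show "{?AB, ?BA, ?W, ?W'} \<subseteq> carrier_mat (p + q) (p + q)" using W AB by simp
  show 1: "?W * ?W' = 1\<^sub>m (p + q)"
    by (subst mult_four_block_mat[of _ p q _ p _ q _ _ p _ q]) auto
  show "?W' * ?W = 1\<^sub>m (p + q)"
    by (subst mult_four_block_mat[of _ q p _ q _ p _ _ q _ p]) (auto simp: add.commute)
  have "?W * ?BA = four_block_mat (0\<^sub>m p q) A B (0\<^sub>m q p)"
    using A B by (subst mult_four_block_mat[of _ p q _ p _ q _ _ q _ p]) auto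
  moreover have "?AB * ?W = four_block_mat (0\<^sub>m p q) A B (0\<^sub>m q p)"
    using A B by (subst mult_four_block_mat[of _ p p _ q _ q _ _ q _ p]) auto
  ultimately have eq: "?AB * ?W = ?W * ?BA" by simp
  have "?AB = ?AB * (?W * ?W')" unfolding 1 by (rule right_mult_one_mat[OF AB(1), symmetric])
  also have "\<dots> = ?W * ?BA * ?W'" unfolding assoc_mult_mat[OF AB(1) W, symmetric] eq ..
  finally show "?AB = ?W * ?BA * ?W'" .
qed

lemma nil_jordan_append:
  "nil_jordan (as @ bs) = four_block_mat (nil_jordan as) (0\<^sub>m (sum_list as) (sum_list bs))
     (0\<^sub>m (sum_list bs) (sum_list as)) (nil_jordan bs)"
  using nil_jordan_carrier[of as] nil_jordan_carrier[of bs]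
  by (simp add: nil_jordan_def jordan_matrix_def diag_block_mat_append Let_def)

text \<open>
  The stratum of a partition admits its parts as block sizes in any order, whereas the family over
  one Jordan matrix fixes an order.
\<close>

lemma similar_nil_jordan_perm:
  "mset as = mset bs \<Longrightarrow> similar_mat (nil_jordan as) (nil_jordan bs)"
proof (induction as arbitrary: bs)
  case Nil
  then show ?case using similar_mat_refl[OF nil_jordan_carrier] by simp
next
  case (Cons a as)
  then have "a \<in> set bs" by (metis list.set_intros(1) mset_eq_setD)
  then obtain us vs where bs: "bs = us @ a # vs" by (meson split_list)
  with Cons.prems have "mset as = mset (vs @ us)" by simp
  from Cons.IH[OF this] have "similar_mat (nil_jordan as) (nil_jordan (vs @ us))" .
  moreover have s: "sum_list as = sum_list (vs @ us)"
    using \<open>mset as = mset (vs @ us)\<close> by (metis sum_mset_sum_list)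
  ultimately have "similar_mat (nil_jordan (a # as)) (nil_jordan (a # vs @ us))"
    unfolding nil_jordan_Cons s[symmetric]
    by (intro similar_mat_four_block_0_0 similar_mat_refl[OF jordan_block_carrier] jordan_block_carrier nil_jordan_carrier)
  moreover have "similar_mat (nil_jordan ((a # vs) @ us)) (nil_jordan (us @ (a # vs)))"
    unfolding nil_jordan_append by (rule similar_mat_swap_blocks[OF nil_jordan_carrier nil_jordan_carrier])
  ultimately show ?case unfolding bs by (auto intro: similar_mat_trans)
qed

text \<open>
  Compare traces: a commutator has trace \<open>0\<close>, while the square of the block has trace \<open>m * a\<^sup>2\<close>.
\<close>

lemma jordan_block_square_commutator:
  fixes a :: complex
  assumes X: "X \<in> carrier_mat m m" and "0 < m"
    and rel: "X * jordan_block m a - jordan_block m a * X = jordan_block m a * jordan_block m a"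
  shows "a = 0"
proof -
  let ?J = "jordan_block m a"
  have Jc: "?J \<in> carrier_mat m m" by simp
  have "(\<Sum>i<m. (X * ?J) $$ (i, i)) = (\<Sum>i<m. \<Sum>k<m. X $$ (i, k) * ?J $$ (k, i))"
    by (intro sum.cong refl mat_prod_entry[OF X Jc]) simp_all
  also have "\<dots> = (\<Sum>k<m. \<Sum>i<m. ?J $$ (k, i) * X $$ (i, k))"
    by (subst sum.swap) (simp add: mult.commute)
  also have "\<dots> = (\<Sum>i<m. (?J * X) $$ (i, i))"
    by (intro sum.cong refl mat_prod_entry[OF Jc X, symmetric]) simp_all
  finally have tr: "(\<Sum>i<m. (X * ?J) $$ (i, i)) = (\<Sum>i<m. (?J * X) $$ (i, i))" .
  have "(?J * ?J) $$ (i, i) = a\<^sup>2" if "i < m" for i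
  proof -
    have "(?J * ?J) $$ (i, i) = (\<Sum>k<m. ?J $$ (i, k) * ?J $$ (k, i))"
      by (rule mat_prod_entry[OF Jc Jc that that])
    also have "\<dots> = (\<Sum>k<m. if k = i then a\<^sup>2 else 0)"
      by (rule sum.cong) (use that in \<open>auto simp: power2_eq_square\<close>)
    finally show ?thesis using that by simp
  qed
  then have "of_nat m * a\<^sup>2 = (\<Sum>i<m. (?J * ?J) $$ (i, i))" by simp
  also have "\<dots> = (\<Sum>i<m. (X * ?J) $$ (i, i) - (?J * X) $$ (i, i))"
    unfolding rel[symmetric] using X Jc by (intro sum.cong refl index_minus_mat(1)) auto
  also have "\<dots> = 0" using tr by (simp add: sum_subtractf)
  finally show "a = 0" using \<open>0 < m\<close> by simp
qed

text \<open>
  The diagonal blocks of the relation only involve the diagonal blocks of \<open>X\<close>, because the Jordan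
  matrix is block diagonal.
\<close>

lemma jordan_matrix_eigenvalues_zero:
  fixes X :: "complex mat"
  assumes "X \<in> carrier_mat (sum_list (map fst n_as)) (sum_list (map fst n_as))"
    and "X * jordan_matrix n_as - jordan_matrix n_as * X = jordan_matrix n_as * jordan_matrix n_as"
    and "0 \<notin> fst ` set n_as"
  shows "\<forall>(m, a)\<in>set n_as. a = 0"
  using assms
proof (induction n_as arbitrary: X)
  case (Cons ma n_as)
  obtain m a where ma: "ma = (m, a)" by (cases ma)
  let ?k = "sum_list (map fst n_as)"
  let ?B = "jordan_block m a" and ?J = "jordan_matrix n_as"
  have Bc: "?B \<in> carrier_mat m m" and Jc: "?J \<in> carrier_mat ?k ?k" by simp_all
  have J: "jordan_matrix (ma # n_as) = four_block_mat ?B (0\<^sub>m m ?k) (0\<^sub>m ?k m) ?J"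
    unfolding ma by (rule jordan_matrix_Cons)
  obtain X1 X2 X3 X4 where sb: "split_block X m m = (X1, X2, X3, X4)" by (metis prod_cases4)
  have "dim_row X = m + ?k" "dim_col X = m + ?k" using Cons.prems(1) ma by auto
  note X = split_block[OF sb this]
  have 1: "X * jordan_matrix (ma # n_as) = four_block_mat (X1 * ?B) (X2 * ?J) (X3 * ?B) (X4 * ?J)"
    unfolding J X(5)
    using X(1-4) Bc Jc by (subst mult_four_block_mat[of _ m m _ ?k _ ?k _ _ m _ ?k]) auto
  have 2: "jordan_matrix (ma # n_as) * X = four_block_mat (?B * X1) (?B * X2) (?J * X3) (?J * X4)"
    unfolding J X(5)
    using X(1-4) Bc Jc by (subst mult_four_block_mat[of _ m m _ ?k _ ?k _ _ m _ ?k]) auto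
  have 3: "jordan_matrix (ma # n_as) * jordan_matrix (ma # n_as) = four_block_mat (?B * ?B) (0\<^sub>m m ?k) (0\<^sub>m ?k m) (?J * ?J)"
    unfolding J
    using Bc Jc by (subst mult_four_block_mat[of _ m m _ ?k _ ?k _ _ m _ ?k]) auto
  note rel = Cons.prems(2)[unfolded 1 2 3]
  have "X1 * ?B - ?B * X1 = ?B * ?B"
  proof (rule eq_matI)
    fix i j assume "i < dim_row (?B * ?B)" "j < dim_col (?B * ?B)"
    then have ij: "i < m" "j < m" by simp_all
    from arg_cong[OF rel, of "\<lambda>M. M $$ (i, j)"]
    show "(X1 * ?B - ?B * X1) $$ (i, j) = (?B * ?B) $$ (i, j)"
      using ij X(1-4) Bc Jc by (simp del: index_mult_mat(1))
  qed (use X Bc in auto)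
  then have "a = 0" using jordan_block_square_commutator[OF X(1)] Cons.prems(3) ma by auto
  moreover have "X4 * ?J - ?J * X4 = ?J * ?J"
  proof (rule eq_matI)
    fix i j assume "i < dim_row (?J * ?J)" "j < dim_col (?J * ?J)"
    then have ij: "i < ?k" "j < ?k" by simp_all
    from arg_cong[OF rel, of "\<lambda>M. M $$ (i + m, j + m)"]
    show "(X4 * ?J - ?J * X4) $$ (i, j) = (?J * ?J) $$ (i, j)"
      using ij X(1-4) Bc Jc by (simp del: index_mult_mat(1))
  qed (use X Jc in auto)
  then have "\<forall>(m, a)\<in>set n_as. a = 0" using Cons.IH[OF X(4)] Cons.prems(3) by auto
  ultimately show ?case by (simp add: ma)
qed simp

section \<open>The strata\<close>

lemma similar_mat_inverse_wit:
  assumes "similar_mat Y J" "Y \<in> carrier_mat n n"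
  obtains P Q where "P \<in> carrier_mat n n" "Q \<in> carrier_mat n n" "J \<in> carrier_mat n n"
    "P * Q = 1\<^sub>m n" "Q * P = 1\<^sub>m n" "Y = P * J * Q"
proof -
  obtain P Q where "similar_mat_wit Y J P Q" using assms(1) unfolding similar_mat_def by blast
  from similar_mat_witD2[OF assms(2) this] that show ?thesis by blast
qed

lemma relation_conj:
  fixes J :: "complex mat"
  assumes c: "P \<in> carrier_mat n n" "Q \<in> carrier_mat n n" "J \<in> carrier_mat n n" "X \<in> carrier_mat n n"
    and PQ: "P * Q = 1\<^sub>m n" "Q * P = 1\<^sub>m n"
    and rel: "X * (P * J * Q) - (P * J * Q) * X = (P * J * Q) * (P * J * Q)"
  shows "(Q * X * P) * J - J * (Q * X * P) = J * J"
proof -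
  let ?Y = "P * J * Q"
  have Yc: "?Y \<in> carrier_mat n n" using c by simp
  have YP: "?Y * P = P * J"
  proof -
    have "?Y * P = P * J * (Q * P)" by (rule assoc_mult_mat) (use c in auto)
    then show ?thesis using c PQ by simp
  qed
  have QY: "Q * ?Y = J * Q"
  proof -
    have "Q * ?Y = Q * (P * (J * Q))" using c by (simp add: assoc_mult_mat[of P n n J n Q n])
    also have "\<dots> = Q * P * (J * Q)" by (rule assoc_mult_mat[symmetric]) (use c in auto)
    finally show ?thesis using c PQ by simp
  qed
  have 1: "(Q * X * P) * J = Q * (X * ?Y) * P"
  proof -
    have "(Q * X * P) * J = Q * X * (?Y * P)" unfolding YP by (rule assoc_mult_mat) (use c in auto)
    also have "\<dots> = Q * X * ?Y * P" by (rule assoc_mult_mat[symmetric]) (use c Yc in auto)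
    also have "Q * X * ?Y = Q * (X * ?Y)" by (rule assoc_mult_mat) (use c Yc in auto)
    finally show ?thesis .
  qed
  have 2: "J * (Q * X * P) = Q * (?Y * X) * P"
  proof -
    have "J * (Q * X * P) = J * (Q * X) * P" by (rule assoc_mult_mat[symmetric]) (use c in auto)
    also have "J * (Q * X) = (J * Q) * X" by (rule assoc_mult_mat[symmetric]) (use c in auto)
    also have "\<dots> = Q * (?Y * X)" unfolding QY[symmetric] by (rule assoc_mult_mat) (use c Yc in auto)
    finally show ?thesis .
  qed
  have 3: "J * J = Q * (?Y * ?Y) * P"
  proof -
    have "Q * (?Y * ?Y) * P = (Q * ?Y) * ?Y * P" using assoc_mult_mat[OF c(2) Yc Yc] by simp
    also have "\<dots> = (Q * ?Y) * (?Y * P)" by (rule assoc_mult_mat) (use c Yc in auto)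
    also have "\<dots> = J * Q * (P * J)" unfolding YP QY ..
    also have "\<dots> = J * (Q * (P * J))" by (rule assoc_mult_mat) (use c in auto)
    also have "Q * (P * J) = Q * P * J" by (rule assoc_mult_mat[symmetric]) (use c in auto)
    finally show ?thesis using c PQ by simp
  qed
  have "Q * (X * ?Y) * P - Q * (?Y * X) * P = Q * (X * ?Y - ?Y * X) * P"
  proof -
    have d: "X * ?Y \<in> carrier_mat n n" "?Y * X \<in> carrier_mat n n" using c(4) Yc by auto
    show ?thesis
      unfolding mult_minus_distrib_mat[OF c(2) d]
      by (rule minus_mult_distrib_mat[OF mult_carrier_mat[OF c(2) d(1)] mult_carrier_mat[OF c(2) d(2)] c(1), symmetric])
  qed
  then show ?thesis unfolding 1 2 3 rel .
qed

lemma mod_R_jordan_eigenvalues_zero: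
  assumes XY: "(X, Y) \<in> mod_R n" and nf: "jordan_nf Y n_as"
  shows "\<forall>(m, a)\<in>set n_as. a = 0"
proof -
  let ?J = "jordan_matrix n_as"
  have c: "X \<in> carrier_mat n n" "Y \<in> carrier_mat n n" and rel: "X * Y - Y * X = Y * Y"
    using XY by (auto simp: mod_R_def)
  have sim: "similar_mat Y ?J" and 0: "0 \<notin> fst ` set n_as" using nf by (auto simp: jordan_nf_def)
  obtain P Q where PQ: "P \<in> carrier_mat n n" "Q \<in> carrier_mat n n" "?J \<in> carrier_mat n n"
    "P * Q = 1\<^sub>m n" "Q * P = 1\<^sub>m n" "Y = P * ?J * Q"
    using sim c(2) by (rule similar_mat_inverse_wit)
  have n: "sum_list (map fst n_as) = n" using carrier_matD(1)[OF PQ(3)] by simp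
  from relation_conj[OF PQ(1,2,3) c(1) PQ(4,5)] rel PQ(6)
  have "(Q * X * P) * ?J - ?J * (Q * X * P) = ?J * ?J" by simp
  moreover have "Q * X * P \<in> carrier_mat (sum_list (map fst n_as)) (sum_list (map fst n_as))"
    unfolding n using c PQ by simp
  ultimately show ?thesis using 0 by (intro jordan_matrix_eigenvalues_zero)
qed

lemma stratum_similar:
  assumes ks: "mset ks = P" "P \<in> partitions n"
  shows "stratum n P = {(X, Y) \<in> mod_R n. similar_mat Y (nil_jordan ks)}"
proof (intro equalityI subsetI)
  fix p assume p: "p \<in> stratum n P"
  then obtain X Y n_as where XY: "p = (X, Y)" "(X, Y) \<in> mod_R n" "jordan_nf Y n_as" "mset (map fst n_as) = P"
    by (auto simp: stratum_def)
  have "map (\<lambda>k. (k, 0)) (map fst n_as) = n_as"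
    using mod_R_jordan_eigenvalues_zero[OF XY(2,3)] by (auto intro!: map_idI)
  then have "similar_mat Y (nil_jordan (map fst n_as))"
    using XY(3) by (simp add: jordan_nf_def nil_jordan_def)
  moreover have "similar_mat (nil_jordan (map fst n_as)) (nil_jordan ks)"
    using XY(4) ks(1) by (intro similar_nil_jordan_perm) simp
  ultimately show "p \<in> {(X, Y) \<in> mod_R n. similar_mat Y (nil_jordan ks)}"
    using XY(1,2) similar_mat_trans by auto
next
  fix p assume "p \<in> {(X, Y) \<in> mod_R n. similar_mat Y (nil_jordan ks)}"
  then obtain X Y where XY: "p = (X, Y)" "(X, Y) \<in> mod_R n" "similar_mat Y (nil_jordan ks)" by auto
  have "0 \<notin> set ks" using ks by (auto simp: partitions_def)
  then have "jordan_nf Y (map (\<lambda>k. (k, 0)) ks)"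
    using XY(3) by (auto simp: jordan_nf_def nil_jordan_def)
  moreover have "mset (map fst (map (\<lambda>k. (k, 0 :: complex)) ks)) = P" using ks(1) by (simp add: o_def)
  ultimately show "p \<in> stratum n P" using XY(1,2) unfolding stratum_def by blast
qed

lemma fibre_bundle_nil_jordan:
  assumes "sum_list ks = n"
  shows "\<exists>X0. fibre_bundle n (nil_jordan ks) X0"
proof -
  let ?J = "nil_jordan ks"
  have J: "?J \<in> carrier_mat n n" using nil_jordan_carrier[of ks] assms by simp
  have "mat n n (\<lambda>(i, j). - of_nat i * ?J $$ (i, j)) * ?J - ?J * mat n n (\<lambda>(i, j). - of_nat i * ?J $$ (i, j)) = ?J * ?J"
    using nil_jordan_superdiagonal[of _ ks] assms by (intro weighted_superdiagonal_relation[OF J]) auto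
  then have "fibre_bundle n ?J (mat n n (\<lambda>(i, j). - of_nat i * ?J $$ (i, j)))"
    using J by unfold_locales auto
  then show ?thesis by blast
qed

lemma (in fibre_bundle) orbit_family_eq:
  "orbit_family = {(X, Y) \<in> mod_R n. similar_mat Y J}"
proof (intro equalityI subsetI)
  fix p assume "p \<in> orbit_family"
  then obtain g X0' where g: "g \<in> carrier_mat n n" "det g \<noteq> 0" and X0': "X0' \<in> fibre" "p = conj_pt J g X0'"
    unfolding orbit_family_def by (elim conj_imageE) auto
  note Xc = fibre_carrier[OF X0'(1)]
  obtain X Y where p: "p = (X, Y)" by (cases p)
  have "p \<in> mat_pairs n" unfolding X0'(2) by (rule conj_pt_mat_pairs[OF J g(1) Xc])
  then have c: "X \<in> carrier_mat n n" "Y \<in> carrier_mat n n" by (simp_all add: p mat_pairs_def)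
  obtain g' where g': "g' \<in> carrier_mat n n" "g * g' = 1\<^sub>m n" "g' * g = 1\<^sub>m n"
    using det_nonzero_inverse[OF g] by blast
  have eq: "X * g = g * X0'" "Y * g = g * J"
    using conj_pt_eq_iff[OF J g(1) Xc g(2) c] X0'(2) p by simp_all
  have cancel: "A = g * B * g'" if "A * g = g * B" "A \<in> carrier_mat n n" "B \<in> carrier_mat n n" for A B
  proof -
    have "A = A * (g * g')" using that g'(2) by simp
    also have "\<dots> = g * B * g'" unfolding that(1)[symmetric] by (rule assoc_mult_mat[OF that(2) g(1) g'(1), symmetric])
    finally show ?thesis .
  qed
  have X: "X = g * X0' * g'" and Y: "Y = g * J * g'"
    using cancel[OF eq(1) c(1) Xc] cancel[OF eq(2) c(2) J] by simp_all
  have X': "X0' = g' * X * g"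
  proof -
    have "g' * X * g = g' * (X * g)" by (rule assoc_mult_mat[OF g'(1) c(1) g(1)])
    also have "\<dots> = g' * g * X0'" unfolding eq(1) by (rule assoc_mult_mat[OF g'(1) g(1) Xc, symmetric])
    finally show ?thesis using g'(3) Xc by simp
  qed
  have J': "J = g' * Y * g"
  proof -
    have "g' * Y * g = g' * (Y * g)" by (rule assoc_mult_mat[OF g'(1) c(2) g(1)])
    also have "\<dots> = g' * g * J" unfolding eq(2) by (rule assoc_mult_mat[OF g'(1) g(1) J, symmetric])
    finally show ?thesis using g'(3) J by simp
  qed
  have "X0' * (g' * Y * g) - (g' * Y * g) * X0' = (g' * Y * g) * (g' * Y * g)"
    using X0'(1) unfolding J'[symmetric] fibre_def by simp
  from relation_conj[OF g'(1) g(1) c(2) Xc g'(3,2) this]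
  have "X * Y - Y * X = Y * Y" unfolding X[symmetric] .
  moreover have "similar_mat Y J"
    by (rule similar_matI[of _ _ g g' n]) (use c g g' J Y in auto)
  ultimately show "p \<in> {(X, Y) \<in> mod_R n. similar_mat Y J}" using c by (simp add: p mod_R_def)
next
  fix p assume "p \<in> {(X, Y) \<in> mod_R n. similar_mat Y J}"
  then obtain X Y where p: "p = (X, Y)" and XY: "(X, Y) \<in> mod_R n" "similar_mat Y J" by auto
  have c: "X \<in> carrier_mat n n" "Y \<in> carrier_mat n n" and rel: "X * Y - Y * X = Y * Y"
    using XY(1) by (auto simp: mod_R_def)
  obtain P Q where PQ: "P \<in> carrier_mat n n" "Q \<in> carrier_mat n n" "J \<in> carrier_mat n n"
    "P * Q = 1\<^sub>m n" "Q * P = 1\<^sub>m n" "Y = P * J * Q"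
    using XY(2) c(2) by (rule similar_mat_inverse_wit)
  have "Q * X * P \<in> fibre"
    using relation_conj[OF PQ(1,2,3) c(1) PQ(4,5)] rel PQ c unfolding fibre_def by simp
  moreover have "det P * det Q = 1" using det_mult[OF PQ(1,2)] PQ(4) by simp
  then have dP: "det P \<noteq> 0" by auto
  ultimately have "conj_pt J P (Q * X * P) \<in> orbit_family"
    unfolding orbit_family_def using PQ(1) by (intro conj_imageI) auto
  moreover have "conj_pt J P (Q * X * P) = (X, Y)"
  proof -
    have "P * (Q * X * P) = P * (Q * X) * P" by (rule assoc_mult_mat[symmetric]) (use c PQ in auto)
    also have "P * (Q * X) = P * Q * X" by (rule assoc_mult_mat[symmetric]) (use c PQ in auto)
    finally have 1: "X * P = P * (Q * X * P)" using PQ c by simp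
    have "Y * P = P * J * (Q * P)" unfolding PQ(6) by (rule assoc_mult_mat) (use PQ in auto)
    then have 2: "Y * P = P * J" using PQ by simp
    have "Q * X * P \<in> carrier_mat n n" using c PQ by simp
    from conj_pt_eq_iff[OF J PQ(1) this dP c] 1 2 show ?thesis by simp
  qed
  ultimately show "p \<in> orbit_family" by (simp add: p)
qed

lemma partition_sum_list: "mset ks = P \<Longrightarrow> P \<in> partitions n \<Longrightarrow> sum_list ks = n"
  by (auto simp: partitions_def sum_mset_sum_list)

lemma stratum_is_orbit_family:
  assumes "P \<in> partitions n"
  obtains J X0 where "fibre_bundle n J X0" "fibre_bundle.orbit_family n J = stratum n P"
proof -
  obtain ks where ks: "mset ks = P" using ex_mset by blast
  obtain X0 where X0: "fibre_bundle n (nil_jordan ks) X0"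
    using fibre_bundle_nil_jordan[OF partition_sum_list[OF ks assms]] by blast
  show ?thesis
    by (rule that[OF X0]) (simp add: fibre_bundle.orbit_family_eq[OF X0] stratum_similar[OF ks assms])
qed

lemma mod_R_strata: "mod_R n = (\<Union>P\<in>partitions n. stratum n P)"
proof (intro equalityI subsetI)
  fix p assume "p \<in> mod_R n"
  then obtain X Y where p: "p = (X, Y)" "(X, Y) \<in> mod_R n" by (cases p) auto
  then have Y: "Y \<in> carrier_mat n n" by (auto simp: mod_R_def)
  obtain as where "char_poly Y = (\<Prod>a\<leftarrow>as. [:- a, 1:])"
    using char_poly_factorized[OF Y] by blast
  then obtain n_as where nf: "jordan_nf Y n_as" using jordan_nf_exists[OF Y] by blast
  then have "similar_mat Y (jordan_matrix n_as)" by (simp add: jordan_nf_def)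
  then obtain Q where "jordan_matrix n_as \<in> carrier_mat n n" using similar_mat_inverse_wit[OF _ Y] by blast
  then have "sum_list (map fst n_as) = n" using carrier_matD(1) by fastforce
  then have "\<Sum>\<^sub># (mset (map fst n_as)) = n" by (metis sum_mset_sum_list)
  moreover have "0 \<notin># mset (map fst n_as)" using nf by (auto simp: jordan_nf_def)
  ultimately have "mset (map fst n_as) \<in> partitions n" unfolding partitions_def by blast
  moreover have "p \<in> stratum n (mset (map fst n_as))" using p nf unfolding stratum_def by blast
  ultimately show "p \<in> (\<Union>P\<in>partitions n. stratum n P)" by blast
qed (auto simp: stratum_def)

lemma finite_partitions: "finite (partitions n)"
proof -
  have "partitions n \<subseteq> mset ` {xs. set xs \<subseteq> {..n} \<and> length xs \<le> n}"
  proof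
    fix P assume P: "P \<in> partitions n"
    obtain xs where xs: "mset xs = P" using ex_mset by blast
    have sum: "sum_list xs = n" by (rule partition_sum_list[OF xs P])
    have pos: "\<forall>x\<in>set xs. 1 \<le> x" using P xs by (auto simp: partitions_def Suc_le_eq intro!: gr0I)
    have "set xs \<subseteq> {..n}" using member_le_sum_list[of _ xs] sum by auto
    moreover have "length xs \<le> sum_list xs" using pos by (induction xs) auto
    ultimately show "P \<in> mset ` {xs. set xs \<subseteq> {..n} \<and> length xs \<le> n}" using xs sum by auto
  qed
  then show ?thesis by (rule finite_subset) (simp add: finite_lists_length_le)
qed

text \<open>
  The first differences of the ranks count the parts larger than \<open>k\<close>, the second differences the parts
  equal to \<open>Suc k\<close>.
\<close>

lemma partition_determined_by_ranks:
  assumes "P \<in> partitions n" "Q \<in> partitions n" and eq: "\<And>k. (\<Sum>m\<in>#P. m - k) = (\<Sum>m\<in>#Q. m - k)"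
  shows "P = Q"
proof (rule multiset_eqI)
  fix x
  have diff: "(\<Sum>m\<in>#R. m - k) = (\<Sum>m\<in>#R. m - Suc k) + size {#m \<in># R. k < m#}" for R :: "nat multiset" and k
    by (induction R) auto
  then have gt: "size {#m \<in># P. k < m#} = size {#m \<in># Q. k < m#}" for k
    using eq[of k] eq[of "Suc k"] diff[where R = P and k = k] diff[where R = Q and k = k] by linarith
  have cnt: "size {#m \<in># R. k < m#} = size {#m \<in># R. Suc k < m#} + count R (Suc k)" for R :: "nat multiset" and k
    by (induction R) auto
  show "count P x = count Q x"
  proof (cases x)
    case 0
    then show ?thesis using assms(1,2) by (simp add: partitions_def not_in_iff)
  next
    case (Suc k)
    then show ?thesis using cnt[where R = P and k = k] cnt[where R = Q and k = k] gt[of k] gt[of "Suc k"] by simp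
  qed
qed

lemma stratum_closure_rank:
  assumes P: "P \<in> partitions n" and Q: "Q \<in> partitions n"
    and sub: "stratum n Q \<subseteq> zariski n closure_of stratum n P"
  shows "(\<Sum>m\<in>#Q. m - k) \<le> (\<Sum>m\<in>#P. m - k)"
proof -
  obtain ps where ps: "mset ps = P" using ex_mset by blast
  obtain qs where qs: "mset qs = Q" using ex_mset by blast
  have rank: "split_rank n (Y ^\<^sub>m k) (\<Sum>m\<leftarrow>xs. m - k)"
    if "mset xs = R" "R \<in> partitions n" "(X, Y) \<in> stratum n R" for X Y xs R
  proof -
    have "similar_mat Y (nil_jordan xs)" "Y \<in> carrier_mat n n"
      using that(3) unfolding stratum_similar[OF that(1,2)] by (auto simp: mod_R_def)
    then show ?thesis
      by (rule split_rank_similar) (rule split_rank_nil_jordan[of xs k, unfolded partition_sum_list[OF that(1,2)]])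
  qed
  obtain J X0 where fb: "fibre_bundle n J X0" "fibre_bundle.orbit_family n J = stratum n Q"
    using stratum_is_orbit_family[OF Q] by metis
  then have "stratum n Q \<noteq> {}"
    using fibre_bundle.orbit_family_irreducible[OF fb(1)] by (simp add: irreducible_subset_def)
  then obtain X Y where XY: "(X, Y) \<in> stratum n Q" by auto
  have "stratum n P \<subseteq> mat_pairs n" by (auto simp: stratum_def mod_R_def mat_pairs_def)
  then have "(\<Sum>m\<leftarrow>qs. m - k) \<le> (\<Sum>m\<leftarrow>ps. m - k)"
    by (rule split_rank_closure[OF _ rank[OF ps P] subsetD[OF sub XY] rank[OF qs Q XY]])
  then show ?thesis using ps qs by (metis mset_map sum_mset_sum_list)
qed

section \<open>The irreducible components\<close>

lemma closedin_mod_R: "closedin (zariski n) (mod_R n)"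
  unfolding closedin_zariski
proof (intro exI conjI)
  let ?f = "\<lambda>(i, j) p. (\<Sum>k<n. fst p $$ (i, k) * snd p $$ (k, j)) - (\<Sum>k<n. snd p $$ (i, k) * fst p $$ (k, j))
     - (\<Sum>k<n. snd p $$ (i, k) * snd p $$ (k, j)) :: complex"
  let ?F = "?f ` ({..<n} \<times> {..<n})"
  show "?F \<subseteq> poly_funs n"
  proof
    fix f assume "f \<in> ?F"
    then obtain i j where ij: "i < n" "j < n" and f: "f = ?f (i, j)" by auto
    have "?f (i, j) \<in> pf.R n"
      unfolding prod.case
      by (intro pf.R_diff pf.R_sum pf.R_mult; simp add: R_poly_funs poly_funs.intros ij)
    then show "f \<in> poly_funs n" by (simp add: f R_poly_funs)
  qed
  show "mod_R n = {p \<in> mat_pairs n. \<forall>f\<in>?F. f p = 0}"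
  proof (intro equalityI subsetI)
    fix p assume p: "p \<in> mod_R n"
    then obtain X Y where XY: "p = (X, Y)" "X \<in> carrier_mat n n" "Y \<in> carrier_mat n n" "X * Y - Y * X = Y * Y"
      by (auto simp: mod_R_def)
    have "?f (i, j) p = 0" if "i < n" "j < n" for i j
    proof -
      have "(X * Y) $$ (i, j) - (Y * X) $$ (i, j) = (X * Y - Y * X) $$ (i, j)"
        using that XY by (intro index_minus_mat(1)[symmetric]) auto
      then have "(X * Y) $$ (i, j) - (Y * X) $$ (i, j) - (Y * Y) $$ (i, j) = 0" unfolding XY(4) by simp
      then show ?thesis
        unfolding mat_prod_entry[OF XY(2,3) that] mat_prod_entry[OF XY(3,2) that] mat_prod_entry[OF XY(3,3) that]
        by (simp add: XY(1))
    qed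
    then show "p \<in> {p \<in> mat_pairs n. \<forall>f\<in>?F. f p = 0}" using XY by (auto simp: mat_pairs_def)
  next
    fix p assume "p \<in> {p \<in> mat_pairs n. \<forall>f\<in>?F. f p = 0}"
    then have *: "p \<in> mat_pairs n \<and> (\<forall>f\<in>?F. f p = 0)" by (rule CollectD)
    note 0 = conjunct2[OF *]
    obtain X Y where XY: "p = (X, Y)" "X \<in> carrier_mat n n" "Y \<in> carrier_mat n n"
      using conjunct1[OF *] unfolding mat_pairs_def by (elim SigmaE)
    have "X * Y - Y * X = Y * Y"
    proof (rule eq_matI)
      fix i j assume "i < dim_row (Y * Y)" "j < dim_col (Y * Y)"
      then have ij: "i < n" "j < n" using XY by auto
      have "?f (i, j) p = 0" by (rule bspec[OF 0], rule imageI) (use ij in simp)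
      then have "(X * Y) $$ (i, j) - (Y * X) $$ (i, j) = (Y * Y) $$ (i, j)"
        unfolding mat_prod_entry[OF XY(2,3) ij] mat_prod_entry[OF XY(3,2) ij] mat_prod_entry[OF XY(3,3) ij]
        by (simp add: XY(1))
      moreover have "(X * Y - Y * X) $$ (i, j) = (X * Y) $$ (i, j) - (Y * X) $$ (i, j)"
        using ij XY by (intro index_minus_mat(1)) auto
      ultimately show "(X * Y - Y * X) $$ (i, j) = (Y * Y) $$ (i, j)" by simp
    qed (use XY in auto)
    then show "p \<in> mod_R n" using XY by (simp add: mod_R_def)
  qed
qed

lemma irreducible_subset_subtopology:
  assumes "closedin T S"
  shows "irreducible_subset (subtopology T S) A \<longleftrightarrow> irreducible_subset T A \<and> A \<subseteq> S"
proof
  have S: "S \<subseteq> topspace T" using assms by (rule closedin_subset)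
  assume A: "irreducible_subset (subtopology T S) A"
  then have sub: "A \<subseteq> S" by (auto simp: irreducible_subset_def)
  moreover have "irreducible_subset T A"
    unfolding irreducible_subset_def
  proof (intro conjI allI impI)
    show "A \<subseteq> topspace T" using sub S by blast
    show "A \<noteq> {}" using A by (simp add: irreducible_subset_def)
    fix C D assume CD: "closedin T C \<and> closedin T D \<and> A \<subseteq> C \<union> D"
    then have "closedin (subtopology T S) (C \<inter> S)" "closedin (subtopology T S) (D \<inter> S)" "A \<subseteq> C \<inter> S \<union> D \<inter> S"
      using sub by (auto simp: closedin_subtopology)
    from irreducible_subsetD[OF A this] show "A \<subseteq> C \<or> A \<subseteq> D" by auto
  qed
  ultimately show "irreducible_subset T A \<and> A \<subseteq> S" by blast
next
  assume A: "irreducible_subset T A \<and> A \<subseteq> S"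
  show "irreducible_subset (subtopology T S) A"
    unfolding irreducible_subset_def
  proof (intro conjI allI impI)
    show "A \<subseteq> topspace (subtopology T S)" "A \<noteq> {}" using A by (auto simp: irreducible_subset_def)
    fix C D assume "closedin (subtopology T S) C \<and> closedin (subtopology T S) D \<and> A \<subseteq> C \<union> D"
    then have "closedin T C" "closedin T D" "A \<subseteq> C \<union> D"
      using closedin_closed_subtopology[OF assms] by auto
    then show "A \<subseteq> C \<or> A \<subseteq> D" using irreducible_subsetD A by blast
  qed
qed

lemma irreducible_subset_finite_cover:
  assumes A: "irreducible_subset T A" and "finite F" "\<And>Z. Z \<in> F \<Longrightarrow> closedin T Z" "A \<subseteq> \<Union>F"
  shows "\<exists>Z\<in>F. A \<subseteq> Z"
  using assms(2-4)
proof (induction F rule: finite_induct)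
  case empty
  then show ?case using A by (auto simp: irreducible_subset_def)
next
  case (insert Z F)
  have "closedin T (\<Union>F)" using insert by (intro closedin_Union) auto
  from irreducible_subsetD[OF A _ this, of Z] insert show ?case by auto
qed

text \<open>
  An irreducible set that is covered by finitely many closed sets lies in one of them.
\<close>

lemma irreducible_components_antichain:
  assumes fin: "finite F" and F: "\<And>Z. Z \<in> F \<Longrightarrow> closedin T Z \<and> irreducible_subset T Z"
    and cover: "topspace T \<subseteq> \<Union>F" and anti: "\<And>Z Z'. Z \<in> F \<Longrightarrow> Z' \<in> F \<Longrightarrow> Z \<subseteq> Z' \<Longrightarrow> Z = Z'"
  shows "irreducible_components T = F"
proof -
  have in_some: "\<exists>Z\<in>F. A \<subseteq> Z" if "irreducible_subset T A" for A
  proof (rule irreducible_subset_finite_cover[OF that fin])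
    show "A \<subseteq> \<Union>F" using that cover by (auto simp: irreducible_subset_def)
  qed (use F in blast)
  show ?thesis
  proof (intro equalityI subsetI)
    fix Z assume Z: "Z \<in> irreducible_components T"
    then have irr: "irreducible_subset T Z" and max: "\<And>A. irreducible_subset T A \<Longrightarrow> Z \<subseteq> A \<Longrightarrow> A = Z"
      by (auto simp: irreducible_components_def)
    obtain Z' where "Z' \<in> F" "Z \<subseteq> Z'" using in_some[OF irr] by blast
    then show "Z \<in> F" using max[of Z'] F by auto
  next
    fix Z assume Z: "Z \<in> F"
    have "A = Z" if A: "irreducible_subset T A" "Z \<subseteq> A" for A
    proof -
      obtain Z' where Z': "Z' \<in> F" "A \<subseteq> Z'" using in_some[OF A(1)] by blast
      then have "Z = Z'" using anti[OF Z Z'(1)] A(2) by blast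
      then show ?thesis using Z' A(2) by blast
    qed
    then show "Z \<in> irreducible_components T" using F[OF Z] by (auto simp: irreducible_components_def)
  qed
qed

lemma krull_dim_eqI:
  assumes upper: "\<And>k C. \<forall>i\<le>k. closedin T (C i) \<and> irreducible_subset T (C i) \<Longrightarrow> \<forall>i<k. C i \<subset> C (Suc i) \<Longrightarrow> k \<le> d"
    and lower: "\<And>i. closedin T (C i) \<and> irreducible_subset T (C i)" "\<And>i. i < d \<Longrightarrow> C i \<subset> C (Suc i)"
  shows "krull_dim T = enat d"
  unfolding krull_dim_def
proof (rule antisym)
  show "Sup {enat k |k. \<exists>C. (\<forall>i\<le>k. closedin T (C i) \<and> irreducible_subset T (C i)) \<and> (\<forall>i<k. C i \<subset> C (Suc i))} \<le> enat d"
    by (rule Sup_least) (auto intro!: upper)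
  show "enat d \<le> Sup {enat k |k. \<exists>C. (\<forall>i\<le>k. closedin T (C i) \<and> irreducible_subset T (C i)) \<and> (\<forall>i<k. C i \<subset> C (Suc i))}"
    by (rule Sup_upper) (use lower in blast)
qed

lemma stratum_subset: "stratum n P \<subseteq> mod_R n"
  by (auto simp: stratum_def)

lemma mod_R_mat_pairs: "mod_R n \<subseteq> mat_pairs n"
  by (auto simp: mod_R_def mat_pairs_def)

lemma stratum_closure_mod_R: "zariski n closure_of stratum n P \<subseteq> mod_R n"
  by (rule closure_of_minimal[OF stratum_subset closedin_mod_R])

lemma stratum_in_closure: "stratum n P \<subseteq> zariski n closure_of stratum n P"
  using stratum_subset[of n P] mod_R_mat_pairs[of n] by (intro closure_of_subset) auto

lemma closure_of_stratum_in_mod_R: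
  "mod_R_variety n closure_of stratum n P = zariski n closure_of stratum n P"
  unfolding mod_R_variety_def closure_of_subtopology
  using stratum_subset[of n P] stratum_closure_mod_R[of n P] by (simp add: Int_absorb1 Int_absorb2)

lemma stratum_closure_irreducible:
  assumes "P \<in> partitions n"
  shows "irreducible_subset (zariski n) (zariski n closure_of stratum n P)"
proof -
  obtain J X0 where fb: "fibre_bundle n J X0" "fibre_bundle.orbit_family n J = stratum n P"
    using stratum_is_orbit_family[OF assms] by metis
  show ?thesis
    using irreducible_closure_of[OF fibre_bundle.orbit_family_irreducible[OF fb(1)]] fb(2) by simp
qed

lemma stratum_chain_le:
  assumes "P \<in> partitions n"
    and "\<forall>i\<le>k. closedin (zariski n) (C i) \<and> irreducible_subset (zariski n) (C i)"
    and "\<forall>i<k. C i \<subset> C (Suc i)" and "C k \<subseteq> zariski n closure_of stratum n P"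
  shows "k \<le> n\<^sup>2"
proof -
  obtain J X0 where fb: "fibre_bundle n J X0" "fibre_bundle.orbit_family n J = stratum n P"
    using stratum_is_orbit_family[OF assms(1)] by metis
  show ?thesis
    using fibre_bundle.orbit_family_chain_le[OF fb(1) assms(2,3)] assms(4) fb(2) by simp
qed

lemma stratum_chain:
  assumes "P \<in> partitions n"
  shows "\<exists>C. (\<forall>i. closedin (zariski n) (C i) \<and> irreducible_subset (zariski n) (C i) \<and>
      C i \<subseteq> zariski n closure_of stratum n P) \<and> (\<forall>i<n\<^sup>2. C i \<subset> C (Suc i))"
proof -
  obtain J X0 where fb: "fibre_bundle n J X0" "fibre_bundle.orbit_family n J = stratum n P"
    using stratum_is_orbit_family[OF assms] by metis
  show ?thesis
    using fibre_bundle.orbit_family_chain[OF fb(1)] unfolding fb(2) .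
qed

text \<open>
  If the closure of one stratum were properly contained in the closure of another one, its chain of
  length \<open>n\<^sup>2\<close> could be prolonged by the larger closure, which is impossible in dimension \<open>n\<^sup>2\<close>. If the
  closures are equal, the semicontinuity of the ranks of \<open>Y ^\<^sub>m k\<close>, applied in both directions, makes
  the ranks and hence the partitions equal.
\<close>

lemma stratum_in_closure_imp_eq:
  assumes P: "P \<in> partitions n" and Q: "Q \<in> partitions n"
    and sub: "stratum n Q \<subseteq> zariski n closure_of stratum n P"
  shows "P = Q"
proof -
  let ?ZP = "zariski n closure_of stratum n P" and ?ZQ = "zariski n closure_of stratum n Q"
  have le: "?ZQ \<subseteq> ?ZP" using sub by (intro closure_of_minimal) auto
  have "?ZQ = ?ZP"
  proof (rule ccontr)
    assume "?ZQ \<noteq> ?ZP"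
    with le have less: "?ZQ \<subset> ?ZP" by blast
    obtain C where C': "\<forall>i. closedin (zariski n) (C i) \<and> irreducible_subset (zariski n) (C i) \<and> C i \<subseteq> ?ZQ"
      "\<forall>i<n\<^sup>2. C i \<subset> C (Suc i)"
      using stratum_chain[OF Q] by (elim exE conjE)
    have C: "closedin (zariski n) (C i)" "irreducible_subset (zariski n) (C i)" "C i \<subseteq> ?ZQ"
      "i < n\<^sup>2 \<Longrightarrow> C i \<subset> C (Suc i)" for i
      using C' by simp_all
    define D where "D i = (if i \<le> n\<^sup>2 then C i else ?ZP)" for i
    have "\<forall>i\<le>Suc (n\<^sup>2). closedin (zariski n) (D i) \<and> irreducible_subset (zariski n) (D i)"
      using C(1,2) stratum_closure_irreducible[OF P] by (simp add: D_def)
    moreover have "\<forall>i<Suc (n\<^sup>2). D i \<subset> D (Suc i)"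
    proof (intro allI impI)
      fix i assume "i < Suc (n\<^sup>2)"
      then consider "i < n\<^sup>2" | "i = n\<^sup>2" by linarith
      then show "D i \<subset> D (Suc i)"
      proof cases
        case 2
        then show ?thesis using C(3)[of i] less by (auto simp: D_def)
      qed (use C(4) in \<open>simp add: D_def\<close>)
    qed
    moreover have "D (Suc (n\<^sup>2)) \<subseteq> ?ZP" by (simp add: D_def)
    ultimately have "Suc (n\<^sup>2) \<le> n\<^sup>2" by (rule stratum_chain_le[OF P])
    then show False by simp
  qed
  then have "stratum n P \<subseteq> ?ZQ" using stratum_in_closure[of n P] by simp
  from stratum_closure_rank[OF P Q sub] stratum_closure_rank[OF Q P this]
  have "(\<Sum>m\<in>#P. m - k) = (\<Sum>m\<in>#Q. m - k)" for k by (simp add: antisym)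
  then show ?thesis by (rule partition_determined_by_ranks[OF P Q])
qed

lemma irreducible_components_mod_R:
  "irreducible_components (mod_R_variety n) = (\<lambda>P. zariski n closure_of stratum n P) ` partitions n"
proof (rule irreducible_components_antichain)
  show "finite ((\<lambda>P. zariski n closure_of stratum n P) ` partitions n)" using finite_partitions by simp
  show "closedin (mod_R_variety n) Z \<and> irreducible_subset (mod_R_variety n) Z"
    if "Z \<in> (\<lambda>P. zariski n closure_of stratum n P) ` partitions n" for Z
  proof -
    obtain P where P: "P \<in> partitions n" and Z: "Z = zariski n closure_of stratum n P" using \<open>Z \<in> _\<close> by blast
    show ?thesis
      unfolding mod_R_variety_def closedin_closed_subtopology[OF closedin_mod_R]
        irreducible_subset_subtopology[OF closedin_mod_R] Z
      using stratum_closure_irreducible[OF P] stratum_closure_mod_R by simp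
  qed
  show "topspace (mod_R_variety n) \<subseteq> \<Union> ((\<lambda>P. zariski n closure_of stratum n P) ` partitions n)"
  proof -
    have "topspace (mod_R_variety n) \<subseteq> mod_R n" by (simp add: mod_R_variety_def)
    also have "\<dots> \<subseteq> \<Union> ((\<lambda>P. zariski n closure_of stratum n P) ` partitions n)"
      unfolding mod_R_strata using stratum_in_closure by (intro UN_mono) auto
    finally show ?thesis .
  qed
  fix Z Z' assume "Z \<in> (\<lambda>P. zariski n closure_of stratum n P) ` partitions n"
    "Z' \<in> (\<lambda>P. zariski n closure_of stratum n P) ` partitions n" and sub: "Z \<subseteq> Z'"
  then obtain P P' where P: "P \<in> partitions n" "Z = zariski n closure_of stratum n P"
    and P': "P' \<in> partitions n" "Z' = zariski n closure_of stratum n P'" by blast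
  have "stratum n P \<subseteq> Z'" using stratum_in_closure[of n P] P(2) sub by blast
  then have "P' = P" using stratum_in_closure_imp_eq[OF P'(1) P(1)] P'(2) by simp
  then show "Z = Z'" using P(2) P'(2) by simp
qed

lemma krull_dim_stratum_closure:
  assumes P: "P \<in> partitions n"
  shows "krull_dim (subtopology (mod_R_variety n) (zariski n closure_of stratum n P)) = enat (n\<^sup>2)"
proof -
  let ?Z = "zariski n closure_of stratum n P"
  have eq: "subtopology (mod_R_variety n) ?Z = subtopology (zariski n) ?Z"
    unfolding mod_R_variety_def subtopology_subtopology using stratum_closure_mod_R[of n P] by (simp add: Int_absorb1)
  have closed: "closedin (zariski n) ?Z" by simp
  note iff = closedin_closed_subtopology[OF closed] irreducible_subset_subtopology[OF closed]
  obtain C where C': "\<forall>i. closedin (zariski n) (C i) \<and> irreducible_subset (zariski n) (C i) \<and> C i \<subseteq> ?Z"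
    "\<forall>i<n\<^sup>2. C i \<subset> C (Suc i)"
    using stratum_chain[OF P] by (elim exE conjE)
  have C: "closedin (zariski n) (C i)" "irreducible_subset (zariski n) (C i)" "C i \<subseteq> ?Z"
    "i < n\<^sup>2 \<Longrightarrow> C i \<subset> C (Suc i)" for i
    using C' by simp_all
  show ?thesis
    unfolding eq
  proof (rule krull_dim_eqI)
    fix k D assume "\<forall>i\<le>k. closedin (subtopology (zariski n) ?Z) (D i) \<and> irreducible_subset (subtopology (zariski n) ?Z) (D i)"
      and D: "\<forall>i<k. D i \<subset> D (Suc i)"
    then have "\<forall>i\<le>k. closedin (zariski n) (D i) \<and> irreducible_subset (zariski n) (D i)" "D k \<subseteq> ?Z"
      unfolding iff by auto
    then show "k \<le> n\<^sup>2" using stratum_chain_le[OF P _ D] by blast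
  next
    show "closedin (subtopology (zariski n) ?Z) (C i) \<and> irreducible_subset (subtopology (zariski n) ?Z) (C i)" for i
      unfolding iff using C(1-3) by simp
  qed (rule C(4))
qed

theorem theorem12p1:
  fixes n :: nat
  assumes "n \<ge> 1"
  shows "(\<forall>Z \<in> irreducible_components (mod_R_variety n).
            (\<exists>!P. P \<in> partitions n \<and> stratum n P \<subseteq> Z) \<and>
            (\<forall>P \<in> partitions n. stratum n P \<subseteq> Z \<longrightarrow>
               Z = mod_R_variety n closure_of stratum n P)) \<and>
         card (irreducible_components (mod_R_variety n)) = card (partitions n) \<and>
         equidimensional (mod_R_variety n) \<and>
         (\<forall>Z \<in> irreducible_components (mod_R_variety n).
            krull_dim (subtopology (mod_R_variety n) Z) = enat (n\<^sup>2))"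
proof -
  let ?cl = "\<lambda>P. zariski n closure_of stratum n P"
  have inj: "P = Q" if "P \<in> partitions n" "Q \<in> partitions n" "stratum n Q \<subseteq> ?cl P" for P Q
    using that by (rule stratum_in_closure_imp_eq)
  have "inj_on ?cl (partitions n)"
  proof (rule inj_onI)
    fix P Q assume PQ: "P \<in> partitions n" "Q \<in> partitions n" "?cl P = ?cl Q"
    then show "P = Q" using inj[of P Q] stratum_in_closure[of n Q] by simp
  qed
  then have card: "card (irreducible_components (mod_R_variety n)) = card (partitions n)"
    unfolding irreducible_components_mod_R by (rule card_image)
  have dim: "krull_dim (subtopology (mod_R_variety n) Z) = enat (n\<^sup>2)"
    if "Z \<in> irreducible_components (mod_R_variety n)" for Z
    using that krull_dim_stratum_closure unfolding irreducible_components_mod_R by blast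
  have "(\<exists>!P. P \<in> partitions n \<and> stratum n P \<subseteq> Z) \<and>
      (\<forall>P \<in> partitions n. stratum n P \<subseteq> Z \<longrightarrow> Z = mod_R_variety n closure_of stratum n P)"
    if "Z \<in> irreducible_components (mod_R_variety n)" for Z
  proof -
    obtain P where P: "P \<in> partitions n" "Z = ?cl P"
      using \<open>Z \<in> _\<close> unfolding irreducible_components_mod_R by blast
    have only: "Q = P" if "Q \<in> partitions n" "stratum n Q \<subseteq> Z" for Q
      using inj[OF P(1) that(1)] that(2) P(2) by simp
    have "stratum n P \<subseteq> Z" using stratum_in_closure[of n P] P(2) by simp
    then have "\<exists>!P. P \<in> partitions n \<and> stratum n P \<subseteq> Z"
      by (intro ex1I[of _ P] conjI P(1)) (simp_all only: only)
    moreover have "Z = mod_R_variety n closure_of stratum n Q" if "Q \<in> partitions n" "stratum n Q \<subseteq> Z" for Q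
      unfolding closure_of_stratum_in_mod_R only[OF that] by (rule P(2))
    ultimately show ?thesis by blast
  qed
  then show ?thesis using card dim unfolding equidimensional_def by simp
qed

end
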